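(* Assume the setting below, on the A-mesh $S_{1/\varepsilon}$ (i.e. $\lambda=\varepsilon^{-1}$) with mesh parameter $a>3$. There exist $N_0$ and $C$, both independent of $\varepsilon$, such that for all $N\ge N_0$, \[ \|w^N-W^N\|\le C\max\left\{\varepsilon|\ln\varepsilon|^3N^{-2},\ \varepsilon N^{-1}\right\}. \]
   Context: Let $0<\varepsilon<1$. Let $b,c,f\in C^4[0,1]$, and let $\beta$ be a constant with $b(x)>\beta>0$ and $c(x)\ge0$ on $[0,1]$. Let $u$ be the solution of $-\varepsilon u''-bu'+cu=f$ on $(0,1)$ with $u(0)=u(1)=0$. Let $u_0$ be the solution of $-bu_0'+cu_0=f$ on $(0,1)$ with $u_0(1)=0$. Set $w=u-u_0$. Mesh $S_\lambda$, $\lambda\in\{N,\varepsilon^{-1}\}$. $N$ is a positive integer. $Q\in(0,1)$ is a fixed rational with $J=QN$ an integer, and $a>0$. Set $\xi=(a\varepsilon/\beta)\ln\lambda$, assumed $\le Q$, and $h=\xi/J$, $H=(1-\xi)/(N-J)$. The mesh points are $x_i=ih$ ($0\le i\le J$) and $x_i=\xi+(i-J)H$ ($J\le i\le N$). Write $h_i=x_i-x_{i-1}$ and $\hbar_i=(h_i+h_{i+1})/2$. Scheme. $D^+U_i=(U_{i+1}-U_i)/h_{i+1}$, $D^-U_i=(U_i-U_{i-1})/h_i$, $D''U_i=(D^+U_i-D^-U_i)/\hbar_i$. Let $\sigma(\rho)=2\rho/(e^{2\rho}-1)$ for $\rho>0$, $\sigma(0)=1$, and $\rho_i=b(x_i)h_{i+1}/(2\varepsilon)$.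 The ASI operator is $L^NU_i=-\varepsilon\sigma(\rho_i)D''U_i-b(x_i)D^+U_i+c(x_i)U_i$. $W^N$ solves $W^N_0=-u_0(0)$, $L^NW^N_i=\varepsilon u_0''(x_i)$ for $1\le i\le N-1$, $W^N_N=0$. $w^N$ is the restriction of $w$ to the mesh, and $\|U\|=\max_i|U_i|$. *)

theory Defs
  imports "HOL-Analysis.Analysis"
begin

definition C_k_01 :: "nat \<Rightarrow> (real \<Rightarrow> real) \<Rightarrow> bool" where
  "C_k_01 k g \<longleftrightarrow> (\<exists>d :: nat \<Rightarrow> real \<Rightarrow> real. d 0 = g \<and>
     (\<forall>j<k. \<forall>x\<in>{0..1}. (d j has_real_derivative d (Suc j) x) (at x within {0..1})) \<and>
     continuous_on {0..1} (d k))"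

definition mesh_xi :: "real \<Rightarrow> real \<Rightarrow> real \<Rightarrow> real \<Rightarrow> real" where
  "mesh_xi a \<beta> \<epsilon> lam = (a * \<epsilon> / \<beta>) * ln lam"

definition mesh_pt :: "nat \<Rightarrow> nat \<Rightarrow> real \<Rightarrow> nat \<Rightarrow> real" where
  "mesh_pt N J \<xi> i =
     (if i \<le> J then real i * (\<xi> / real J)
      else \<xi> + real (i - J) * ((1 - \<xi>) / (real N - real J)))"

definition sigma_fit :: "real \<Rightarrow> real" where
  "sigma_fit \<rho> = (if \<rho> = 0 then 1 else 2 * \<rho> / (exp (2 * \<rho>) - 1))"

definition ASI_op :: "real \<Rightarrow> (real \<Rightarrow> real) \<Rightarrow> (real \<Rightarrow> real) \<Rightarrow> (nat \<Rightarrow> real)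
                      \<Rightarrow> (nat \<Rightarrow> real) \<Rightarrow> nat \<Rightarrow> real" where
  "ASI_op \<epsilon> b c x U i =
     (let hi = x i - x (i - 1); hi1 = x (i + 1) - x i; hb = (hi + hi1) / 2;
          Dp = (U (i + 1) - U i) / hi1; Dm = (U i - U (i - 1)) / hi;
          D2 = (Dp - Dm) / hb; \<rho> = b (x i) * hi1 / (2 * \<epsilon>)
      in - \<epsilon> * sigma_fit \<rho> * D2 - b (x i) * Dp + c (x i) * U i)"

end

theory Submission
  imports Defs
begin

text \<open>The scheme is fitted to the layer function \<open>E x = exp (- b 0 * x / \<epsilon>)\<close>, so one splits
  \<open>u - u0 = \<gamma> E + z\<close> with \<open>\<gamma> = - u0 0\<close>. The remainder \<open>z\<close> vanishes at \<open>0\<close>, which makes it smaller than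
  the layer by a factor \<open>\<epsilon>\<close>: by the maximum principle \<open>z = O(\<epsilon>)\<close>, and two
  first-order estimates (for \<open>z'\<close> and \<open>z''\<close>) give, with \<open>e = exp (- \<kappa> x / \<epsilon>)\<close> and \<open>\<kappa> = 2 \<beta> / 3\<close>,
  \<open>z'' = O(\<epsilon> + e / \<epsilon>)\<close>, \<open>z''' = O(1 + e / \<epsilon>\<^sup>2)\<close> and \<open>z'''' = O(1 / \<epsilon>\<^sup>3)\<close>.
  On the fine part both \<open>E\<close> (because of the exponential fitting) and \<open>z\<close> (by Taylor expansion, where the
  upwind error cancels against the linear term of \<open>\<sigma>\<close>) have truncation error \<open>O((h / \<epsilon>)\<^sup>2)\<close>; from the
  transition point on, \<open>a > 3\<close> gives \<open>exp (- \<beta> x / \<epsilon>) \<le> \<epsilon>\<^sup>3\<close>, also one mesh point to the left of it once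
  \<open>N\<close> is large, and the first-order truncation error is \<open>O(\<epsilon> / N)\<close>. A discrete barrier that
  decreases linearly on the fine part turns the fine truncation error into
  \<open>O((h / \<epsilon>)\<^sup>2 (\<xi> + \<epsilon>))\<close>, which is where the cube of the logarithm comes from.\<close>

section \<open>Continuous estimates\<close>

text \<open>Taylor expansion alone cannot treat the layer function: on the fine part it would give a
  truncation error of order \<open>h\<^sup>2 / \<epsilon>\<^sup>3\<close>, one power of 1/\<epsilon>
  too many. The remainder is smaller by exactly this power, so the splitting separates what needs
  the precise form of the fitting from what needs only consistency. A second obstacle is that
  \<open>N0\<close> must not depend on \<epsilon>, while h/\<epsilon> is proportional to
  ln(1/\<epsilon>)/N. Hence h may exceed \<epsilon>, and h/\<epsilon> is never assumed small. For
  the layer function this forces two regimes; when h > \<epsilon>, boundedness of \<xi>^2/\<epsilon>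
  keeps the exponents b(x_i) h/\<epsilon> and b(0) h/\<epsilon> within a bounded distance of each
  other. Finally, \<open>u\<close> and \<open>u0\<close> are only known to be twice differentiable,
  and only inside the interval. All higher derivatives therefore come from the differentiated
  equations, and the estimates for z' and z'' start from a point in (0, \<epsilon>) instead of the
  endpoint 0. Starting near 0 is right because solutions of the homogeneous equation \<epsilon> y' +
  b y = 0 decay from there.\<close>

lemma taylor_bound_open:
  fixes d :: "nat \<Rightarrow> real \<Rightarrow> real"
  assumes cont: "continuous_on {l..r} (d 0)"
    and der: "\<And>m t. m < n \<Longrightarrow> l < t \<Longrightarrow> t < r \<Longrightarrow> (d m has_real_derivative d (Suc m) t) (at t)"
    and bd: "\<And>t. l < t \<Longrightarrow> t < r \<Longrightarrow> \<bar>d n t\<bar> \<le> B"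
    and n: "n > 0" and x: "l < x" "x < r" and y: "l \<le> y" "y \<le> r"
  shows "\<bar>d 0 y - (\<Sum>m<n. d m x / fact m * (y - x) ^ m)\<bar> \<le> B / fact n * \<bar>y - x\<bar> ^ n"
proof -
  have inner: "\<bar>d 0 y - (\<Sum>m<n. d m x / fact m * (y - x) ^ m)\<bar> - B / fact n * \<bar>y - x\<bar> ^ n \<le> 0"
    if "y \<in> {l<..<r}" for y
  proof (cases "y = x")
    case True
    have "(\<Sum>m<n. d m x / fact m * (x - x) ^ m) = (\<Sum>m\<in>{0}. d m x / fact m * (x - x) ^ m)"
      using n by (intro sum.mono_neutral_right) auto
    then show ?thesis using True n by (simp add: zero_power)
  next
    case False
    have "\<exists>t. (if y < x then y < t \<and> t < x else x < t \<and> t < y) \<and>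
        d 0 y = (\<Sum>m<n. d m x / fact m * (y - x) ^ m) + d n t / fact n * (y - x) ^ n"
      using that x False
      by (intro Taylor[OF n, of d "d 0" "min x y" "max x y"]) (auto intro!: der)
    then obtain t where t': "if y < x then y < t \<and> t < x else x < t \<and> t < y"
      and eq: "d 0 y = (\<Sum>m<n. d m x / fact m * (y - x) ^ m) + d n t / fact n * (y - x) ^ n"
      by blast
    have t: "l < t" "t < r" using t' that x by (auto split: if_splits)
    have "\<bar>d n t / fact n * (y - x) ^ n\<bar> \<le> B / fact n * \<bar>y - x\<bar> ^ n"
      unfolding abs_mult power_abs abs_divide
      by (intro mult_right_mono) (auto intro!: divide_right_mono bd t)
    then show ?thesis using eq by simp
  qed
  \<comment> \<open>Taylor's formula is available only for interior \<open>y\<close>. Continuity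
    carries the inequality to the ends, which matters because the outermost stencils reach 0 and
    1.\<close>
  have cl: "closure {l<..<r} = {l..r}" using x by simp
  show ?thesis
    using continuous_le_on_closure[of "{l<..<r}"
      "\<lambda>y. \<bar>d 0 y - (\<Sum>m<n. d m x / fact m * (y - x) ^ m)\<bar> - B / fact n * \<bar>y - x\<bar> ^ n" y 0]
      inner y unfolding cl by (fastforce intro!: continuous_intros cont)
qed

section \<open>Comparison principle for the differential operator\<close>

lemma interior_min_derivatives:
  fixes \<phi> \<phi>' :: "real \<Rightarrow> real"
  assumes x: "l < x" "x < r"
    and der: "\<And>t. l < t \<Longrightarrow> t < r \<Longrightarrow> (\<phi> has_real_derivative \<phi>' t) (at t)"
    and der2: "(\<phi>' has_real_derivative D) (at x)"
    and min: "\<And>t. l < t \<Longrightarrow> t < r \<Longrightarrow> \<phi> x \<le> \<phi> t"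
  shows "\<phi>' x = 0" "0 \<le> D"
proof -
  show 0: "\<phi>' x = 0"
    by (rule DERIV_local_min[OF der[OF x], of "min (x - l) (r - x)"]) (use x in \<open>auto intro!: min\<close>)
  show "0 \<le> D"
  proof (rule ccontr)
    assume "\<not> 0 \<le> D"
    then obtain d where d: "d > 0" "\<And>h. 0 < h \<Longrightarrow> h < d \<Longrightarrow> \<phi>' (x + h) < \<phi>' x"
      using DERIV_neg_dec_right[OF der2] by auto
    \<comment> \<open>The point \<open>y\<close> stays inside the interval and within the range
      where \<phi>' is negative. The mean value theorem then contradicts minimality without
      continuity of the second derivative.\<close>
    define y where "y = x + min (d / 2) ((r - x) / 2)"
    have y: "x < y" "y < r" "y < x + d" using d x by (auto simp: y_def min_def field_simps)
    obtain t where t: "x < t" "t < y" "\<phi> y - \<phi> x = (y - x) * \<phi>' t"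
      using MVT2[of x y \<phi> \<phi>'] y x der by force
    have "\<phi>' t < 0" using d(2)[of "t - x"] t y 0 by auto
    then have "\<phi> y < \<phi> x" using t y by (smt (verit) mult_pos_neg)
    then show False using min[of y] y x by auto
  qed
qed

text \<open>At a negative interior minimum the convection term vanishes and the other two terms are
  nonpositive, against the strict inequality \<open>L\<close>. Strictness replaces the usual
  perturbation argument; the barrier used later carries a slack for it.\<close>

lemma maximum_principle:
  fixes \<phi> \<phi>' \<phi>'' b c :: "real \<Rightarrow> real"
  assumes eps: "\<epsilon> > 0" and cont: "continuous_on {0..1} \<phi>" and bnd: "0 \<le> \<phi> 0" "0 \<le> \<phi> 1"
    and der: "\<And>t. 0 < t \<Longrightarrow> t < 1 \<Longrightarrow> (\<phi> has_real_derivative \<phi>' t) (at t)"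
    and der2: "\<And>t. 0 < t \<Longrightarrow> t < 1 \<Longrightarrow> (\<phi>' has_real_derivative \<phi>'' t) (at t)"
    and c: "\<And>t. 0 < t \<Longrightarrow> t < 1 \<Longrightarrow> 0 \<le> c t"
    and L: "\<And>t. 0 < t \<Longrightarrow> t < 1 \<Longrightarrow> 0 < - \<epsilon> * \<phi>'' t - b t * \<phi>' t + c t * \<phi> t"
    and x: "x \<in> {0..1}"
  shows "0 \<le> \<phi> x"
proof (rule ccontr)
  assume neg: "\<not> 0 \<le> \<phi> x"
  obtain m where m: "m \<in> {0..1}" "\<And>t. t \<in> {0..1} \<Longrightarrow> \<phi> m \<le> \<phi> t"
    using continuous_attains_inf[OF compact_Icc _ cont] by auto
  have m_neg: "\<phi> m < 0" using m(2)[OF x] neg by simp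
  then have m01: "0 < m" "m < 1" using m(1) bnd by (auto simp: less_le)
  have "\<phi>' m = 0" "0 \<le> \<phi>'' m"
    using interior_min_derivatives[OF m01 der der2[OF m01]] m(2) by auto
  moreover have "c m * \<phi> m \<le> 0" using c[OF m01] m_neg by (simp add: mult_nonneg_nonpos)
  moreover have "0 \<le> \<epsilon> * \<phi>'' m" using calculation eps by simp
  ultimately show False using L[OF m01] by simp
qed

section \<open>Layer estimates for first-order equations\<close>

lemma antiderivative_on_unit_interval:
  fixes b :: "real \<Rightarrow> real"
  assumes cont: "continuous_on {0..1} b" and b: "\<And>x. x \<in> {0..1} \<Longrightarrow> 0 \<le> b x \<and> b x \<le> M"
  shows "\<exists>P. \<forall>x. 0 < x \<and> x < 1 \<longrightarrow> (P has_real_derivative b x) (at x) \<and> 0 \<le> P x \<and> P x \<le> M * x"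
proof -
  define P where "P = (\<lambda>x. integral {0..x} b)"
  have w: "(P has_real_derivative b x) (at x within {0..1})" if "x \<in> {0..1}" for x
    unfolding P_def using integral_has_real_derivative[OF cont that] .
  have d: "(P has_real_derivative b x) (at x)" if "0 < x" "x < 1" for x
    using w[of x] that at_within_Icc_at[of 0 x 1] by auto
  have cP: "continuous_on {0..1} P"
    using w by (rule DERIV_continuous_on)
  have "0 \<le> P x \<and> P x \<le> M * x" if x: "0 < x" "x < 1" for x
  proof -
    obtain t where t: "0 < t" "t < x" "P x - P 0 = (x - 0) * b t"
    proof -
      have "continuous_on {0..x} P" using cP x by (auto intro: continuous_on_subset)
      moreover have "P differentiable (at t)" if "0 < t" "t < x" for t
        using d[of t] that x by (auto simp: real_differentiable_def)
      ultimately obtain l t where "0 < t" "t < x" "DERIV P t :> l" "P x - P 0 = (x - 0) * l"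
        using MVT[OF x(1)] by blast
      moreover have "l = b t" using calculation x by (intro DERIV_unique[OF _ d]) auto
      ultimately show ?thesis using that by auto
    qed
    have "P 0 = 0" by (simp add: P_def)
    then show ?thesis using t b[of t] x by (auto simp: mult.commute intro: mult_right_mono)
  qed
  then show ?thesis using d by blast
qed

text \<open>Multiplying by the integrating factor \<open>exp (P x / \<epsilon>)\<close> turns the equation into a statement
  about monotonicity. To the right of the anchor \<open>s\<close> the bound is a supersolution; to the left of
  it the factor stays bounded because \<open>s < \<epsilon>\<close>.\<close>

lemma first_order_layer_bound:
  fixes y y' b G :: "real \<Rightarrow> real"
  assumes eps: "0 < \<epsilon>" "\<epsilon> < 1" and cont: "continuous_on {0..1} b"
    and b: "\<And>x. x \<in> {0..1} \<Longrightarrow> \<beta> \<le> b x \<and> b x \<le> M"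
    and k: "0 < \<kappa>" "\<kappa> < \<beta>"
    and der: "\<And>x. 0 < x \<Longrightarrow> x < 1 \<Longrightarrow> (y has_real_derivative y' x) (at x)"
    and ode: "\<And>x. 0 < x \<Longrightarrow> x < 1 \<Longrightarrow> \<epsilon> * y' x + b x * y x = G x"
    and G: "\<And>x. 0 < x \<Longrightarrow> x < 1 \<Longrightarrow> \<bar>G x\<bar> \<le> A + B * exp (- \<kappa> * x / \<epsilon>)"
    and AB: "0 \<le> A" "0 \<le> B" and s: "0 < s" "s < \<epsilon>" "\<bar>y s\<bar> \<le> Y"
    and x: "0 < x" "x < 1"
  shows "\<bar>y x\<bar> \<le> A / \<beta> + (B / (\<beta> - \<kappa>) + exp (2 * M) * (Y + A + B)) * exp (- \<kappa> * x / \<epsilon>)"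
proof -
  have \<beta>M: "0 < \<beta>" "\<beta> \<le> M" using k b[of 0] by auto
  have kM: "\<kappa> \<le> M" using k \<beta>M by simp
  have Y0: "0 \<le> Y" using s by linarith
  have b': "0 \<le> b x \<and> b x \<le> M" if "x \<in> {0..1}" for x
    using b[OF that] \<beta>M by simp
  obtain P where P: "\<And>x. 0 < x \<Longrightarrow> x < 1 \<Longrightarrow> (P has_real_derivative b x) (at x)"
    and P_bd: "\<And>x. 0 < x \<Longrightarrow> x < 1 \<Longrightarrow> 0 \<le> P x \<and> P x \<le> M * x"
    using antiderivative_on_unit_interval[OF cont b'] by blast
  \<comment> \<open>The first summand makes the bound a supersolution to the right of
    \<open>s\<close>; the second covers points below \<epsilon>. There one factor
    \<open>exp M\<close> comes from the integrating factor, and the other from replacing 1 by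
    exp(-\<kappa> t/\<epsilon>), which loses at most \<open>exp M\<close> since \<kappa> \<le> M and
    t < \<epsilon>.\<close>
  define D where "D = B / (\<beta> - \<kappa>) + exp (2 * M) * (Y + A + B)"
  have "0 \<le> exp (2 * M) * (Y + A + B)" "0 \<le> B / (\<beta> - \<kappa>)" using k AB Y0 by auto
  then have D0: "0 \<le> D" "exp (2 * M) * (Y + A + B) \<le> D" "B / (\<beta> - \<kappa>) \<le> D"
    unfolding D_def by linarith+
  then have D1: "B \<le> D * (\<beta> - \<kappa>)" using k by (simp add: pos_divide_le_eq)
  have scaled: "c \<le> D * exp (- \<kappa> * t / \<epsilon>)" if "0 < t" "t < \<epsilon>" "c \<le> exp M * (Y + A + B)" for c t
  proof -
    have "\<kappa> * t \<le> M * \<epsilon>" using that kM k eps by (intro mult_mono) auto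
    then have "M + \<kappa> * t / \<epsilon> \<le> 2 * M" using eps by (simp add: field_simps)
    then have "exp M \<le> exp (2 * M) * exp (- \<kappa> * t / \<epsilon>)"
      unfolding exp_add[symmetric] by simp
    then have "exp M * (Y + A + B) \<le> exp (2 * M) * exp (- \<kappa> * t / \<epsilon>) * (Y + A + B)"
      using Y0 AB by (intro mult_right_mono) auto
    also have "\<dots> \<le> D * exp (- \<kappa> * t / \<epsilon>)" using D0(2) by (simp add: mult.commute mult.left_commute)
    finally show ?thesis using that by linarith
  qed
  show ?thesis
  proof (cases "x < s")
    case True
    define g where "g = (\<lambda>t. y t * exp (P t / \<epsilon>))"
    have "(g has_real_derivative exp (P t / \<epsilon>) * G t / \<epsilon>) (at t)" if "x \<le> t" "t \<le> s" for t
    proof -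
      have t01: "0 < t" "t < 1" using that x s eps by auto
      have "(g has_real_derivative y' t * exp (P t / \<epsilon>) + exp (P t / \<epsilon>) * (b t / \<epsilon>) * y t) (at t)"
        unfolding g_def using eps by (auto intro!: derivative_eq_intros der P t01)
      moreover have "y' t * exp (P t / \<epsilon>) + exp (P t / \<epsilon>) * (b t / \<epsilon>) * y t = exp (P t / \<epsilon>) * G t / \<epsilon>"
        unfolding ode[OF t01, symmetric] using eps by (simp add: field_simps)
      ultimately show ?thesis by simp
    qed
    from MVT2[OF True this]
    obtain t where t: "x < t" "t < s" "g s - g x = (s - x) * (exp (P t / \<epsilon>) * G t / \<epsilon>)" by blast
    have expM: "exp (P t / \<epsilon>) \<le> exp M" if "0 < t" "t \<le> s" for t
    proof -
      have "P t \<le> M * \<epsilon>" using P_bd[of t] that s eps \<beta>M mult_left_mono[of t \<epsilon> M]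
        by linarith
      then show ?thesis using eps by (simp add: field_simps)
    qed
    have "exp (- \<kappa> * t / \<epsilon>) \<le> 1" using t x k eps by simp
    then have "\<bar>G t\<bar> \<le> A + B" using G[of t] t x s eps AB
        mult_left_le[of "exp (- \<kappa> * t / \<epsilon>)" B] by linarith
    then have "exp (P t / \<epsilon>) * \<bar>G t\<bar> \<le> exp M * (A + B)"
      using expM[of t] t x s by (intro mult_mono) auto
    then have "(s - x) / \<epsilon> * (exp (P t / \<epsilon>) * \<bar>G t\<bar>) \<le> 1 * (exp M * (A + B))"
      using x s eps AB True by (intro mult_mono[OF _ _ zero_le_one]) (auto simp: field_simps)
    moreover have "\<bar>g s - g x\<bar> = (s - x) / \<epsilon> * (exp (P t / \<epsilon>) * \<bar>G t\<bar>)" unfolding t(3)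
      using eps True by (simp add: abs_mult)
    ultimately have "\<bar>g s - g x\<bar> \<le> exp M * (A + B)" by simp
    moreover have "\<bar>g s\<bar> \<le> Y * exp M" unfolding g_def abs_mult
      using s Y0 expM[of s] by (intro mult_mono) auto
    moreover have "\<bar>y x\<bar> \<le> \<bar>g x\<bar>"
      using P_bd[of x] x eps by (auto simp: g_def abs_mult mult_le_cancel_left1)
    ultimately have "\<bar>y x\<bar> \<le> exp M * (Y + A + B)" by (simp add: algebra_simps)
    then have "\<bar>y x\<bar> \<le> D * exp (- \<kappa> * x / \<epsilon>)" using scaled[of x] True x s by auto
    moreover have "0 \<le> A / \<beta>" using AB \<beta>M by simp
    ultimately show ?thesis unfolding D_def by linarith
  next
    case False
    \<comment> \<open>The sign \<open>\<tau>\<close> treats both halves of the absolute value at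
      once. With \<open>v\<close> the claimed bound minus \<open>\<tau> * y\<close>, the product of
      \<open>v\<close> and the integrating factor is nondecreasing, so nonnegativity travels from
      \<open>s\<close> to \<open>x\<close>.\<close>
    have "\<tau> * y x \<le> A / \<beta> + D * exp (- \<kappa> * x / \<epsilon>)" if \<tau>: "\<tau> = 1 \<or> \<tau> = -1" for \<tau> :: real
    proof -
      define v where "v = (\<lambda>t. A / \<beta> + D * exp (- \<kappa> * t / \<epsilon>) - \<tau> * y t)"
      define g where "g = (\<lambda>t. v t * exp (P t / \<epsilon>))"
      have incr: "\<exists>d. (g has_real_derivative d) (at t) \<and> 0 \<le> d" if t: "s \<le> t" "t \<le> x" for t
      proof -
        have t01: "0 < t" "t < 1" using t s x by auto
        have bt: "\<beta> \<le> b t" using b[of t] t01 by simp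
        have 1: "A \<le> b t * (A / \<beta>)"
          using mult_right_mono[OF bt, of "A / \<beta>"] AB \<beta>M by simp
        have "B * exp (- \<kappa> * t / \<epsilon>) \<le> D * (\<beta> - \<kappa>) * exp (- \<kappa> * t / \<epsilon>)"
          using D1 by (intro mult_right_mono) auto
        also have "\<dots> \<le> D * (b t - \<kappa>) * exp (- \<kappa> * t / \<epsilon>)"
          using D0 bt by (intro mult_right_mono mult_left_mono) auto
        finally have 2: "B * exp (- \<kappa> * t / \<epsilon>) \<le> D * (b t - \<kappa>) * exp (- \<kappa> * t / \<epsilon>)" .
        have "\<tau> * G t \<le> \<bar>G t\<bar>" using \<tau> by auto
        then have nn: "0 \<le> b t * (A / \<beta>) + D * (b t - \<kappa>) * exp (- \<kappa> * t / \<epsilon>) - \<tau> * G t"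
          using 1 2 G[OF t01] by linarith
        have D': "(g has_real_derivative (D * (exp (- \<kappa> * t / \<epsilon>) * (- \<kappa> / \<epsilon>)) - \<tau> * y' t) * exp (P t / \<epsilon>)
            + exp (P t / \<epsilon>) * (b t / \<epsilon>) * v t) (at t)"
          unfolding g_def v_def using eps by (auto intro!: derivative_eq_intros der P t01)
        have eq: "(D * (exp (- \<kappa> * t / \<epsilon>) * (- \<kappa> / \<epsilon>)) - \<tau> * y' t) * exp (P t / \<epsilon>)
            + exp (P t / \<epsilon>) * (b t / \<epsilon>) * v t
            = (b t * (A / \<beta>) + D * (b t - \<kappa>) * exp (- \<kappa> * t / \<epsilon>) - \<tau> * G t) * exp (P t / \<epsilon>) / \<epsilon>"
          unfolding ode[OF t01, symmetric] v_def using eps \<beta>M by (simp add: field_simps)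
        have "0 \<le> (b t * (A / \<beta>) + D * (b t - \<kappa>) * exp (- \<kappa> * t / \<epsilon>) - \<tau> * G t) * exp (P t / \<epsilon>) / \<epsilon>"
          using nn eps by (intro divide_nonneg_pos mult_nonneg_nonneg) auto
        then show ?thesis using D' unfolding eq by blast
      qed
      have "g s \<le> g x" by (rule DERIV_nonneg_imp_nondecreasing[OF _ incr]) (use False in simp_all)
      moreover have "0 \<le> g s"
      proof -
        have "\<tau> * y s \<le> Y" using s \<tau> by auto
        moreover have "Y \<le> exp M * (Y + A + B)"
          using Y0 AB \<beta>M mult_mono[of 1 "exp M" Y "Y + A + B"] by auto
        ultimately have "\<tau> * y s \<le> D * exp (- \<kappa> * s / \<epsilon>)" using scaled[of s Y] s by linarith
        moreover have "0 \<le> A / \<beta>" using AB \<beta>M by simp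
        ultimately show ?thesis by (simp add: g_def v_def)
      qed
      ultimately have "0 \<le> g x" by linarith
      then have "0 \<le> v x" unfolding g_def by (simp add: zero_le_mult_iff)
      then show ?thesis by (simp add: v_def)
    qed
    from this[of 1] this[of "-1"] show ?thesis unfolding D_def by auto
  qed
qed

section \<open>Truncation error and discrete stability\<close>

text \<open>The last two bounds put \<sigma> within \<rho>^2 of its linearisation 1 - \<rho> for
  every \<rho> \<ge> 0, since \<rho> is large whenever h is large against \<epsilon>. With t = 2
  \<rho>, the lower one is monotonicity of t - (1 - t/2)(e^t - 1), and the upper one rests on e^t -
  1 \<ge> t + t^2/2.\<close>

lemma sigma_fit_bounds:
  assumes "0 \<le> \<rho>"
  shows "0 < sigma_fit \<rho>" "sigma_fit \<rho> \<le> 1" "1 - \<rho> \<le> sigma_fit \<rho>" "sigma_fit \<rho> \<le> 1 - \<rho> + \<rho>\<^sup>2"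
proof -
  have "0 < sigma_fit \<rho> \<and> sigma_fit \<rho> \<le> 1 \<and> 1 - \<rho> \<le> sigma_fit \<rho> \<and> sigma_fit \<rho> \<le> 1 - \<rho> + \<rho>\<^sup>2"
  proof (cases "\<rho> = 0")
    case True
    then show ?thesis by (simp add: sigma_fit_def)
  next
    case False
    define t where "t = 2 * \<rho>"
    have t: "0 < t" "\<rho> = t / 2" using False assms by (auto simp: t_def)
    have e: "0 < exp t - 1" using t by simp
    have s: "sigma_fit \<rho> = t / (exp t - 1)" using False by (simp add: sigma_fit_def t_def)
    have quad: "1 + t + t\<^sup>2 / 2 \<le> exp t" using exp_lower_Taylor_quadratic t by simp
    define F :: "real \<Rightarrow> real" where "F = (\<lambda>t. t - (1 - t / 2) * (exp t - 1))"
    have "F 0 \<le> F t"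
    proof (rule DERIV_nonneg_imp_nondecreasing[of 0 t F])
      fix x :: real
      have "(F has_real_derivative (1 - exp x * (1 - x)) / 2) (at x)"
        unfolding F_def by (auto intro!: derivative_eq_intros simp: field_simps)
      moreover have "exp x * (1 - x) \<le> exp x * exp (- x)"
        using exp_ge_add_one_self[of "- x"] by (intro mult_left_mono) auto
      then have "0 \<le> (1 - exp x * (1 - x)) / 2" by (simp flip: exp_add)
      ultimately show "\<exists>y. (F has_real_derivative y) (at x) \<and> 0 \<le> y" by blast
    qed (use t in auto)
    then have 3: "1 - \<rho> \<le> sigma_fit \<rho>" using e unfolding s unfolding t(2) F_def by (simp add: le_divide_eq)
    \<comment> \<open>The product (1 - t/2 + t^2/4)(t + t^2/2) collapses to t + t^4/8, so the
      quadratic lower bound for exp is already enough.\<close>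
    have "t \<le> t + t * (t * (t * t)) / 8" using t by simp
    also have "\<dots> = (1 - t / 2 + (t / 2)\<^sup>2) * (t + t\<^sup>2 / 2)" by (simp add: power2_eq_square field_simps)
    also have "\<dots> \<le> (1 - t / 2 + (t / 2)\<^sup>2) * (exp t - 1)"
    proof (rule mult_left_mono)
      have "1 - t / 2 + (t / 2)\<^sup>2 = (1 - t / 4)\<^sup>2 + 3 * (t / 4)\<^sup>2"
        by (simp add: power2_eq_square field_simps)
      then show "0 \<le> 1 - t / 2 + (t / 2)\<^sup>2" by simp
    qed (use quad in simp)
    finally have 4: "sigma_fit \<rho> \<le> 1 - \<rho> + \<rho>\<^sup>2" using e unfolding s unfolding t(2) by (simp add: divide_le_eq)
    have 1: "0 < sigma_fit \<rho>" using t e by (simp add: s)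
    have "t \<le> exp t - 1" using exp_ge_add_one_self[of t] by linarith
    then have 2: "sigma_fit \<rho> \<le> 1" using e by (simp add: s)
    show ?thesis using 1 2 3 4 by blast
  qed
  then show "0 < sigma_fit \<rho>" "sigma_fit \<rho> \<le> 1" "1 - \<rho> \<le> sigma_fit \<rho>"
    "sigma_fit \<rho> \<le> 1 - \<rho> + \<rho>\<^sup>2" by auto
qed

section \<open>Consistency error for smooth functions\<close>

lemma ASI_op_split:
  fixes g g1 g2 b c :: "real \<Rightarrow> real" and x :: "nat \<Rightarrow> real" and i :: nat
  assumes "\<epsilon> > 0"
  defines "hp \<equiv> x (i + 1) - x i" and "hm \<equiv> x i - x (i - 1)"
  defines "Dp \<equiv> (g (x (i + 1)) - g (x i)) / hp" and "Dm \<equiv> (g (x i) - g (x (i - 1))) / hm"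
  defines "D2 \<equiv> (Dp - Dm) / ((hm + hp) / 2)" and "\<sigma> \<equiv> sigma_fit (b (x i) * hp / (2 * \<epsilon>))"
  shows "ASI_op \<epsilon> b c x (\<lambda>j. g (x j)) i - (- \<epsilon> * g2 (x i) - b (x i) * g1 (x i) + c (x i) * g (x i))
    = - (\<epsilon> * \<sigma> * (D2 - g2 (x i))) + \<epsilon> * (1 - \<sigma>) * g2 (x i) - b (x i) * (Dp - g1 (x i))"
proof -
  have "ASI_op \<epsilon> b c x (\<lambda>j. g (x j)) i = - \<epsilon> * \<sigma> * D2 - b (x i) * Dp + c (x i) * g (x i)"
    unfolding ASI_op_def Let_def assms(2-) by (rule refl)
  then show ?thesis by (simp add: algebra_simps)
qed

text \<open>No symmetry of the stencil is used. At the transition point the two step widths differ,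
  the odd Taylor terms do not cancel, and the three error terms are bounded separately.\<close>

lemma truncation_first_order:
  fixes g g1 g2 g3 b c :: "real \<Rightarrow> real"
  assumes eps: "\<epsilon> > 0" and x: "x (i - 1) < x i" "x i < x (i + 1)"
    and cont: "continuous_on {x (i - 1)..x (i + 1)} g"
    and d1: "\<And>t. x (i - 1) < t \<Longrightarrow> t < x (i + 1) \<Longrightarrow> (g has_real_derivative g1 t) (at t)"
    and d2: "\<And>t. x (i - 1) < t \<Longrightarrow> t < x (i + 1) \<Longrightarrow> (g1 has_real_derivative g2 t) (at t)"
    and d3: "\<And>t. x (i - 1) < t \<Longrightarrow> t < x (i + 1) \<Longrightarrow> (g2 has_real_derivative g3 t) (at t)"
    and A: "\<And>t. x (i - 1) < t \<Longrightarrow> t < x (i + 1) \<Longrightarrow> \<bar>g2 t\<bar> \<le> A"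
    and B: "\<And>t. x (i - 1) < t \<Longrightarrow> t < x (i + 1) \<Longrightarrow> \<bar>g3 t\<bar> \<le> B"
    and b: "0 \<le> b (x i)" "b (x i) \<le> M"
  shows "\<bar>ASI_op \<epsilon> b c x (\<lambda>j. g (x j)) i
      - (- \<epsilon> * g2 (x i) - b (x i) * g1 (x i) + c (x i) * g (x i))\<bar>
    \<le> (x (i + 1) - x (i - 1)) * (\<epsilon> * B + M * A)"
proof -
  define X hp hm where "X = x i" and "hp = x (i + 1) - x i" and "hm = x i - x (i - 1)"
  have xs: "x (Suc i) = X + hp" "x (i - Suc 0) = X - hm" by (auto simp: X_def hp_def hm_def)
  have h: "0 < hp" "0 < hm" using x by (auto simp: hp_def hm_def)
  have A0: "0 \<le> A" and B0: "0 \<le> B" using A[of X] B[of X] x unfolding X_def by linarith+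
  define d :: "nat \<Rightarrow> real \<Rightarrow> real" where "d = (\<lambda>k. [g, g1, g2, g3] ! k)"
  have d: "d 0 = g" "d (Suc 0) = g1" "d 2 = g2" "d 3 = g3" "d (Suc (Suc 0)) = g2" by (simp_all add: d_def)
  have der: "(d m has_real_derivative d (Suc m) t) (at t)"
    if "m < 3" "x (i - 1) < t" "t < x (i + 1)" for m t
  proof -
    have "m = 0 \<or> m = 1 \<or> m = 2" using that by auto
    then show ?thesis using d1[OF that(2,3)] d2[OF that(2,3)] d3[OF that(2,3)]
      by (auto simp: d eval_nat_numeral(3) d_def)
  qed
  have t2: "\<bar>g y - (\<Sum>m<2. d m X / fact m * (y - X) ^ m)\<bar> \<le> A / fact 2 * \<bar>y - X\<bar> ^ 2"
    if "x (i - 1) \<le> y" "y \<le> x (i + 1)" for y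
    using taylor_bound_open[of "x (i - 1)" "x (i + 1)" d 2 A X y] cont der A x that
    by (simp add: d X_def)
  have t3: "\<bar>g y - (\<Sum>m<3. d m X / fact m * (y - X) ^ m)\<bar> \<le> B / fact 3 * \<bar>y - X\<bar> ^ 3"
    if "x (i - 1) \<le> y" "y \<le> x (i + 1)" for y
    using taylor_bound_open[of "x (i - 1)" "x (i + 1)" d 3 B X y] cont der B x that
    by (simp add: d X_def)
  define Dp Dm where "Dp = (g (X + hp) - g X) / hp" and "Dm = (g X - g (X - hm)) / hm"
  have "\<bar>g (X + hp) - g X - hp * g1 X\<bar> \<le> A * hp\<^sup>2 / 2"
    using t2[of "X + hp"] h by (simp add: xs d eval_nat_numeral algebra_simps)
  moreover have "g (X + hp) - g X - hp * g1 X = hp * (Dp - g1 X)"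
    using h by (simp add: Dp_def field_simps)
  ultimately have "hp * \<bar>Dp - g1 X\<bar> \<le> hp * (A * hp / 2)"
    using h by (simp add: abs_mult power2_eq_square mult_ac)
  then have Dp1: "\<bar>Dp - g1 X\<bar> \<le> A * hp / 2" using h by simp
  have "\<bar>g (X + hp) - g X - hp * g1 X - hp\<^sup>2 / 2 * g2 X\<bar> \<le> B * hp ^ 3 / 6"
    using t3[of "X + hp"] h by (simp add: xs d eval_nat_numeral algebra_simps)
  moreover have "g (X + hp) - g X - hp * g1 X - hp\<^sup>2 / 2 * g2 X = hp * (Dp - g1 X - hp / 2 * g2 X)"
    using h by (simp add: Dp_def field_simps power2_eq_square)
  ultimately have "hp * \<bar>Dp - g1 X - hp / 2 * g2 X\<bar> \<le> hp * (B * hp\<^sup>2 / 6)"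
    using h by (simp add: abs_mult power2_eq_square power3_eq_cube mult_ac)
  then have p: "\<bar>Dp - g1 X - hp / 2 * g2 X\<bar> \<le> B * hp\<^sup>2 / 6" using h by simp
  have "\<bar>g (X - hm) - g X + hm * g1 X - hm\<^sup>2 / 2 * g2 X\<bar> \<le> B * hm ^ 3 / 6"
    using t3[of "X - hm"] h by (simp add: xs d eval_nat_numeral algebra_simps)
  moreover have "g (X - hm) - g X + hm * g1 X - hm\<^sup>2 / 2 * g2 X = hm * (- (Dm - g1 X + hm / 2 * g2 X))"
    using h by (simp add: Dm_def field_simps power2_eq_square)
  ultimately have "hm * \<bar>Dm - g1 X + hm / 2 * g2 X\<bar> \<le> hm * (B * hm\<^sup>2 / 6)"
    using h by (simp only: abs_mult abs_minus) (simp add: power2_eq_square power3_eq_cube mult_ac)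
  then have m: "\<bar>Dm - g1 X + hm / 2 * g2 X\<bar> \<le> B * hm\<^sup>2 / 6" using h by simp
  define D2 where "D2 = (Dp - Dm) / ((hm + hp) / 2)"
  have "(hm + hp) / 2 * (D2 - g2 X) = (Dp - g1 X - hp / 2 * g2 X) - (Dm - g1 X + hm / 2 * g2 X)"
    using h by (simp add: D2_def field_simps)
  then have "\<bar>(hm + hp) / 2 * (D2 - g2 X)\<bar> \<le> B * hp\<^sup>2 / 6 + B * hm\<^sup>2 / 6"
    using p m by linarith
  then have "(hm + hp) / 2 * \<bar>D2 - g2 X\<bar> \<le> B * hp\<^sup>2 / 6 + B * hm\<^sup>2 / 6"
    unfolding abs_mult using h by simp
  also have "\<dots> \<le> (hm + hp) / 2 * (B * (hm + hp))"
  proof -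
    have "0 \<le> B * hp\<^sup>2" "0 \<le> B * hm\<^sup>2" "0 \<le> B * (hm * hp)" using B0 h by auto
    then show ?thesis by (simp add: power2_eq_square field_simps)
  qed
  finally have D2b: "\<bar>D2 - g2 X\<bar> \<le> B * (hm + hp)" using h by simp
  define \<rho> where "\<rho> = b X * hp / (2 * \<epsilon>)"
  have \<rho>: "0 \<le> \<rho>" "\<epsilon> * \<rho> = b X * hp / 2" using b eps h by (auto simp: \<rho>_def X_def)
  note s = sigma_fit_bounds[OF \<rho>(1)]
  have bX: "0 \<le> b X" "b X \<le> M" using b by (auto simp: X_def)
  have i1: "\<bar>\<epsilon> * sigma_fit \<rho> * (D2 - g2 X)\<bar> \<le> \<epsilon> * 1 * (B * (hm + hp))"
    unfolding abs_mult using D2b s eps by (intro mult_mono) auto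
  \<comment> \<open>The factor \<epsilon> of the diffusion term cancels the 1/\<epsilon> contained
    in \<rho>, so the fitting costs no more than the one-sided difference.\<close>
  have "\<epsilon> * \<bar>1 - sigma_fit \<rho>\<bar> \<le> \<epsilon> * \<rho>" using s eps by (intro mult_left_mono) auto
  also have "\<dots> \<le> M * hp / 2" unfolding \<rho> using bX h by simp
  finally have "\<epsilon> * \<bar>1 - sigma_fit \<rho>\<bar> * \<bar>g2 X\<bar> \<le> M * hp / 2 * A"
    using A[of X] x bX h by (intro mult_mono) (auto simp: X_def)
  then have i2: "\<bar>\<epsilon> * (1 - sigma_fit \<rho>) * g2 X\<bar> \<le> M * hp / 2 * A"
    using eps by (simp add: abs_mult)
  have i3: "\<bar>b X * (Dp - g1 X)\<bar> \<le> M * (A * hp / 2)"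
    unfolding abs_mult using Dp1 bX by (intro mult_mono) auto
  have "0 \<le> M * hm * A" using bX A0 h by auto
  then have "\<epsilon> * 1 * (B * (hm + hp)) + M * hp / 2 * A + M * (A * hp / 2)
      \<le> (hm + hp) * (\<epsilon> * B + M * A)" by (simp add: algebra_simps)
  then have "\<bar>- (\<epsilon> * sigma_fit \<rho> * (D2 - g2 X)) + \<epsilon> * (1 - sigma_fit \<rho>) * g2 X - b X * (Dp - g1 X)\<bar>
      \<le> (hm + hp) * (\<epsilon> * B + M * A)"
    using i1 i2 i3 by linarith
  moreover have "x (i + 1) - x (i - 1) = hm + hp" by (simp add: hm_def hp_def)
  moreover have "X + hp = x (i + 1)" "X - hm = x (i - 1)" by (auto simp: X_def hp_def hm_def)
  ultimately show ?thesis
    unfolding ASI_op_split[OF eps] \<rho>_def D2_def Dp_def Dm_def unfolding X_def hp_def hm_def by simp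
qed

text \<open>On equal steps the cubic Taylor terms of the second difference cancel. Moreover \<rho> =
  b h/(2 \<epsilon>) is chosen such that the leading upwind error (b h/2) g'' equals \<epsilon>
  \<rho> g''. What the fitting leaves behind is at most \<epsilon> \<rho>^2 |g''|, the origin of
  \<open>M\<^sup>2 * A / \<epsilon>\<close>.\<close>

lemma truncation_second_order:
  fixes g g1 g2 g3 g4 b c :: "real \<Rightarrow> real"
  assumes eps: "\<epsilon> > 0" and h: "h > 0" and x: "x (i - 1) = x i - h" "x (i + 1) = x i + h"
    and cont: "continuous_on {x i - h..x i + h} g"
    and d1: "\<And>t. x i - h < t \<Longrightarrow> t < x i + h \<Longrightarrow> (g has_real_derivative g1 t) (at t)"
    and d2: "\<And>t. x i - h < t \<Longrightarrow> t < x i + h \<Longrightarrow> (g1 has_real_derivative g2 t) (at t)"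
    and d3: "\<And>t. x i - h < t \<Longrightarrow> t < x i + h \<Longrightarrow> (g2 has_real_derivative g3 t) (at t)"
    and d4: "\<And>t. x i - h < t \<Longrightarrow> t < x i + h \<Longrightarrow> (g3 has_real_derivative g4 t) (at t)"
    and A: "\<bar>g2 (x i)\<bar> \<le> A"
    and B: "\<And>t. x i - h < t \<Longrightarrow> t < x i + h \<Longrightarrow> \<bar>g3 t\<bar> \<le> B"
    and K: "\<And>t. x i - h < t \<Longrightarrow> t < x i + h \<Longrightarrow> \<bar>g4 t\<bar> \<le> K"
    and b: "0 \<le> b (x i)" "b (x i) \<le> M"
  shows "\<bar>ASI_op \<epsilon> b c x (\<lambda>j. g (x j)) i
      - (- \<epsilon> * g2 (x i) - b (x i) * g1 (x i) + c (x i) * g (x i))\<bar>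
    \<le> h\<^sup>2 * (\<epsilon> * K + M * B + M\<^sup>2 * A / \<epsilon>)"
proof -
  define X where "X = x i"
  have K0: "0 \<le> K" and B0: "0 \<le> B" using K[of X] B[of X] h unfolding X_def by force+
  have A0: "0 \<le> A" using A by linarith
  define d :: "nat \<Rightarrow> real \<Rightarrow> real" where "d = (\<lambda>k. [g, g1, g2, g3, g4] ! k)"
  have d: "d 0 = g" "d (Suc 0) = g1" "d 2 = g2" "d 3 = g3" "d 4 = g4" "d (Suc (Suc 0)) = g2"
    "d (Suc (Suc (Suc 0))) = g3" by (simp_all add: d_def)
  have der: "(d m has_real_derivative d (Suc m) t) (at t)"
    if "m < 4" "X - h < t" "t < X + h" for m t
  proof -
    have "m = 0 \<or> m = 1 \<or> m = 2 \<or> m = 3" using that by auto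
    then show ?thesis using that(2,3) d1[of t] d2[of t] d3[of t] d4[of t]
      by (auto simp: d_def X_def numeral_2_eq_2 numeral_3_eq_3)
  qed
  have t3: "\<bar>g y - (\<Sum>m<3. d m X / fact m * (y - X) ^ m)\<bar> \<le> B / fact 3 * \<bar>y - X\<bar> ^ 3"
    if "X - h \<le> y" "y \<le> X + h" for y
    using taylor_bound_open[of "X - h" "X + h" d 3 B X y] cont der B h that
    by (simp add: d X_def)
  have t4: "\<bar>g y - (\<Sum>m<4. d m X / fact m * (y - X) ^ m)\<bar> \<le> K / fact 4 * \<bar>y - X\<bar> ^ 4"
    if "X - h \<le> y" "y \<le> X + h" for y
    using taylor_bound_open[of "X - h" "X + h" d 4 K X y] cont der K h that
    by (simp add: d X_def)
  define Dp D2 where "Dp = (g (X + h) - g X) / h"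
    and "D2 = (Dp - (g X - g (X - h)) / h) / ((h + h) / 2)"
  have "\<bar>g (X + h) - g X - h * g1 X - h\<^sup>2 / 2 * g2 X\<bar> \<le> B * h ^ 3 / 6"
    using t3[of "X + h"] h by (simp add: d eval_nat_numeral algebra_simps)
  moreover have "g (X + h) - g X - h * g1 X - h\<^sup>2 / 2 * g2 X = h * (Dp - g1 X - h / 2 * g2 X)"
    using h by (simp add: Dp_def field_simps power2_eq_square)
  ultimately have "h * \<bar>Dp - g1 X - h / 2 * g2 X\<bar> \<le> h * (B * h\<^sup>2 / 6)"
    using h by (simp add: abs_mult power2_eq_square power3_eq_cube mult_ac)
  then have p: "\<bar>Dp - g1 X - h / 2 * g2 X\<bar> \<le> B * h\<^sup>2 / 6" using h by simp
  have "\<bar>g (X + h) - (g X + h * g1 X + h\<^sup>2 / 2 * g2 X + h ^ 3 / 6 * g3 X)\<bar> \<le> K * h ^ 4 / 24"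
    using t4[of "X + h"] h by (simp add: d eval_nat_numeral algebra_simps)
  moreover have "\<bar>g (X - h) - (g X - h * g1 X + h\<^sup>2 / 2 * g2 X - h ^ 3 / 6 * g3 X)\<bar> \<le> K * h ^ 4 / 24"
    using t4[of "X - h"] h by (simp add: d eval_nat_numeral algebra_simps)
  ultimately have "\<bar>(g (X + h) - (g X + h * g1 X + h\<^sup>2 / 2 * g2 X + h ^ 3 / 6 * g3 X))
      + (g (X - h) - (g X - h * g1 X + h\<^sup>2 / 2 * g2 X - h ^ 3 / 6 * g3 X))\<bar> \<le> K * h ^ 4 / 12"
    by linarith
  moreover have "(g (X + h) - (g X + h * g1 X + h\<^sup>2 / 2 * g2 X + h ^ 3 / 6 * g3 X))
      + (g (X - h) - (g X - h * g1 X + h\<^sup>2 / 2 * g2 X - h ^ 3 / 6 * g3 X)) = h\<^sup>2 * (D2 - g2 X)"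
    using h by (simp add: D2_def Dp_def field_simps power2_eq_square)
  ultimately have "h\<^sup>2 * \<bar>D2 - g2 X\<bar> \<le> h\<^sup>2 * (K * h\<^sup>2 / 12)"
    by (simp add: abs_mult eval_nat_numeral mult_ac)
  then have D2b: "\<bar>D2 - g2 X\<bar> \<le> K * h\<^sup>2 / 12" using h by simp
  define \<rho> where "\<rho> = b X * h / (2 * \<epsilon>)"
  have \<rho>: "0 \<le> \<rho>" "b X * h / 2 = \<epsilon> * \<rho>" using b eps h by (auto simp: \<rho>_def X_def)
  note s = sigma_fit_bounds[OF \<rho>(1)]
  have bX: "0 \<le> b X" "b X \<le> M" using b by (auto simp: X_def)
  have i1: "\<bar>\<epsilon> * sigma_fit \<rho> * (D2 - g2 X)\<bar> \<le> \<epsilon> * 1 * (K * h\<^sup>2 / 12)"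
    unfolding abs_mult using D2b s eps by (intro mult_mono) auto
  have "\<epsilon> * \<bar>1 - \<rho> - sigma_fit \<rho>\<bar> \<le> \<epsilon> * \<rho>\<^sup>2" using s eps by (intro mult_left_mono) auto
  also have "\<dots> = (b X)\<^sup>2 * h\<^sup>2 / (4 * \<epsilon>)" using eps by (simp add: \<rho>_def field_simps power2_eq_square)
  also have "\<dots> \<le> M\<^sup>2 * h\<^sup>2 / (4 * \<epsilon>)" using bX eps by (intro divide_right_mono mult_right_mono power_mono) auto
  finally have "\<epsilon> * \<bar>1 - \<rho> - sigma_fit \<rho>\<bar> * \<bar>g2 X\<bar> \<le> M\<^sup>2 * h\<^sup>2 / (4 * \<epsilon>) * A"
    using A eps by (intro mult_mono) (auto simp: X_def)
  then have i2: "\<bar>\<epsilon> * (1 - \<rho> - sigma_fit \<rho>) * g2 X\<bar> \<le> M\<^sup>2 * h\<^sup>2 / (4 * \<epsilon>) * A"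
    using eps by (simp add: abs_mult)
  have i3: "\<bar>b X * (Dp - g1 X - h / 2 * g2 X)\<bar> \<le> M * (B * h\<^sup>2 / 6)"
    unfolding abs_mult using p bX by (intro mult_mono) auto
  have "\<epsilon> * 1 * (K * h\<^sup>2 / 12) + M\<^sup>2 * h\<^sup>2 / (4 * \<epsilon>) * A + M * (B * h\<^sup>2 / 6)
      \<le> h\<^sup>2 * (\<epsilon> * K) + h\<^sup>2 * (M\<^sup>2 * A / \<epsilon>) + h\<^sup>2 * (M * B)"
  proof (intro add_mono)
    have "0 \<le> \<epsilon> * (K * h\<^sup>2)" using eps K0 by auto
    then show "\<epsilon> * 1 * (K * h\<^sup>2 / 12) \<le> h\<^sup>2 * (\<epsilon> * K)" by (simp add: algebra_simps)
    have "0 \<le> M\<^sup>2 * h\<^sup>2 * A / \<epsilon>" using eps A0 by auto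
    then show "M\<^sup>2 * h\<^sup>2 / (4 * \<epsilon>) * A \<le> h\<^sup>2 * (M\<^sup>2 * A / \<epsilon>)" using eps by (simp add: field_simps)
    have "0 \<le> M * (B * h\<^sup>2)" using bX B0 by auto
    then show "M * (B * h\<^sup>2 / 6) \<le> h\<^sup>2 * (M * B)" by (simp add: algebra_simps)
  qed
  moreover have "- (\<epsilon> * sigma_fit \<rho> * (D2 - g2 X)) + \<epsilon> * (1 - sigma_fit \<rho>) * g2 X - b X * (Dp - g1 X)
      = - (\<epsilon> * sigma_fit \<rho> * (D2 - g2 X)) + \<epsilon> * (1 - \<rho> - sigma_fit \<rho>) * g2 X
        - b X * (Dp - g1 X - h / 2 * g2 X)"
  proof -
    have "b X * (h / 2 * g2 X) = b X * h / 2 * g2 X" by simp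
    also have "\<dots> = \<epsilon> * \<rho> * g2 X" by (simp only: \<rho>(2))
    finally have "b X * (h / 2 * g2 X) = \<epsilon> * \<rho> * g2 X" .
    moreover have "b X * (Dp - g1 X - h / 2 * g2 X) = b X * (Dp - g1 X) - b X * (h / 2 * g2 X)"
      by (simp only: right_diff_distrib)
    moreover have "\<epsilon> * (1 - \<rho> - sigma_fit \<rho>) * g2 X = \<epsilon> * (1 - sigma_fit \<rho>) * g2 X - \<epsilon> * \<rho> * g2 X"
      by (simp add: algebra_simps)
    ultimately show ?thesis by linarith
  qed
  ultimately have "\<bar>- (\<epsilon> * sigma_fit \<rho> * (D2 - g2 X)) + \<epsilon> * (1 - sigma_fit \<rho>) * g2 X - b X * (Dp - g1 X)\<bar>
      \<le> h\<^sup>2 * (\<epsilon> * K) + h\<^sup>2 * (M\<^sup>2 * A / \<epsilon>) + h\<^sup>2 * (M * B)"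
    using i1 i2 i3 by linarith
  then show ?thesis
    unfolding ASI_op_split[OF eps] x unfolding \<rho>_def D2_def Dp_def X_def by (simp add: algebra_simps)
qed

section \<open>Discrete comparison principle and stability\<close>

lemma ASI_op_linear:
  "ASI_op \<epsilon> b c x (\<lambda>i. r * U i + s * V i) i = r * ASI_op \<epsilon> b c x U i + s * ASI_op \<epsilon> b c x V i"
  unfolding ASI_op_def Let_def by (simp add: algebra_simps add_divide_distrib diff_divide_distrib)

text \<open>At a smallest mesh value the forward difference is nonnegative and the backward one
  nonpositive. Since convection uses the forward difference and \<open>sigma_fit\<close> is
  positive, both terms have the right sign there without any restriction on the step widths.\<close>

lemma discrete_maximum_principle:
  assumes eps: "\<epsilon> > 0" and x: "\<And>i. i < N \<Longrightarrow> x i < x (i + 1)"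
    and b: "\<And>i. 0 < i \<Longrightarrow> i < N \<Longrightarrow> 0 \<le> b (x i)" and c: "\<And>i. 0 < i \<Longrightarrow> i < N \<Longrightarrow> 0 \<le> c (x i)"
    and L: "\<And>i. 0 < i \<Longrightarrow> i < N \<Longrightarrow> 0 < ASI_op \<epsilon> b c x V i"
    and bnd: "0 \<le> V 0" "0 \<le> V N" and i: "i \<le> N"
  shows "0 \<le> V i"
proof (rule ccontr)
  assume neg: "\<not> 0 \<le> V i"
  obtain m where m: "m \<le> N" "\<And>j. j \<le> N \<Longrightarrow> V m \<le> V j"
    using ex_min_if_finite[of "V ` {..N}"] by (auto simp: not_less)
  have Vm: "V m < 0" using m(2)[OF i] neg by simp
  then have m0: "0 < m" "m < N" using m(1) bnd by (metis not_less gr0I, metis le_neq_implies_less not_less)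
  define hm hp where "hm = x m - x (m - 1)" and "hp = x (m + 1) - x m"
  have h: "0 < hm" "0 < hp" using x[of "m - 1"] x[of m] m0 by (auto simp: hm_def hp_def)
  have Dp: "0 \<le> (V (m + 1) - V m) / hp" using m(2)[of "m + 1"] m0 h by simp
  have Dm: "(V m - V (m - 1)) / hm \<le> 0" using m(2)[of "m - 1"] m0 h by (simp add: divide_le_0_iff)
  have "0 \<le> \<epsilon> * sigma_fit (b (x m) * hp / (2 * \<epsilon>)) * (((V (m + 1) - V m) / hp - (V m - V (m - 1)) / hm) / ((hm + hp) / 2))"
    using eps sigma_fit_bounds(1)[of "b (x m) * hp / (2 * \<epsilon>)"] b[OF m0] h Dp Dm
    by (intro mult_nonneg_nonneg divide_nonneg_pos) auto
  moreover have "0 \<le> b (x m) * ((V (m + 1) - V m) / hp)" using b[OF m0] Dp by (rule mult_nonneg_nonneg)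
  moreover have "c (x m) * V m \<le> 0" using c[OF m0] Vm by (simp add: mult_nonneg_nonpos)
  ultimately show False using L[OF m0] unfolding ASI_op_def Let_def hm_def hp_def by simp
qed

text \<open>The linear part of the barrier has a convex kink at the transition point; the geometric tail
  is there to compensate it.\<close>

definition barrier :: "real \<Rightarrow> real \<Rightarrow> nat \<Rightarrow> (nat \<Rightarrow> real) \<Rightarrow> real \<Rightarrow> nat \<Rightarrow> real" where
  "barrier \<epsilon> \<beta> J x H i =
    (if i \<le> J then x J - x i + 4 * \<epsilon> / \<beta> else 4 * \<epsilon> / \<beta> * (1 / (1 + \<beta> * H / \<epsilon>)) ^ (i - J))"

lemma barrier_bounds:
  assumes "\<epsilon> > 0" "\<beta> > 0" "H > 0" and x: "\<And>i. i \<le> J \<Longrightarrow> x i = real i * h" and h: "h > 0"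
  shows "0 \<le> barrier \<epsilon> \<beta> J x H i" "barrier \<epsilon> \<beta> J x H i \<le> x J + 4 * \<epsilon> / \<beta>"
proof -
  define r where "r = 1 / (1 + \<beta> * H / \<epsilon>)"
  have "0 < \<beta> * H / \<epsilon>" using assms by simp
  then have r: "0 < r" "r \<le> 1" by (auto simp: r_def divide_le_eq add_pos_pos)
  have xi: "0 \<le> x i \<and> x i \<le> x J" if "i \<le> J" using that h by (simp add: x)
  have xJ: "0 \<le> x J" using h by (simp add: x)
  have A: "0 \<le> 4 * \<epsilon> / \<beta>" using assms by simp
  moreover have "4 * \<epsilon> / \<beta> * r ^ (i - J) \<le> 4 * \<epsilon> / \<beta> * 1"
    using r by (intro mult_left_mono[OF _ A] power_le_one) auto
  moreover have "0 \<le> 4 * \<epsilon> / \<beta> * r ^ (i - J)"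
    using r by (intro mult_nonneg_nonneg[OF A]) auto
  ultimately show "0 \<le> barrier \<epsilon> \<beta> J x H i" "barrier \<epsilon> \<beta> J x H i \<le> x J + 4 * \<epsilon> / \<beta>"
    unfolding barrier_def r_def[symmetric] using xi xJ by auto
qed

text \<open>Left of \<open>J\<close> the second difference vanishes and the slope -1 leaves
  \<open>b\<close>. Right of \<open>J\<close> the tail is the implicit Euler solution of \<phi>' =
  -(\<beta>/\<epsilon>) \<phi>, that is (1 - r)/H = (\<beta>/\<epsilon>) r; since \<sigma> \<le> 1
  and \<beta> \<le> b, convection outweighs diffusion. The only delicate point is \<open>J\<close>
  itself.\<close>

lemma ASI_op_barrier:
  assumes eps: "\<epsilon> > 0" and \<beta>: "\<beta> > 0" and h: "h > 0" and H: "H > 0"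
    and x1: "\<And>i. i \<le> J \<Longrightarrow> x i = real i * h"
    and x2: "\<And>i. J \<le> i \<Longrightarrow> x i = x J + real (i - J) * H"
    and i: "0 < i" and b: "\<beta> \<le> b (x i)" and c: "0 \<le> c (x i)"
  shows "ASI_op \<epsilon> b c x (barrier \<epsilon> \<beta> J x H) i \<ge> (if i < J then \<beta> else 0)"
proof -
  define r where "r = 1 / (1 + \<beta> * H / \<epsilon>)"
  have den: "0 < 1 + \<beta> * H / \<epsilon>" using eps \<beta> H by (simp add: add_pos_pos)
  have r: "0 < r" "r * (1 + \<beta> * H / \<epsilon>) = 1" using den by (auto simp: r_def)
  have r1: "(1 - r) / H = \<beta> / \<epsilon> * r" using r(2) H eps by (simp add: field_simps)
  note bd = barrier_def[of \<epsilon> \<beta> J x H, folded r_def]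
  have cn: "0 \<le> c (x i) * barrier \<epsilon> \<beta> J x H i"
    using c barrier_bounds(1)[OF eps \<beta> H x1 h] by simp
  define \<rho> where "\<rho> = b (x i) * (x (i + 1) - x i) / (2 * \<epsilon>)"
  have step: "0 < x (i + 1) - x i"
  proof (cases "i < J")
    case True then show ?thesis using h by (simp add: x1 algebra_simps)
  next
    case False then show ?thesis using H x2[of i] x2[of "i + 1"] by (simp add: Suc_diff_le algebra_simps)
  qed
  have "0 \<le> \<rho>" using b \<beta> step eps by (simp add: \<rho>_def)
  note s = sigma_fit_bounds[OF this]
  consider "i < J" | "i = J" | "J < i" by linarith
  then show ?thesis
  proof cases
    case 1
    have "x (i + 1) - x i = h" "x i - x (i - 1) = h" using 1 i x1[of i] x1[of "i + 1"] x1[of "i - 1"]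
      by (auto simp: algebra_simps of_nat_diff)
    then have "ASI_op \<epsilon> b c x (barrier \<epsilon> \<beta> J x H) i
        = b (x i) + c (x i) * barrier \<epsilon> \<beta> J x H i"
      unfolding ASI_op_def Let_def using 1 h by (simp add: bd field_simps le_diff_conv)
    then show ?thesis using cn b 1 by simp
  next
    case 2
    have hp: "x (i + 1) - x i = H" and hm: "x i - x (i - 1) = h"
      using 2 i x1[of i] x2[of "i + 1"] x1[of "i - 1"] by (auto simp: algebra_simps of_nat_diff)
    have Dp: "(barrier \<epsilon> \<beta> J x H (i + 1) - barrier \<epsilon> \<beta> J x H i) / H = - 4 * r"
    proof -
      have "(barrier \<epsilon> \<beta> J x H (i + 1) - barrier \<epsilon> \<beta> J x H i) / H = - (4 * \<epsilon> / \<beta>) * ((1 - r) / H)"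
        using 2 H eps \<beta> by (simp add: bd field_simps)
      then show ?thesis unfolding r1 using eps \<beta> by simp
    qed
    have Dm: "(barrier \<epsilon> \<beta> J x H i - barrier \<epsilon> \<beta> J x H (i - 1)) / h = - 1"
      using 2 hm h by (simp add: bd divide_eq_eq)
    define q where "q = \<epsilon> * sigma_fit \<rho> / ((h + H) / 2)"
    have "0 < q" using s eps h H by (simp add: q_def)
    \<comment> \<open>The kink contributes -q (1 - 4 r), and the convection term returns 4 r b.
      Dividing by r leaves q (1 + \<beta> H/\<epsilon>) \<le> 4 (q + b). The bound q \<le> 2
      \<epsilon>/H makes the left side at most q + 2 \<beta>, whatever the ratio of the step
      widths.\<close>
    have "q \<le> \<epsilon> * 1 / (H / 2)" unfolding q_def
      using s eps h H by (intro frac_le mult_mono) auto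
    then have "q * (\<beta> * H / \<epsilon>) \<le> \<epsilon> * 1 / (H / 2) * (\<beta> * H / \<epsilon>)" using eps \<beta> H by (intro mult_right_mono) auto
    also have "\<dots> = 2 * \<beta>" using eps H by (simp add: field_simps)
    finally have "q * (1 + \<beta> * H / \<epsilon>) \<le> 4 * (q + b (x i))"
      using \<open>0 < q\<close> b \<beta> by (simp add: distrib_left)
    then have "r * (q * (1 + \<beta> * H / \<epsilon>)) \<le> r * (4 * (q + b (x i)))" using r by (intro mult_left_mono) auto
    moreover have "r * (q * (1 + \<beta> * H / \<epsilon>)) = q" using r(2) by (metis mult.left_commute mult.right_neutral)
    ultimately have q: "q \<le> 4 * r * q + 4 * r * b (x i)" by (simp add: algebra_simps)
    have "ASI_op \<epsilon> b c x (barrier \<epsilon> \<beta> J x H) i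
        = - q * (- 4 * r - - 1) - b (x i) * (- 4 * r) + c (x i) * barrier \<epsilon> \<beta> J x H i"
      unfolding ASI_op_def Let_def hp hm Dp Dm q_def \<rho>_def by simp
    then show ?thesis using q cn 2 by (simp add: algebra_simps)
  next
    case 3
    define k where "k = i - J"
    have k: "i - J = k" "i - 1 - J = k - 1" "i + 1 - J = k + 1" "k \<ge> 1" using 3 by (auto simp: k_def)
    have hp: "x (i + 1) - x i = H" and hm: "x i - x (i - 1) = H"
      using 3 x2[of i] x2[of "i + 1"] x2[of "i - 1"] k by (auto simp: algebra_simps of_nat_diff)
    have bi: "barrier \<epsilon> \<beta> J x H i = 4 * \<epsilon> / \<beta> * r ^ k"
      "barrier \<epsilon> \<beta> J x H (i + 1) = 4 * \<epsilon> / \<beta> * (r ^ k * r)" using 3 k by (auto simp: bd)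
    \<comment> \<open>For k = 1 the left neighbour is \<open>J\<close>, where the linear branch of
      the barrier applies. Both branches take the value 4 \<epsilon>/\<beta> there, so the geometric
      recurrence also holds at this step.\<close>
    have bm: "barrier \<epsilon> \<beta> J x H (i - 1) * r = 4 * \<epsilon> / \<beta> * r ^ k"
    proof (cases "k = 1")
      case True
      then have "i - 1 = J" using 3 k by simp
      then show ?thesis using True by (simp add: bd)
    next
      case False
      then have "J < i - 1" "r ^ k = r ^ (k - 1) * r" using k
        by (auto simp: power_eq_if mult.commute)
      then show ?thesis using k by (simp add: bd)
    qed
    have Dp: "(barrier \<epsilon> \<beta> J x H (i + 1) - barrier \<epsilon> \<beta> J x H i) / H = - 4 * r ^ k * r"
    proof -
      have "(barrier \<epsilon> \<beta> J x H (i + 1) - barrier \<epsilon> \<beta> J x H i) / H = - (4 * \<epsilon> / \<beta>) * r ^ k * ((1 - r) / H)"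
        using H eps \<beta> unfolding bi by (simp add: field_simps)
      then show ?thesis unfolding r1 using eps \<beta> by simp
    qed
    have Dm: "(barrier \<epsilon> \<beta> J x H i - barrier \<epsilon> \<beta> J x H (i - 1)) / H = - 4 * r ^ k"
    proof -
      have "(barrier \<epsilon> \<beta> J x H i - barrier \<epsilon> \<beta> J x H (i - 1)) / H * r
          = (barrier \<epsilon> \<beta> J x H i * r - barrier \<epsilon> \<beta> J x H (i - 1) * r) / H"
        by (simp add: left_diff_distrib)
      also have "\<dots> = - (4 * \<epsilon> / \<beta>) * r ^ k * ((1 - r) / H)"
        unfolding bm unfolding bi using H eps \<beta> by (simp add: field_simps)
      also have "\<dots> = - 4 * r ^ k * r" unfolding r1 using eps \<beta> by simp
      finally show ?thesis using r(1) unfolding mult_cancel_right by simp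
    qed
    have "(- 4 * r ^ k * r - - 4 * r ^ k) / ((H + H) / 2) = 4 * r ^ k * ((1 - r) / H)"
      by (simp add: algebra_simps)
    then have D2: "(- 4 * r ^ k * r - - 4 * r ^ k) / ((H + H) / 2) = 4 * r ^ k * (\<beta> / \<epsilon> * r)" unfolding r1 .
    have "ASI_op \<epsilon> b c x (barrier \<epsilon> \<beta> J x H) i
        = 4 * r ^ k * r * (b (x i) - sigma_fit \<rho> * \<beta>) + c (x i) * barrier \<epsilon> \<beta> J x H i"
      unfolding ASI_op_def Let_def hp hm Dp Dm D2 \<rho>_def using eps by (simp add: field_simps)
    moreover have "sigma_fit \<rho> * \<beta> \<le> 1 * \<beta>" using s \<beta> by (intro mult_right_mono) auto
    then have "0 \<le> 4 * r ^ k * r * (b (x i) - sigma_fit \<rho> * \<beta>)"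
      using r b by (intro mult_nonneg_nonneg) auto
    ultimately show ?thesis using cn 3 by simp
  qed
qed

text \<open>From \<open>J\<close> on, \<open>barrier\<close> is only guaranteed a nonnegative image.
  The truncation error there is caught by 2 - x, whose constant slope removes the second difference
  on any mesh and leaves at least \<beta> in the setting below.\<close>

lemma ASI_op_linear_barrier:
  assumes x: "x (i - 1) < x i" "x i < x (i + 1)"
  shows "ASI_op \<epsilon> b c x (\<lambda>i. 2 - x i) i = b (x i) + c (x i) * (2 - x i)"
proof -
  have "(2 - x (i + 1) - (2 - x i)) / (x (i + 1) - x i) = - 1"
    "(2 - x i - (2 - x (i - 1))) / (x i - x (i - 1)) = - 1"
    using x by (auto simp: divide_eq_eq)
  then show ?thesis unfolding ASI_op_def Let_def by simp
qed

lemma discrete_stability: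
  fixes x :: "nat \<Rightarrow> real"
  assumes eps: "\<epsilon> > 0" and \<beta>: "\<beta> > 0" and h: "h > 0" and H: "H > 0" and JN: "J \<le> N"
    and x1: "\<And>i. i \<le> J \<Longrightarrow> x i = real i * h"
    and x2: "\<And>i. J \<le> i \<Longrightarrow> x i = x J + real (i - J) * H" and xN: "x N = 1"
    and b: "\<And>i. i \<le> N \<Longrightarrow> \<beta> \<le> b (x i)" and c: "\<And>i. i \<le> N \<Longrightarrow> 0 \<le> c (x i)"
    and bnd: "e 0 = 0" "e N = 0" and A: "0 \<le> A1" "0 < A2"
    and t1: "\<And>i. 0 < i \<Longrightarrow> i < J \<Longrightarrow> \<bar>ASI_op \<epsilon> b c x e i\<bar> \<le> A1"
    and t2: "\<And>i. 0 < i \<Longrightarrow> J \<le> i \<Longrightarrow> i < N \<Longrightarrow> \<bar>ASI_op \<epsilon> b c x e i\<bar> \<le> A2"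
    and i: "i \<le> N"
  shows "\<bar>e i\<bar> \<le> A1 / \<beta> * (x J + 4 * \<epsilon> / \<beta>) + 4 * A2 / \<beta>"
proof -
  have mono: "x i < x (i + 1)" for i
  proof (cases "i < J")
    case True then show ?thesis using h by (simp add: x1 algebra_simps)
  next
    case False then show ?thesis using H x2[of i] x2[of "i + 1"] by (simp add: Suc_diff_le algebra_simps)
  qed
  have smono: "x i \<le> x j" if "i \<le> j" for i j
    using that lift_Suc_mono_le[of x i j] mono by (auto intro: less_imp_le)
  have x01: "0 \<le> x i" "x i \<le> 1" if "i \<le> N" for i
    using smono[of 0 i] smono[of i N] x1[of 0] xN that by auto
  let ?\<phi> = "barrier \<epsilon> \<beta> J x H"
  \<comment> \<open>The factor 2 before \<open>A2\<close> supplies the strict inequality of the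
    comparison principle: the image of \<open>\<Phi>\<close> is at least A1 + 2 A2 left of
    \<open>J\<close> and at least 2 A2 from \<open>J\<close> on. This uses A2 > 0.\<close>
  define \<Phi> where "\<Phi> = (\<lambda>i. A1 / \<beta> * ?\<phi> i + 2 * A2 / \<beta> * (2 - x i))"
  have bb: "0 \<le> ?\<phi> i" "?\<phi> i \<le> x J + 4 * \<epsilon> / \<beta>" for i
    using barrier_bounds[of \<epsilon> \<beta> H J x h i] eps \<beta> H h x1 by auto
  have \<Phi>0: "0 \<le> \<Phi> i" if "i \<le> N" for i
    unfolding \<Phi>_def using A \<beta> bb(1)[of i] x01[OF that] by (intro add_nonneg_nonneg mult_nonneg_nonneg) auto
  have L\<Phi>: "\<bar>ASI_op \<epsilon> b c x e i\<bar> < ASI_op \<epsilon> b c x \<Phi> i" if j: "0 < i" "i < N" for i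
  proof -
    have L: "ASI_op \<epsilon> b c x \<Phi> i
        = A1 / \<beta> * ASI_op \<epsilon> b c x ?\<phi> i + 2 * A2 / \<beta> * (b (x i) + c (x i) * (2 - x i))"
      unfolding \<Phi>_def ASI_op_linear using ASI_op_linear_barrier[of x i \<epsilon> b c] mono[of "i - 1"] mono[of i] j by simp
    have "(if i < J then \<beta> else 0) \<le> ASI_op \<epsilon> b c x ?\<phi> i"
      using j by (intro ASI_op_barrier[OF eps \<beta> h H x1 x2] b c) auto
    then have "A1 / \<beta> * (if i < J then \<beta> else 0) \<le> A1 / \<beta> * ASI_op \<epsilon> b c x ?\<phi> i"
      using A \<beta> by (intro mult_left_mono) auto
    then have l1: "(if i < J then A1 else 0) \<le> A1 / \<beta> * ASI_op \<epsilon> b c x ?\<phi> i" using \<beta> by (auto split: if_splits)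
    have "0 \<le> c (x i) * (2 - x i)" using c[of i] x01[of i] j by simp
    then have "\<beta> \<le> b (x i) + c (x i) * (2 - x i)" using b[of i] j by simp
    then have "2 * A2 / \<beta> * \<beta> \<le> 2 * A2 / \<beta> * (b (x i) + c (x i) * (2 - x i))"
      using A \<beta> by (intro mult_left_mono) auto
    then have l2: "2 * A2 \<le> 2 * A2 / \<beta> * (b (x i) + c (x i) * (2 - x i))" using \<beta> by simp
    show ?thesis unfolding L using l1 l2 A t1[of i] t2[of i] j by (cases "i < J") auto
  qed
  have "0 \<le> 1 * \<Phi> i + s * e i" if s: "s = 1 \<or> s = -1" for s
  proof (rule discrete_maximum_principle[OF eps, where N = N and x = x and b = b and c = c])
    show "0 < ASI_op \<epsilon> b c x (\<lambda>i. 1 * \<Phi> i + s * e i) i" if "0 < i" "i < N" for i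
      unfolding ASI_op_linear using L\<Phi>[OF that] s by auto
  qed (use mono b c \<beta> \<Phi>0 bnd i s in \<open>auto simp: order.trans[OF less_imp_le]\<close>)
  from this[of 1] this[of "-1"] have "\<bar>e i\<bar> \<le> \<Phi> i" by auto
  also have "\<Phi> i \<le> A1 / \<beta> * (x J + 4 * \<epsilon> / \<beta>) + 2 * A2 / \<beta> * 2"
    unfolding \<Phi>_def using A \<beta> bb(2)[of i] x01[OF i] by (intro add_mono mult_left_mono) auto
  finally show ?thesis by simp
qed

section \<open>Truncation error on the layer function\<close>

lemma sinh_real_bounds:
  assumes "0 \<le> (y::real)"
  shows "y \<le> sinh y" "sinh y \<le> y * cosh y"
proof -
  define F G :: "real \<Rightarrow> real" where "F = (\<lambda>y. sinh y - y)" and "G = (\<lambda>y. y * cosh y - sinh y)"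
  have "F 0 \<le> F y"
  proof (rule DERIV_nonneg_imp_nondecreasing[of 0 y F])
    fix x :: real
    have "(F has_real_derivative cosh x - 1) (at x)"
      unfolding F_def by (auto intro!: derivative_eq_intros)
    then show "\<exists>d. (F has_real_derivative d) (at x) \<and> 0 \<le> d"
      using cosh_real_ge_1[of x] by (metis diff_ge_0_iff_ge)
  qed (use assms in auto)
  then show "y \<le> sinh y" by (simp add: F_def)
  have "G 0 \<le> G y"
  proof (rule DERIV_nonneg_imp_nondecreasing[of 0 y G])
    fix x :: real assume "0 \<le> x"
    have "(G has_real_derivative x * sinh x) (at x)"
      unfolding G_def by (auto intro!: derivative_eq_intros)
    moreover have "0 \<le> x * sinh x" using \<open>0 \<le> x\<close> by simp
    ultimately show "\<exists>d. (G has_real_derivative d) (at x) \<and> 0 \<le> d" by blast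
  qed (use assms in auto)
  then show "sinh y \<le> y * cosh y" by (simp add: G_def)
qed

text \<open>The quotient is even and at most cosh. The identity cosh z = 1 + 2 sinh(z/2)^2 turns a
  first-order bound for sinh into a second-order one, and the range bound \<open>P\<close> keeps the
  constant finite.\<close>

lemma sinh_quotient_bounds:
  assumes "y \<noteq> 0" "\<bar>y\<bar> \<le> (P::real)"
  shows "1 \<le> sinh y / y" "sinh y / y \<le> 1 + (cosh P)\<^sup>2 * y\<^sup>2"
proof -
  define z where "z = \<bar>y\<bar>"
  have z: "0 < z" "z \<le> P" "sinh y / y = sinh z / z" "z\<^sup>2 = y\<^sup>2"
    using assms by (auto simp: z_def abs_if)
  show "1 \<le> sinh y / y" using sinh_real_bounds(1)[of z] z by simp
  have "sinh z / z \<le> cosh z" using sinh_real_bounds(2)[of z] z by (simp add: divide_le_eq mult.commute)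
  also have "cosh z = 1 + 2 * (sinh (z / 2))\<^sup>2"
    using cosh_double[of "z / 2"] cosh_square_eq[of "z / 2"] by simp
  also have "\<dots> \<le> 1 + 2 * (z / 2 * cosh P)\<^sup>2"
  proof -
    have "sinh (z / 2) \<le> z / 2 * cosh (z / 2)" using sinh_real_bounds(2)[of "z / 2"] z by simp
    also have "\<dots> \<le> z / 2 * cosh P" using z by (intro mult_left_mono) (auto simp: cosh_real_nonneg_le_iff)
    finally show ?thesis using z by (intro add_left_mono mult_left_mono power_mono) auto
  qed
  also have "\<dots> \<le> 1 + (cosh P)\<^sup>2 * y\<^sup>2"
    using z(4) by (simp add: power_mult_distrib power_divide)
  finally show "sinh y / y \<le> 1 + (cosh P)\<^sup>2 * y\<^sup>2" using z by simp
qed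

lemma exp_diff_sinh: "exp p - exp q = 2 * exp ((p + q) / 2) * sinh ((p - q) / (2::real))"
proof -
  have "exp ((p + q) / 2) * exp ((p - q) / 2) = exp p" "exp ((p + q) / 2) * exp (- ((p - q) / 2)) = exp q"
    unfolding exp_add[symmetric] by (simp_all add: field_simps)
  then show ?thesis unfolding sinh_field_def by (simp add: algebra_simps)
qed

text \<open>In terms of \<open>sinh\<close> the exponential factors cancel, leaving a ratio of even
  functions; this is why the error is quadratic in the mesh width.\<close>

lemma fitted_factor_small:
  fixes p q :: real
  assumes p: "0 < p" "p \<le> t" and q: "0 < q" "q \<le> t" and t: "t \<le> P"
  shows "\<bar>p * (1 - exp (- q)) * (exp p - exp q) / (exp p - 1) - q * (p - q)\<bar>
    \<le> (cosh P)\<^sup>2 * (2 + (cosh P)\<^sup>2 * P\<^sup>2) * (q * \<bar>p - q\<bar> * t\<^sup>2)"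
proof (cases "p = q")
  case True then show ?thesis by simp
next
  case False
  define s where "s = p - q"
  have s: "s \<noteq> 0" "\<bar>s\<bar> \<le> t" using False p q by (auto simp: s_def)
  define \<psi> where "\<psi> = (\<lambda>x::real. sinh (x / 2) / (x / 2))"
  define K where "K = (cosh P)\<^sup>2"
  have K: "0 \<le> K" by (simp add: K_def)
  have \<psi>: "1 \<le> \<psi> x" "\<psi> x \<le> 1 + K * t\<^sup>2" if "x \<noteq> 0" "\<bar>x\<bar> \<le> t" for x
  proof -
    have x2: "x / 2 \<noteq> 0" "\<bar>x / 2\<bar> \<le> P" using that t by auto
    show "1 \<le> \<psi> x" unfolding \<psi>_def using sinh_quotient_bounds(1)[OF x2] .
    have "(x / 2)\<^sup>2 \<le> t\<^sup>2" using that by (intro power2_le_iff_abs_le[THEN iffD2]) auto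
    then have "K * (x / 2)\<^sup>2 \<le> K * t\<^sup>2" using K by (rule mult_left_mono)
    then show "\<psi> x \<le> 1 + K * t\<^sup>2"
      using sinh_quotient_bounds(2)[OF x2] unfolding \<psi>_def K_def by linarith
  qed
  \<comment> \<open>Once q (p - q) is factored out exactly, \<open>R\<close> is what remains in
    place of 1. Each of its three \<psi>-values lies between 1 and 1 + K t^2, so R - 1 is quadratic
    in t.\<close>
  define R where "R = \<psi> q * \<psi> s / \<psi> p"
  have sp: "0 < sinh (p / 2)" using p by simp
  have "p * (1 - exp (- q)) * (exp p - exp q) / (exp p - 1) = q * s * R"
  proof -
    have "1 - exp (- q) = 2 * exp (- q / 2) * sinh (q / 2)" using exp_diff_sinh[of 0 "- q"] by simp
    moreover have "exp p - 1 = 2 * exp (p / 2) * sinh (p / 2)" using exp_diff_sinh[of p 0] by simp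
    moreover have "exp (p / 2) = exp (- q / 2) * exp ((p + q) / 2)"
      unfolding exp_add[symmetric] by (simp add: field_simps)
    ultimately have "(1 - exp (- q)) * (exp p - exp q) / (exp p - 1)
        = exp (- q / 2) * exp ((p + q) / 2) * (4 * sinh (q / 2) * sinh (s / 2))
          / (exp (- q / 2) * exp ((p + q) / 2) * (2 * sinh (p / 2)))"
      unfolding exp_diff_sinh[of p q] s_def by (simp only: mult_ac)
    also have "\<dots> = 2 * sinh (q / 2) * sinh (s / 2) / sinh (p / 2)" by simp
    finally have X: "(1 - exp (- q)) * (exp p - exp q) / (exp p - 1)
        = 2 * sinh (q / 2) * sinh (s / 2) / sinh (p / 2)" .
    have "p * (1 - exp (- q)) * (exp p - exp q) / (exp p - 1)
        = p * ((1 - exp (- q)) * (exp p - exp q) / (exp p - 1))" by (simp only: mult.assoc times_divide_eq_right)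
    also have "\<dots> = q * s * R"
      unfolding X R_def \<psi>_def using sp p q s by (simp add: field_simps)
    finally show ?thesis .
  qed
  then have eq: "p * (1 - exp (- q)) * (exp p - exp q) / (exp p - 1) - q * (p - q) = q * s * (R - 1)"
    by (simp add: s_def algebra_simps)
  have pp: "p \<noteq> 0" "\<bar>p\<bar> \<le> t" "q \<noteq> 0" "\<bar>q\<bar> \<le> t" using p q by auto
  have Rl: "1 - K * t\<^sup>2 \<le> R"
  proof -
    have "0 < 1 + K * t\<^sup>2" using K by (simp add: add_pos_nonneg)
    have "(1 - K * t\<^sup>2) * (1 + K * t\<^sup>2) = 1 - (K * t\<^sup>2) * (K * t\<^sup>2)" by (simp add: algebra_simps)
    then have "(1 - K * t\<^sup>2) * (1 + K * t\<^sup>2) \<le> 1" using zero_le_square[of "K * t\<^sup>2"] by linarith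
    then have "1 - K * t\<^sup>2 \<le> 1 / (1 + K * t\<^sup>2)" using \<open>0 < 1 + K * t\<^sup>2\<close> by (simp add: le_divide_eq)
    also have "\<dots> \<le> \<psi> q * \<psi> s / \<psi> p"
      using \<psi>[OF pp(1,2)] \<psi>(1)[OF pp(3,4)] \<psi>(1)[OF s] mult_mono[of 1 "\<psi> q" 1 "\<psi> s"]
      by (intro frac_le) auto
    finally show ?thesis by (simp add: R_def)
  qed
  have Ru: "R \<le> (1 + K * t\<^sup>2) * (1 + K * t\<^sup>2)"
  proof -
    have "R \<le> \<psi> q * \<psi> s / 1" unfolding R_def
      using \<psi>(1)[OF pp(1,2)] \<psi>(1)[OF pp(3,4)] \<psi>(1)[OF s] by (intro frac_le) auto
    also have "\<dots> \<le> (1 + K * t\<^sup>2) * (1 + K * t\<^sup>2)"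
      using \<psi>[OF pp(3,4)] \<psi>[OF s] by (auto intro!: mult_mono)
    finally show ?thesis .
  qed
  have KP: "K * t\<^sup>2 * (2 + K * t\<^sup>2) \<le> K * t\<^sup>2 * (2 + K * P\<^sup>2)"
    using K p t by (intro mult_left_mono add_left_mono power_mono) auto
  have "0 \<le> K * t\<^sup>2" using K by simp
  then have KP': "K * t\<^sup>2 * 1 \<le> K * t\<^sup>2 * (2 + K * P\<^sup>2)"
    by (intro mult_left_mono) (use K in auto)
  have "(1 + K * t\<^sup>2) * (1 + K * t\<^sup>2) = 1 + K * t\<^sup>2 * (2 + K * t\<^sup>2)" by (simp add: algebra_simps)
  then have "\<bar>R - 1\<bar> \<le> K * (2 + K * P\<^sup>2) * t\<^sup>2" using Rl Ru KP KP' by (simp add: mult_ac)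
  then have "q * \<bar>s\<bar> * \<bar>R - 1\<bar> \<le> q * \<bar>s\<bar> * (K * (2 + K * P\<^sup>2) * t\<^sup>2)" using q by (intro mult_left_mono) auto
  then show ?thesis unfolding eq abs_mult using q by (simp add: K_def s_def mult_ac)
qed

lemma abs_exp_minus_one_le: "\<bar>exp v - 1\<bar> \<le> \<bar>v\<bar> * exp \<bar>v::real\<bar>"
proof (cases "0 \<le> v")
  case True
  have "(1 - v) * exp v \<le> exp (- v) * exp v" using exp_ge_add_one_self[of "- v"] by (intro mult_right_mono) auto
  then show ?thesis using True by (simp add: algebra_simps flip: exp_add)
next
  case False
  have "1 - exp v \<le> - v" using exp_ge_add_one_self[of v] by linarith
  also have "- v * 1 \<le> - v * exp (- v)" using False by (intro mult_left_mono) auto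
  finally show ?thesis using False by simp
qed

text \<open>For steps wider than \<epsilon> the exponents p and q have no uniform bound, but their
  difference has. The growth of exp p is compensated by the denominator, since p exp p/(exp p - 1)
  \<le> p + 1. A bound without smallness in h suffices because (h/\<epsilon>)^2 > 1 in this
  regime.\<close>

lemma fitted_factor_large:
  fixes p q :: real
  assumes p: "0 < p" and q: "0 < q" and s: "\<bar>p - q\<bar> \<le> S"
  shows "\<bar>p * (1 - exp (- q)) * (exp p - exp q) / (exp p - 1) - q * (p - q)\<bar>
    \<le> \<bar>p - q\<bar> * exp S * (p + 1 + q)"
proof -
  have ep: "0 < exp p - 1" using p by simp
  have 1: "p * exp p / (exp p - 1) \<le> p + 1"
  proof -
    have "p \<le> exp p - 1" using exp_ge_add_one_self[of p] by linarith
    then have "p * exp p \<le> (p + 1) * (exp p - 1)" by (simp add: algebra_simps)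
    then show ?thesis using ep by (simp add: divide_le_eq)
  qed
  have "exp p - exp q = - (exp p * (exp (- (p - q)) - 1))"
    by (simp add: algebra_simps flip: exp_add)
  then have "\<bar>exp p - exp q\<bar> = exp p * \<bar>exp (- (p - q)) - 1\<bar>" by (simp add: abs_mult)
  also have "\<dots> \<le> exp p * (\<bar>p - q\<bar> * exp \<bar>p - q\<bar>)"
    using abs_exp_minus_one_le[of "- (p - q)"] by (intro mult_left_mono) (auto simp: abs_minus_commute)
  also have "\<dots> \<le> exp p * (\<bar>p - q\<bar> * exp S)" using s by (intro mult_left_mono) auto
  finally have 2: "\<bar>exp p - exp q\<bar> \<le> exp p * (\<bar>p - q\<bar> * exp S)" .
  have "\<bar>p * (1 - exp (- q)) * (exp p - exp q) / (exp p - 1)\<bar>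
      = p * (1 - exp (- q)) * \<bar>exp p - exp q\<bar> / (exp p - 1)"
    using p q ep by (simp add: abs_mult)
  also have "\<dots> \<le> p * 1 * (exp p * (\<bar>p - q\<bar> * exp S)) / (exp p - 1)"
    using 2 p q ep by (intro divide_right_mono mult_mono) auto
  also have "\<dots> = p * exp p / (exp p - 1) * (\<bar>p - q\<bar> * exp S)" by simp
  also have "\<dots> \<le> (p + 1) * (\<bar>p - q\<bar> * exp S)" using 1 by (rule mult_right_mono) simp
  finally have A: "\<bar>p * (1 - exp (- q)) * (exp p - exp q) / (exp p - 1)\<bar> \<le> (p + 1) * (\<bar>p - q\<bar> * exp S)" .
  have "0 \<le> S" using s by linarith
  then have "\<bar>q * (p - q)\<bar> \<le> q * (\<bar>p - q\<bar> * exp S)"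
    using q by (simp add: abs_mult mult_le_cancel_left1)
  then have "\<bar>p * (1 - exp (- q)) * (exp p - exp q) / (exp p - 1) - q * (p - q)\<bar>
      \<le> (p + 1) * (\<bar>p - q\<bar> * exp S) + q * (\<bar>p - q\<bar> * exp S)"
    using A by linarith
  then show ?thesis by (simp only: distrib_left distrib_right mult_ac)
qed

lemma mult_exp_neg_le_1: "y * exp (- y) \<le> (1::real)"
proof -
  have "y \<le> exp y" using exp_ge_add_one_self[of y] by linarith
  then have "y * exp (- y) \<le> exp y * exp (- y)" by (intro mult_right_mono) auto
  then show ?thesis by (simp flip: exp_add)
qed

text \<open>One summand per regime: the first comes from \<open>fitted_factor_small\<close> with P =
  M when h \<le> \<epsilon>, the second from \<open>fitted_factor_large\<close> with S = M \<Lambda>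
  when h > \<epsilon>.\<close>

definition layer_const :: "real \<Rightarrow> real \<Rightarrow> real \<Rightarrow> real" where
  "layer_const \<beta> M \<Lambda> = (cosh M)\<^sup>2 * (2 + (cosh M)\<^sup>2 * M\<^sup>2) * M ^ 3 + M * exp (M * \<Lambda>) * (M / \<beta> + 1 / \<beta> + 1)"

text \<open>The error is E(x_i) times \<epsilon>/h^2 times a factor that vanishes for p = q, so it
  is driven solely by the change of b between 0 and x_i. That change is at most M x_i and grows with
  i, but only in the combination q i exp(-q i), which never exceeds 1.\<close>

lemma exponential_truncation:
  fixes b c :: "real \<Rightarrow> real" and x :: "nat \<Rightarrow> real"
  assumes eps: "0 < \<epsilon>" and h: "0 < h" and \<beta>: "0 < \<beta>" and i: "0 < i"
    and x: "x i = real i * h" "x (i - 1) = x i - h" "x (i + 1) = x i + h"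
    and b0: "\<beta> \<le> b0" "b0 \<le> M" and b: "\<beta> \<le> b (x i)" "b (x i) \<le> M"
    and lip: "\<bar>b (x i) - b0\<bar> \<le> M * x i" and L: "x i * h / \<epsilon> \<le> \<Lambda>"
  defines "E \<equiv> (\<lambda>t. exp (- b0 * t / \<epsilon>))"
  shows "\<bar>ASI_op \<epsilon> b c x (\<lambda>j. E (x j)) i
      - (- \<epsilon> * ((b0 / \<epsilon>)\<^sup>2 * E (x i)) - b (x i) * (- (b0 / \<epsilon>) * E (x i)) + c (x i) * E (x i))\<bar>
    \<le> layer_const \<beta> M \<Lambda> * (h / \<epsilon>)\<^sup>2"
proof -
  define p q where "p = b (x i) * h / \<epsilon>" and "q = b0 * h / \<epsilon>"
  have M: "0 < M" using \<beta> b0 by linarith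
  have pq: "0 < p" "0 < q" using b b0 \<beta> eps h by (auto simp: p_def q_def)
  have bp: "b (x i) = \<epsilon> / h * p" "b0 / \<epsilon> = q / h" using eps h by (auto simp: p_def q_def)
  define e where "e = E (x i)"
  have e: "0 < e" by (simp add: e_def E_def)
  have Ep: "E (x (i + 1)) = e * exp (- q)" and Em: "E (x (i - 1)) = e * exp q"
    unfolding e_def E_def x q_def exp_add[symmetric] by (simp_all add: algebra_simps diff_divide_distrib add_divide_distrib)
  have qi: "q * real i * e \<le> 1"
  proof -
    have "e = exp (- (q * real i))" unfolding e_def E_def x(1) q_def by (simp add: mult_ac)
    then show ?thesis using mult_exp_neg_le_1[of "q * real i"] by simp
  qed
  define F where "F = p * (1 - exp (- q)) * (exp p - exp q) / (exp p - 1) - q * (p - q)"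
  have sig: "sigma_fit (b (x i) * h / (2 * \<epsilon>)) = p / (exp p - 1)"
    using b \<beta> eps h by (simp add: sigma_fit_def p_def)
  have ep: "exp p - 1 \<noteq> 0" using pq by simp
  have tau: "ASI_op \<epsilon> b c x (\<lambda>j. E (x j)) i
      - (- \<epsilon> * ((b0 / \<epsilon>)\<^sup>2 * E (x i)) - b (x i) * (- (b0 / \<epsilon>) * E (x i)) + c (x i) * E (x i))
      = e * (\<epsilon> / h\<^sup>2) * F"
  proof -
    have hp: "x (i + 1) - x i = h" and hm: "x i - x (i - 1) = h" using x by auto
    have "ASI_op \<epsilon> b c x (\<lambda>j. E (x j)) i
      = - \<epsilon> * (p / (exp p - 1)) * (((e * exp (- q) - e) / h - (e - e * exp q) / h) / ((h + h) / 2))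
        - b (x i) * ((e * exp (- q) - e) / h) + c (x i) * e"
      unfolding ASI_op_def Let_def hp hm sig Ep Em e_def[symmetric] by (rule refl)
    also have "\<dots> = e * (\<epsilon> / h\<^sup>2) * (p * (1 - exp (- q)) * (1 - (exp q - 1) / (exp p - 1))) + c (x i) * e"
    proof -
      have "exp (- q) * exp q = 1" by (simp flip: exp_add)
      then have "exp (- q) - 2 + exp q = (1 - exp (- q)) * (exp q - 1)" by (simp add: algebra_simps)
      moreover have "((e * exp (- q) - e) / h - (e - e * exp q) / h) / ((h + h) / 2) = e * (exp (- q) - 2 + exp q) / h\<^sup>2"
        using h by (simp add: field_simps power2_eq_square)
      ultimately show ?thesis unfolding bp using h ep by (simp add: field_simps power2_eq_square)
    qed
    also have "1 - (exp q - 1) / (exp p - 1) = (exp p - exp q) / (exp p - 1)"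
      using ep by (simp add: field_simps)
    finally have 1: "ASI_op \<epsilon> b c x (\<lambda>j. E (x j)) i
        = e * (\<epsilon> / h\<^sup>2) * (p * (1 - exp (- q)) * (exp p - exp q) / (exp p - 1)) + c (x i) * e" by simp
    have 2: "- \<epsilon> * ((b0 / \<epsilon>)\<^sup>2 * E (x i)) - b (x i) * (- (b0 / \<epsilon>) * E (x i)) = e * (\<epsilon> / h\<^sup>2) * (q * (p - q))"
      unfolding bp e_def[symmetric] by (simp add: power2_eq_square algebra_simps diff_divide_distrib)
    show ?thesis unfolding 1 2 F_def unfolding e_def[symmetric] by (simp add: right_diff_distrib)
  qed
  have spq: "\<bar>p - q\<bar> \<le> M * (real i * h\<^sup>2 / \<epsilon>)"
  proof -
    have "\<bar>p - q\<bar> = \<bar>b (x i) - b0\<bar> * (h / \<epsilon>)"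
      using eps h by (simp add: p_def q_def abs_mult flip: left_diff_distrib diff_divide_distrib)
    also have "\<dots> \<le> M * x i * (h / \<epsilon>)" using lip eps h by (intro mult_right_mono) auto
    finally show ?thesis by (simp add: x(1) power2_eq_square mult_ac)
  qed
  have C0: "0 \<le> (cosh M)\<^sup>2 * (2 + (cosh M)\<^sup>2 * M\<^sup>2) * M ^ 3" "0 \<le> M * exp (M * \<Lambda>) * (M / \<beta> + 1 / \<beta> + 1)"
    using M \<beta> by auto
  have "e * (\<epsilon> / h\<^sup>2) * \<bar>F\<bar> \<le> layer_const \<beta> M \<Lambda> * (h / \<epsilon>)\<^sup>2"
  proof (cases "h \<le> \<epsilon>")
    case True
    define K where "K = (cosh M)\<^sup>2 * (2 + (cosh M)\<^sup>2 * M\<^sup>2)"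
    define t where "t = M * h / \<epsilon>"
    have "p \<le> t" "q \<le> t" using b b0 eps h by (auto simp: p_def q_def t_def divide_right_mono)
    moreover have "t \<le> M" using True eps M by (simp add: t_def divide_le_eq)
    ultimately have "\<bar>F\<bar> \<le> K * (q * \<bar>p - q\<bar> * t\<^sup>2)"
      unfolding F_def K_def using fitted_factor_small[of p t q M] pq by simp
    also have "\<dots> \<le> K * (q * (M * (real i * h\<^sup>2 / \<epsilon>)) * t\<^sup>2)"
      using spq pq M by (intro mult_left_mono mult_right_mono) (auto simp: K_def)
    finally have "e * (\<epsilon> / h\<^sup>2) * \<bar>F\<bar> \<le> e * (\<epsilon> / h\<^sup>2) * (K * (q * (M * (real i * h\<^sup>2 / \<epsilon>)) * t\<^sup>2))"
      using e eps by (intro mult_left_mono) auto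
    also have "\<dots> = (q * real i * e) * (K * M ^ 3 * (h / \<epsilon>)\<^sup>2)"
      using h eps by (simp add: t_def power2_eq_square power3_eq_cube)
    also have "\<dots> \<le> 1 * (K * M ^ 3 * (h / \<epsilon>)\<^sup>2)"
      using qi M by (intro mult_right_mono) (auto simp: K_def)
    also have "\<dots> \<le> layer_const \<beta> M \<Lambda> * (h / \<epsilon>)\<^sup>2"
      unfolding layer_const_def K_def using C0 by (simp add: distrib_right)
    finally show ?thesis .
  next
    case False
    have S: "\<bar>p - q\<bar> \<le> M * \<Lambda>"
    proof -
      have "real i * h\<^sup>2 / \<epsilon> \<le> \<Lambda>" using L by (simp add: x(1) power2_eq_square mult_ac)
      then show ?thesis using spq M by (meson mult_left_mono less_imp_le order_trans)
    qed
    \<comment> \<open>Since h > \<epsilon>, q is bounded below by \<beta>. The constant in p + 1 + q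
      can then be absorbed into a multiple of q, the factor needed to form q i exp(-q i).\<close>
    have q1: "1 \<le> q / \<beta>"
    proof -
      have "\<beta> * \<epsilon> \<le> b0 * h" using False b0 \<beta> eps by (intro mult_mono) auto
      then have "\<epsilon> * \<beta> \<le> b0 * h" by (simp only: mult.commute)
      then show ?thesis using \<beta> eps by (simp add: q_def le_divide_eq)
    qed
    have "p \<le> M / \<beta> * q"
    proof -
      have "b (x i) * \<beta> \<le> M * b0" using b b0 \<beta> by (intro mult_mono) auto
      then have "b (x i) \<le> M / \<beta> * b0" using \<beta> by (simp add: field_simps)
      then have "b (x i) * (h / \<epsilon>) \<le> M / \<beta> * b0 * (h / \<epsilon>)" using h eps by (intro mult_right_mono) auto
      then show ?thesis by (simp add: p_def q_def)
    qed
    then have pq1: "p + 1 + q \<le> q * (M / \<beta> + 1 / \<beta> + 1)" using q1 by (simp add: algebra_simps)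
    have "\<bar>F\<bar> \<le> \<bar>p - q\<bar> * exp (M * \<Lambda>) * (p + 1 + q)"
      unfolding F_def by (rule fitted_factor_large[OF pq S])
    also have "\<dots> \<le> M * (real i * h\<^sup>2 / \<epsilon>) * exp (M * \<Lambda>) * (q * (M / \<beta> + 1 / \<beta> + 1))"
      using spq pq1 pq M eps by (intro mult_mono) auto
    finally have "e * (\<epsilon> / h\<^sup>2) * \<bar>F\<bar>
        \<le> e * (\<epsilon> / h\<^sup>2) * (M * (real i * h\<^sup>2 / \<epsilon>) * exp (M * \<Lambda>) * (q * (M / \<beta> + 1 / \<beta> + 1)))"
      using e eps by (intro mult_left_mono) auto
    also have "\<dots> = (q * real i * e) * (M * exp (M * \<Lambda>) * (M / \<beta> + 1 / \<beta> + 1))"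
      using h eps by simp
    also have "\<dots> \<le> 1 * (M * exp (M * \<Lambda>) * (M / \<beta> + 1 / \<beta> + 1))"
      using qi C0 by (intro mult_right_mono) auto
    also have "\<dots> \<le> layer_const \<beta> M \<Lambda> * 1"
      unfolding layer_const_def using C0 by simp
    also have "\<dots> \<le> layer_const \<beta> M \<Lambda> * (h / \<epsilon>)\<^sup>2"
      using False eps C0 by (intro mult_left_mono) (auto simp: layer_const_def)
    finally show ?thesis .
  qed
  then show ?thesis unfolding tau abs_mult using e eps by simp
qed

section \<open>Derivative bounds\<close>

lemma abs_add_bound: "\<bar>p\<bar> \<le> P \<Longrightarrow> \<bar>q\<bar> \<le> S \<Longrightarrow> \<bar>p + q\<bar> \<le> P + (S::real)"
  and abs_diff_bound: "\<bar>p\<bar> \<le> P \<Longrightarrow> \<bar>q\<bar> \<le> S \<Longrightarrow> \<bar>p - q\<bar> \<le> P + (S::real)"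
  and abs_numeral_mult_bound: "\<bar>p\<bar> \<le> P \<Longrightarrow> \<bar>numeral k * p\<bar> \<le> numeral k * (P::real)"
  and abs_mult_bound: "\<bar>p\<bar> \<le> P \<Longrightarrow> \<bar>q\<bar> \<le> S \<Longrightarrow> \<bar>p * q\<bar> \<le> P * (S::real)"
  by (auto simp: abs_mult intro!: mult_mono)

text \<open>Everything that precedes the choice of \<epsilon> is collected here, and the constants
  are defined in this context. The concluding argument can then name its witnesses before
  \<epsilon>, N and the solutions are fixed; \<open>layer_problem\<close> adds those of the
  continuous problem.\<close>

locale problem_data =
  fixes b b1 b2 b3 c c1 c2 c3 f f1 f2 f3 :: "real \<Rightarrow> real" and \<beta> M :: real
  assumes \<beta>_pos: "0 < \<beta>" and M_ge_1: "1 \<le> M"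
    and b_ge: "\<And>x. x \<in> {0..1} \<Longrightarrow> \<beta> \<le> b x" and c_nonneg: "\<And>x. x \<in> {0..1} \<Longrightarrow> 0 \<le> c x"
    and cont_b: "continuous_on {0..1} b"
    and deriv_b: "\<And>x. 0 < x \<Longrightarrow> x < 1 \<Longrightarrow> (b has_real_derivative b1 x) (at x)"
    and deriv_b1: "\<And>x. 0 < x \<Longrightarrow> x < 1 \<Longrightarrow> (b1 has_real_derivative b2 x) (at x)"
    and deriv_b2: "\<And>x. 0 < x \<Longrightarrow> x < 1 \<Longrightarrow> (b2 has_real_derivative b3 x) (at x)"
    and deriv_c: "\<And>x. 0 < x \<Longrightarrow> x < 1 \<Longrightarrow> (c has_real_derivative c1 x) (at x)"
    and deriv_c1: "\<And>x. 0 < x \<Longrightarrow> x < 1 \<Longrightarrow> (c1 has_real_derivative c2 x) (at x)"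
    and deriv_c2: "\<And>x. 0 < x \<Longrightarrow> x < 1 \<Longrightarrow> (c2 has_real_derivative c3 x) (at x)"
    and deriv_f: "\<And>x. 0 < x \<Longrightarrow> x < 1 \<Longrightarrow> (f has_real_derivative f1 x) (at x)"
    and deriv_f1: "\<And>x. 0 < x \<Longrightarrow> x < 1 \<Longrightarrow> (f1 has_real_derivative f2 x) (at x)"
    and deriv_f2: "\<And>x. 0 < x \<Longrightarrow> x < 1 \<Longrightarrow> (f2 has_real_derivative f3 x) (at x)"
    and b_bound: "\<And>x. x \<in> {0..1} \<Longrightarrow> \<bar>b x\<bar> \<le> M \<and> \<bar>b1 x\<bar> \<le> M \<and> \<bar>b2 x\<bar> \<le> M \<and> \<bar>b3 x\<bar> \<le> M"
    and c_bound: "\<And>x. x \<in> {0..1} \<Longrightarrow> \<bar>c x\<bar> \<le> M \<and> \<bar>c1 x\<bar> \<le> M \<and> \<bar>c2 x\<bar> \<le> M \<and> \<bar>c3 x\<bar> \<le> M"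
    and f_bound: "\<And>x. x \<in> {0..1} \<Longrightarrow> \<bar>f x\<bar> \<le> M \<and> \<bar>f1 x\<bar> \<le> M \<and> \<bar>f2 x\<bar> \<le> M \<and> \<bar>f3 x\<bar> \<le> M"
begin

text \<open>Uniformity of the final bound in \<open>\<epsilon>\<close> rests on all constants being functions of \<open>\<beta>\<close> and \<open>M\<close> alone.\<close>

definition "U0 = 2 * M / \<beta>"
definition "U1 = (M * U0 + M) / \<beta>"
definition "U2 = (M * U0 + 2 * (M * U1) + M) / \<beta>"
definition "U3 = (M * U0 + 3 * (M * U1) + 3 * (M * U2) + M) / \<beta>"
definition "U4 = (M * U0 + 4 * (M * U1) + 6 * (M * U2) + 4 * (M * U3) + M) / \<beta>"

text \<open>The rate must lie below \<beta>, so that a factor x/\<epsilon> can be absorbed. Two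
  thirds is matched to the mesh: where exp(-\<beta> x/\<epsilon>) \<le> \<epsilon>^3, one has
  exp(-\<kappa> x/\<epsilon>) \<le> \<epsilon>^2, which makes the layer parts of z'' and z''' as
  small as their regular parts, \<epsilon> and 1.\<close>

definition "\<kappa> = 2 * \<beta> / 3"
definition "KE = M * M * (3 / \<beta>) + M"
definition "KE1 = M * M + M + M * KE"
definition "KE2 = M * M + M + 2 * (M * (M * M + M)) + M * M * KE"
definition "KG = U2 + U3 + U4 + U0 * (KE + KE1 + KE2)"
text \<open>The maximum of the barrier in \<open>z_bound\<close>, divided by \<epsilon>: twice the
  coefficient of its linear part plus that of its layer part. The latter is (KG + 1) / (\<kappa>
  (\<beta> - \<kappa>)) with \<kappa> (\<beta> - \<kappa>) = 2 \<beta>^2/9.\<close>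

definition "KZ = 2 * ((KG + 1 + U0) / \<beta>) + 9 * (KG + 1) / (2 * \<beta>\<^sup>2)"
text \<open>Specialises \<open>first_order_layer_bound\<close> to this \<kappa>, where 1/(\<beta> -
  \<kappa>) = 3/\<beta>. The term 4 K/\<beta> dominates both K/\<beta> for the regular part and 3
  K/\<beta> for the layer part.\<close>

definition "layer_K K Y = 4 * K / \<beta> + exp (2 * M) * (Y + 2 * K)"
definition "K1 = layer_K (M * KZ + KG) KZ"
definition "KH = M * KZ + 2 * (M * K1) + KG"
definition "K2 = layer_K KH (M * KZ + 2 * KG + 2 * (M * K1))"
definition "K3 = KH + M * K2"
definition "K4 = M * KZ + 2 * KG + 6 * (M * K1) + 6 * (M * K2) + 2 * (M * K3)"

lemma U_nonneg: "0 \<le> U0" "0 \<le> U1" "0 \<le> U2" "0 \<le> U3" "0 \<le> U4"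
proof -
  show 0: "0 \<le> U0" using \<beta>_pos M_ge_1 by (simp add: U0_def)
  show 1: "0 \<le> U1" using 0 \<beta>_pos M_ge_1 by (simp add: U1_def)
  show 2: "0 \<le> U2" using 0 1 \<beta>_pos M_ge_1 by (simp add: U2_def)
  show 3: "0 \<le> U3" using 0 1 2 \<beta>_pos M_ge_1 by (simp add: U3_def)
  show 4: "0 \<le> U4" using 0 1 2 3 \<beta>_pos M_ge_1 by (simp add: U4_def)
qed

lemma KE_nonneg: "0 \<le> KE" "0 \<le> KE1" "0 \<le> KE2"
proof -
  show 0: "0 \<le> KE" using \<beta>_pos M_ge_1 by (simp add: KE_def)
  show "0 \<le> KE1" "0 \<le> KE2" using 0 M_ge_1 by (simp_all add: KE1_def KE2_def)
qed

lemma layer_K_nonneg: "0 \<le> K \<Longrightarrow> 0 \<le> Y \<Longrightarrow> 0 \<le> layer_K K Y"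
  using \<beta>_pos by (simp add: layer_K_def)

lemma K_nonneg: "0 \<le> KG" "0 \<le> KZ" "0 \<le> K1" "0 \<le> KH" "0 \<le> K2" "0 \<le> K3" "0 \<le> K4"
proof -
  have M: "0 \<le> M" using M_ge_1 by simp
  show G: "0 \<le> KG" using U_nonneg KE_nonneg by (simp add: KG_def)
  show Z: "0 \<le> KZ" using G U_nonneg \<beta>_pos by (simp add: KZ_def)
  show 1: "0 \<le> K1" unfolding K1_def using M G Z by (intro layer_K_nonneg) auto
  show H: "0 \<le> KH" unfolding KH_def using M G Z 1 by simp
  show 2: "0 \<le> K2" unfolding K2_def using M G Z 1 H by (intro layer_K_nonneg) auto
  show 3: "0 \<le> K3" unfolding K3_def using M H 2 by simp
  show "0 \<le> K4" unfolding K4_def using M G Z 1 2 3 by simp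
qed

definition "CF \<Lambda> = U0 * layer_const \<beta> M \<Lambda> + (K4 + 2 * (M * K3) + 2 * (M\<^sup>2 * K2))"
text \<open>The added 1 keeps the constant strictly positive, as \<open>discrete_stability\<close>
  demands of the error level from \<open>J\<close> on.\<close>

definition "CC = U0 * (2 * M ^ 3) + 2 * K3 + 2 * (M * K2) + 1"

lemma C_nonneg: "0 \<le> CF \<Lambda>" "0 < CC"
proof -
  have "0 \<le> layer_const \<beta> M \<Lambda>" using M_ge_1 \<beta>_pos by (simp add: layer_const_def)
  then show "0 \<le> CF \<Lambda>" using K_nonneg U_nonneg M_ge_1 by (simp add: CF_def)
  show "0 < CC" using K_nonneg U_nonneg M_ge_1 by (simp add: CC_def add_nonneg_pos)
qed

lemma b_0: "\<beta> \<le> b 0" "b 0 \<le> M" "0 < b 0"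
  using b_ge[of 0] b_bound[of 0] \<beta>_pos by auto

lemma b_lipschitz:
  assumes "0 < x" "x < 1"
  shows "\<bar>b x - b 0\<bar> \<le> M * x"
proof -
  have "continuous_on {0..x} b" using cont_b by (rule continuous_on_subset) (use assms in auto)
  moreover have "b differentiable (at t)" if "0 < t" "t < x" for t
    using deriv_b[of t] that assms by (auto simp: real_differentiable_def)
  ultimately obtain l t where t: "0 < t" "t < x" "DERIV b t :> l" "b x - b 0 = (x - 0) * l"
    using MVT[OF assms(1)] by blast
  have "l = b1 t" using t assms by (intro DERIV_unique[OF t(3) deriv_b]) auto
  then have "\<bar>l\<bar> \<le> M" using b_bound[of t] t assms by auto
  then show ?thesis unfolding t(4) using assms by (simp add: abs_mult mult.commute mult_right_mono)
qed

lemma divide_b_bound: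
  assumes "x \<in> {0..1}" "\<bar>n\<bar> \<le> S"
  shows "\<bar>n / b x\<bar> \<le> S / \<beta>"
  using b_ge[OF assms(1)] \<beta>_pos assms(2) by (auto simp: abs_divide intro!: frac_le)

end

locale layer_problem = problem_data +
  fixes \<epsilon> :: real and u u' u'' u0 u0' u0'' :: "real \<Rightarrow> real"
  assumes eps: "0 < \<epsilon>" "\<epsilon> < 1"
    and cont_u: "continuous_on {0..1} u" and u_bnd: "u 0 = 0" "u 1 = 0"
    and deriv_u: "\<And>x. 0 < x \<Longrightarrow> x < 1 \<Longrightarrow> (u has_real_derivative u' x) (at x)"
    and deriv_u': "\<And>x. 0 < x \<Longrightarrow> x < 1 \<Longrightarrow> (u' has_real_derivative u'' x) (at x)"
    and ode_u: "\<And>x. 0 < x \<Longrightarrow> x < 1 \<Longrightarrow> - \<epsilon> * u'' x - b x * u' x + c x * u x = f x"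
    and cont_u0: "continuous_on {0..1} u0" and u0_bnd: "u0 1 = 0"
    and deriv_u0: "\<And>x. 0 < x \<Longrightarrow> x < 1 \<Longrightarrow> (u0 has_real_derivative u0' x) (at x)"
    and deriv_u0': "\<And>x. 0 < x \<Longrightarrow> x < 1 \<Longrightarrow> (u0' has_real_derivative u0'' x) (at x)"
    and ode_u0: "\<And>x. 0 < x \<Longrightarrow> x < 1 \<Longrightarrow> - b x * u0' x + c x * u0 x = f x"
begin

lemma b_pos: "x \<in> {0..1} \<Longrightarrow> 0 < b x"
  using b_ge[of x] \<beta>_pos by linarith

text \<open>Since \<open>c\<close> is nonnegative, \<open>u0\<^sup>2 exp x\<close> decreases at most at a bounded rate.\<close>

lemma u0_bound:
  assumes "x \<in> {0..1}"
  shows "\<bar>u0 x\<bar> \<le> U0"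
proof -
  define K where "K = M / \<beta>"
  have K0: "0 \<le> K" using \<beta>_pos M_ge_1 by (simp add: K_def)
  define F where "F = (\<lambda>x. (u0 x)\<^sup>2 * exp x + 3 * K\<^sup>2 * x)"
  have inc: "\<exists>d. (F has_real_derivative d) (at t) \<and> 0 \<le> d" if t: "x < t" "t < 1" for t
  proof -
    have t01: "0 < t" "t < 1" "t \<in> {0..1}" using t assms by auto
    have bt: "0 < b t" using b_pos t01 by simp
    have u0': "u0' t = c t / b t * u0 t - f t / b t"
      using ode_u0[OF t01(1,2)] bt by (simp add: field_simps)
    \<comment> \<open>The term with c has a favourable sign and is dropped. By the inequality
      between products and squares, the source term costs u0^2, exactly what differentiating the
      weight \<open>exp\<close> returns, plus a constant.\<close>
    have "2 * u0 t * u0' t = 2 * (c t / b t) * (u0 t)\<^sup>2 - 2 * (u0 t * (f t / b t))"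
      unfolding u0' by (simp add: algebra_simps power2_eq_square)
    moreover have "0 \<le> 2 * (c t / b t) * (u0 t)\<^sup>2" using c_nonneg[OF t01(3)] bt by simp
    moreover have "2 * (u0 t * (f t / b t)) \<le> (u0 t)\<^sup>2 + (f t / b t)\<^sup>2"
      using sum_squares_bound[of "u0 t" "f t / b t"] by (simp add: mult.assoc)
    moreover have "(f t / b t)\<^sup>2 \<le> K\<^sup>2"
      using divide_b_bound[OF t01(3), of "f t" M] f_bound[OF t01(3)] power2_le_iff_abs_le[OF K0]
      by (simp add: K_def)
    ultimately have "- K\<^sup>2 \<le> 2 * u0 t * u0' t + (u0 t)\<^sup>2" by linarith
    then have "- K\<^sup>2 * exp t \<le> (2 * u0 t * u0' t + (u0 t)\<^sup>2) * exp t"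
      by (rule mult_right_mono) simp
    moreover have "exp t \<le> 3" using exp_le exp_le_cancel_iff[of t 1] t01 by linarith
    then have "K\<^sup>2 * exp t \<le> K\<^sup>2 * 3" by (intro mult_left_mono) auto
    ultimately have "0 \<le> (2 * u0 t * u0' t + (u0 t)\<^sup>2) * exp t + 3 * K\<^sup>2" by linarith
    moreover have "(F has_real_derivative 2 * u0 t * u0' t * exp t + exp t * (u0 t)\<^sup>2 + 3 * K\<^sup>2) (at t)"
      unfolding F_def by (auto intro!: derivative_eq_intros deriv_u0 t01)
    then have "(F has_real_derivative (2 * u0 t * u0' t + (u0 t)\<^sup>2) * exp t + 3 * K\<^sup>2) (at t)"
      by (simp add: algebra_simps)
    ultimately show ?thesis by blast
  qed
  have contF: "continuous_on {x..1} F"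
    unfolding F_def using assms
    by (intro continuous_intros continuous_on_subset[OF cont_u0]) auto
  have "F x \<le> F 1"
    by (rule DERIV_nonneg_imp_increasing_open[OF _ inc contF]) (use assms in auto)
  then have "(u0 x)\<^sup>2 * exp x \<le> 3 * K\<^sup>2 * (1 - x)" by (simp add: F_def u0_bnd algebra_simps)
  also have "\<dots> \<le> (2 * K)\<^sup>2"
  proof -
    have "K\<^sup>2 * (1 - x) \<le> K\<^sup>2 * 1" using assms by (intro mult_left_mono) auto
    moreover have "0 \<le> K\<^sup>2" "(2 * K)\<^sup>2 = 4 * K\<^sup>2" by (simp_all add: power_mult_distrib)
    moreover have "3 * K\<^sup>2 * (1 - x) = 3 * (K\<^sup>2 * (1 - x))" by (simp only: mult.assoc)
    ultimately show ?thesis by linarith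
  qed
  finally have 1: "(u0 x)\<^sup>2 * exp x \<le> (2 * K)\<^sup>2" .
  have "1 \<le> exp x" using assms by simp
  then have "(u0 x)\<^sup>2 * 1 \<le> (u0 x)\<^sup>2 * exp x" by (rule mult_left_mono) simp
  then have "(u0 x)\<^sup>2 \<le> (2 * K)\<^sup>2" using 1 by linarith
  moreover have "0 \<le> 2 * K" using K0 by simp
  ultimately have "\<bar>u0 x\<bar> \<le> 2 * K" using power2_le_iff_abs_le by blast
  then show ?thesis by (simp add: U0_def K_def)
qed

section \<open>Higher derivatives of the reduced solution\<close>

definition u03 where "u03 x = (c2 x * u0 x + 2 * (c1 x * u0' x) + c x * u0'' x - f2 x - b2 x * u0' x
  - 2 * (b1 x * u0'' x)) / b x"
definition u04 where "u04 x = (c3 x * u0 x + 3 * (c2 x * u0' x) + 3 * (c1 x * u0'' x) + c x * u03 x - f3 x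
  - b3 x * u0' x - 3 * (b2 x * u0'' x) - 3 * (b1 x * u03 x)) / b x"

text \<open>Differentiability of \<open>v\<close> is a conclusion: on the open interval v equals
  n/b, and the quotient rule applies. Used on the reduced equation and then on its derivatives, this
  gains one derivative of \<open>u0\<close> at a time.\<close>

lemma derivative_from_product:
  assumes "0 < x" "x < 1" and der: "(n has_real_derivative n') (at x)"
    and eq: "\<And>t. 0 < t \<Longrightarrow> t < 1 \<Longrightarrow> b t * v t = n t"
  shows "(v has_real_derivative (n' - b1 x * v x) / b x) (at x)"
proof -
  have bx: "0 < b x" using b_pos[of x] assms by simp
  have "((\<lambda>t. n t / b t) has_real_derivative (n' * b x - n x * b1 x) / (b x * b x)) (at x)"
    using assms bx by (intro DERIV_divide deriv_b) auto
  moreover have "(n' * b x - n x * b1 x) / (b x * b x) = (n' - b1 x * v x) / b x"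
    unfolding eq[OF assms(1,2), symmetric] using bx by (simp add: field_simps)
  ultimately have "((\<lambda>t. n t / b t) has_real_derivative (n' - b1 x * v x) / b x) (at x)" by simp
  moreover have "open {0<..<1::real}" "x \<in> {0<..<1}" using assms by auto
  moreover have "n t / b t = v t" if "t \<in> {0<..<1}" for t
    using eq[of t] b_pos[of t] that by (simp add: divide_eq_eq mult.commute)
  ultimately show ?thesis by (rule has_field_derivative_transform_within_open)
qed

lemma u0''_eq:
  assumes x: "0 < x" "x < 1"
  shows "b x * u0'' x = c1 x * u0 x + c x * u0' x - f1 x - b1 x * u0' x"
proof -
  have eq: "b t * u0' t = c t * u0 t - f t" if "0 < t" "t < 1" for t
    using ode_u0[OF that] by linarith
  have n: "((\<lambda>x. c x * u0 x - f x) has_real_derivative c1 x * u0 x + c x * u0' x - f1 x) (at x)"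
    using x by (auto intro!: derivative_eq_intros deriv_c deriv_u0 deriv_f)
  have "(u0' has_real_derivative (c1 x * u0 x + c x * u0' x - f1 x - b1 x * u0' x) / b x) (at x)"
    by (rule derivative_from_product[OF x n eq])
  \<comment> \<open>Here \<open>u0''\<close> is given in advance as a derivative of
    \<open>u0'\<close>. Its formula therefore comes from uniqueness of the derivative, whereas
    \<open>u03\<close> and \<open>u04\<close> are defined by theirs.\<close>
  from DERIV_unique[OF this deriv_u0'[OF x]] show ?thesis using b_pos[of x] x by (simp add: field_simps)
qed

lemma deriv_u0'':
  assumes x: "0 < x" "x < 1"
  shows "(u0'' has_real_derivative u03 x) (at x)"
proof -
  have n: "((\<lambda>x. c1 x * u0 x + c x * u0' x - f1 x - b1 x * u0' x) has_real_derivative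
      c2 x * u0 x + 2 * (c1 x * u0' x) + c x * u0'' x - f2 x - b2 x * u0' x - b1 x * u0'' x) (at x)"
    using x by (auto intro!: derivative_eq_intros deriv_c deriv_c1 deriv_u0 deriv_u0' deriv_f1 deriv_b1)
  have "(u0'' has_real_derivative (c2 x * u0 x + 2 * (c1 x * u0' x) + c x * u0'' x - f2 x - b2 x * u0' x
      - b1 x * u0'' x - b1 x * u0'' x) / b x) (at x)"
    by (rule derivative_from_product[OF x n u0''_eq])
  then show ?thesis unfolding u03_def by (rule back_subst[of "\<lambda>d. (u0'' has_real_derivative d) (at x)"])
      (rule arg_cong2[of _ _ _ _ "(/)"], linarith, rule refl)
qed

lemma deriv_u03:
  assumes x: "0 < x" "x < 1"
  shows "(u03 has_real_derivative u04 x) (at x)"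
proof -
  have n: "((\<lambda>x. c2 x * u0 x + 2 * (c1 x * u0' x) + c x * u0'' x - f2 x - b2 x * u0' x - 2 * (b1 x * u0'' x))
      has_real_derivative
      c3 x * u0 x + 3 * (c2 x * u0' x) + 3 * (c1 x * u0'' x) + c x * u03 x - f3 x
      - b3 x * u0' x - 3 * (b2 x * u0'' x) - 2 * (b1 x * u03 x)) (at x)"
    using x by (auto intro!: derivative_eq_intros deriv_c deriv_c1 deriv_c2 deriv_u0 deriv_u0' deriv_u0''
        deriv_f2 deriv_b1 deriv_b2)
  have eq: "b t * u03 t = c2 t * u0 t + 2 * (c1 t * u0' t) + c t * u0'' t - f2 t - b2 t * u0' t - 2 * (b1 t * u0'' t)"
    if "0 < t" "t < 1" for t using b_pos[of t] that by (simp add: u03_def)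
  have "(u03 has_real_derivative (c3 x * u0 x + 3 * (c2 x * u0' x) + 3 * (c1 x * u0'' x) + c x * u03 x - f3 x
      - b3 x * u0' x - 3 * (b2 x * u0'' x) - 2 * (b1 x * u03 x) - b1 x * u03 x) / b x) (at x)"
    by (rule derivative_from_product[OF x n eq])
  then show ?thesis unfolding u04_def
    by (rule back_subst[of "\<lambda>d. (u03 has_real_derivative d) (at x)"])
      (rule arg_cong2[of _ _ _ _ "(/)"], linarith, rule refl)
qed

lemma u0_derivative_bounds:
  assumes x: "0 < x" "x < 1"
  shows "\<bar>u0' x\<bar> \<le> U1" "\<bar>u0'' x\<bar> \<le> U2" "\<bar>u03 x\<bar> \<le> U3" "\<bar>u04 x\<bar> \<le> U4"
proof -
  have x01: "x \<in> {0..1}" using x by simp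
  have bb: "\<bar>b1 x\<bar> \<le> M" "\<bar>b2 x\<bar> \<le> M" "\<bar>b3 x\<bar> \<le> M" using b_bound[OF x01] by simp_all
  have cb: "\<bar>c x\<bar> \<le> M" "\<bar>c1 x\<bar> \<le> M" "\<bar>c2 x\<bar> \<le> M" "\<bar>c3 x\<bar> \<le> M" using c_bound[OF x01] by simp_all
  have fb: "\<bar>f x\<bar> \<le> M" "\<bar>f1 x\<bar> \<le> M" "\<bar>f2 x\<bar> \<le> M" "\<bar>f3 x\<bar> \<le> M" using f_bound[OF x01] by simp_all
  note bounds = abs_add_bound abs_diff_bound abs_numeral_mult_bound abs_mult_bound bb cb fb
  have 0: "\<bar>u0 x\<bar> \<le> U0" using u0_bound x01 .
  have n: "\<bar>c x * u0 x - f x\<bar> \<le> M * U0 + M" by (intro bounds 0)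
  have eq: "u0' x = (c x * u0 x - f x) / b x" using ode_u0[OF x] b_pos[OF x01] by (simp add: field_simps)
  show 1: "\<bar>u0' x\<bar> \<le> U1" unfolding U1_def eq by (rule divide_b_bound[OF x01 n])
  have n: "\<bar>c1 x * u0 x + c x * u0' x - f1 x - b1 x * u0' x\<bar> \<le> M * U0 + M * U1 + M + M * U1"
    by (intro bounds 0 1)
  have eq: "u0'' x = (c1 x * u0 x + c x * u0' x - f1 x - b1 x * u0' x) / b x"
    using u0''_eq[OF x] b_pos[OF x01] by (simp add: field_simps)
  show 2: "\<bar>u0'' x\<bar> \<le> U2"
    using divide_b_bound[OF x01 n] unfolding U2_def eq[symmetric] by (simp add: algebra_simps)
  have n: "\<bar>c2 x * u0 x + 2 * (c1 x * u0' x) + c x * u0'' x - f2 x - b2 x * u0' x - 2 * (b1 x * u0'' x)\<bar>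
      \<le> M * U0 + 2 * (M * U1) + M * U2 + M + M * U1 + 2 * (M * U2)"
    by (intro bounds 0 1 2)
  show 3: "\<bar>u03 x\<bar> \<le> U3"
    using divide_b_bound[OF x01 n] unfolding U3_def u03_def[symmetric] by (simp add: algebra_simps)
  have n: "\<bar>c3 x * u0 x + 3 * (c2 x * u0' x) + 3 * (c1 x * u0'' x) + c x * u03 x - f3 x
      - b3 x * u0' x - 3 * (b2 x * u0'' x) - 3 * (b1 x * u03 x)\<bar>
      \<le> M * U0 + 3 * (M * U1) + 3 * (M * U2) + M * U3 + M + M * U1 + 3 * (M * U2) + 3 * (M * U3)"
    by (intro bounds 0 1 2 3)
  show "\<bar>u04 x\<bar> \<le> U4"
    using divide_b_bound[OF x01 n] unfolding U4_def u04_def[symmetric] by (simp add: algebra_simps)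
qed

subsection \<open>The layer function and the remainder\<close>

definition "E x = exp (- b 0 * x / \<epsilon>)"
definition "ex x = exp (- \<kappa> * x / \<epsilon>)"
definition "\<gamma> = - u0 0"
text \<open>The differential operator maps \<open>E\<close> to \<open>k0 * E\<close>. The
  coefficient of 1/\<epsilon> vanishes at 0, so it is of order x/\<epsilon> and is absorbed by the
  decay of \<open>E\<close>; this is why the source of \<open>z\<close> is bounded uniformly in
  \<epsilon>. \<open>k1\<close> and \<open>k2\<close> are its derivatives.\<close>

definition "k0 x = b 0 / \<epsilon> * (b x - b 0) + c x"
definition "k1 x = b 0 / \<epsilon> * b1 x + c1 x"
definition "k2 x = b 0 / \<epsilon> * b2 x + c2 x"
text \<open>The source of \<open>z\<close>: the operator maps u - u0 to \<epsilon> u0'', and the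
  contribution of the layer function is subtracted. \<open>g1\<close> and \<open>g2\<close> are its
  derivatives.\<close>

definition "g0 x = \<epsilon> * u0'' x - \<gamma> * (k0 x * E x)"
definition "g1 x = \<epsilon> * u03 x - \<gamma> * ((k1 x - b 0 / \<epsilon> * k0 x) * E x)"
definition "g2 x = \<epsilon> * u04 x - \<gamma> * ((k2 x - 2 * (b 0 / \<epsilon> * k1 x) + (b 0 / \<epsilon>)\<^sup>2 * k0 x) * E x)"
definition "z x = u x - u0 x - \<gamma> * E x"
definition "z1 x = u' x - u0' x + \<gamma> * (b 0 / \<epsilon> * E x)"
definition "z2 x = u'' x - u0'' x - \<gamma> * ((b 0 / \<epsilon>)\<^sup>2 * E x)"
text \<open>\<open>z3\<close> and \<open>z4\<close> are the once and twice differentiated equation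
  of \<open>z\<close>, solved for the highest derivative. This provides four derivatives although
  only two of \<open>u\<close> are given.\<close>

definition "z3 x = (c1 x * z x + c x * z1 x - g1 x - b1 x * z1 x - b x * z2 x) / \<epsilon>"
definition "z4 x = (c2 x * z x + 2 * (c1 x * z1 x) + c x * z2 x - g2 x - b2 x * z1 x - 2 * (b1 x * z2 x)
  - b x * z3 x) / \<epsilon>"

lemma deriv_E: "(E has_real_derivative - (b 0 / \<epsilon> * E x)) (at x)"
  unfolding E_def using eps by (auto intro!: derivative_eq_intros)

lemma E_le: "0 \<le> x \<Longrightarrow> E x \<le> exp (- \<beta> * x / \<epsilon>)"
  unfolding E_def using b_0 eps by (simp add: divide_right_mono mult_right_mono)

lemma E_pos: "0 < E x" "0 < ex x"
  by (simp_all add: E_def ex_def)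

lemma \<kappa>: "0 < \<kappa>" "\<kappa> < \<beta>" "\<beta> - \<kappa> = \<beta> / 3"
  using \<beta>_pos by (auto simp: \<kappa>_def)

lemma ex_le_1: "0 \<le> x \<Longrightarrow> ex x \<le> 1"
  unfolding ex_def using \<kappa> eps by simp

text \<open>The decay rate of \<open>E\<close> is at least \<beta>. Giving up a third of \<beta>
  leaves a factor exp(-\<beta> x/(3 \<epsilon>)), and its product with x/\<epsilon> is at most
  3/\<beta>.\<close>

lemma E_le_ex:
  assumes "0 \<le> x"
  shows "E x \<le> ex x" "x / \<epsilon> * E x \<le> 3 / \<beta> * ex x"
proof -
  define X where "X = x / \<epsilon>"
  have X: "0 \<le> X" using assms eps by (simp add: X_def)
  have s: "exp (- \<beta> * x / \<epsilon>) = exp (- (\<beta> / 3 * X)) * ex x"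
    unfolding ex_def X_def \<kappa>_def exp_add[symmetric] by (simp add: field_simps)
  have "exp (- (\<beta> / 3 * X)) * ex x \<le> 1 * ex x"
    using X \<beta>_pos E_pos by (intro mult_right_mono) (auto simp: less_imp_le)
  then show 1: "E x \<le> ex x" using E_le[OF assms] s by simp
  have "X * exp (- (\<beta> / 3 * X)) \<le> 3 / \<beta>"
    using mult_exp_neg_le_1[of "\<beta> / 3 * X"] \<beta>_pos by (simp add: field_simps)
  then have "X * exp (- (\<beta> / 3 * X)) * ex x \<le> 3 / \<beta> * ex x"
    using E_pos by (intro mult_right_mono) (auto simp: less_imp_le)
  moreover have "X * E x \<le> X * exp (- \<beta> * x / \<epsilon>)" using E_le[OF assms] X by (rule mult_left_mono)
  ultimately show "x / \<epsilon> * E x \<le> 3 / \<beta> * ex x" unfolding s by (simp add: X_def mult.assoc)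
qed

lemma \<gamma>_bound: "\<bar>\<gamma>\<bar> \<le> U0"
  using u0_bound[of 0] by (simp add: \<gamma>_def)

lemma scale_le: "ex x \<le> ex x / \<epsilon>" "ex x / \<epsilon> \<le> ex x / \<epsilon>\<^sup>2"
  using eps E_pos[of x] by (simp_all add: field_simps power2_eq_square mult_left_le)

text \<open>The Lipschitz bound |b(x) - b(0)| \<le> M x pays for the 1/\<epsilon> in
  \<open>k0\<close>. In \<open>k1\<close> and \<open>k2\<close> the derivatives of b need not vanish
  at 0, and one factor 1/\<epsilon> remains.\<close>

lemma k_bounds:
  assumes x: "0 < x" "x < 1"
  shows "\<bar>k0 x * E x\<bar> \<le> KE * ex x" "\<bar>k1 x * E x\<bar> \<le> (M * M + M) * (ex x / \<epsilon>)"
    "\<bar>k2 x * E x\<bar> \<le> (M * M + M) * (ex x / \<epsilon>)"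
proof -
  have x01: "x \<in> {0..1}" using x by simp
  note E = E_le_ex[of x] E_pos[of x]
  have "\<bar>b 0 * (b x - b 0)\<bar> \<le> M * (M * x)"
    using b_0 b_lipschitz[OF x] by (intro abs_mult_bound) auto
  then have "\<bar>b 0 * (b x - b 0)\<bar> * (E x / \<epsilon>) \<le> M * (M * x) * (E x / \<epsilon>)"
    using eps E by (intro mult_right_mono) auto
  also have "\<dots> = M * M * (x / \<epsilon> * E x)" by simp
  also have "\<dots> \<le> M * M * (3 / \<beta> * ex x)" using E(2) x M_ge_1 by (intro mult_left_mono) auto
  finally have 1: "\<bar>b 0 / \<epsilon> * (b x - b 0) * E x\<bar> \<le> M * M * (3 / \<beta>) * ex x"
    using eps E by (simp add: abs_mult mult_ac)
  have 2: "\<bar>h * E x\<bar> \<le> M * ex x" if "\<bar>h\<bar> \<le> M" for h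
    using E x that by (intro abs_mult_bound) auto
  have "\<bar>c x * E x\<bar> \<le> M * ex x" using c_bound[OF x01] by (intro 2) simp
  with 1 show "\<bar>k0 x * E x\<bar> \<le> KE * ex x" unfolding k0_def KE_def distrib_right
    by (rule abs_add_bound)
  have 3: "\<bar>(b 0 / \<epsilon> * p + q) * E x\<bar> \<le> (M * M + M) * (ex x / \<epsilon>)" if "\<bar>p\<bar> \<le> M" "\<bar>q\<bar> \<le> M" for p q
  proof -
    have "\<bar>b 0 / \<epsilon>\<bar> \<le> M / \<epsilon>" using b_0 eps by (simp add: divide_right_mono)
    then have "\<bar>b 0 / \<epsilon> * p * E x\<bar> \<le> M / \<epsilon> * M * ex x" using that E x by (intro abs_mult_bound) auto
    moreover have "M * ex x \<le> M * (ex x / \<epsilon>)" using scale_le(1) M_ge_1 by (intro mult_left_mono) auto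
    then have "\<bar>q * E x\<bar> \<le> M * (ex x / \<epsilon>)" using 2[OF that(2)] by linarith
    ultimately show ?thesis unfolding distrib_right
      using abs_add_bound[of "b 0 / \<epsilon> * p * E x" "M / \<epsilon> * M * ex x" "q * E x" "M * (ex x / \<epsilon>)"] by (simp add: mult_ac)
  qed
  show "\<bar>k1 x * E x\<bar> \<le> (M * M + M) * (ex x / \<epsilon>)" "\<bar>k2 x * E x\<bar> \<le> (M * M + M) * (ex x / \<epsilon>)"
    unfolding k1_def k2_def by (rule 3; use b_bound[OF x01] c_bound[OF x01] in simp)+
qed

lemma weighted_diff_bound:
  assumes "\<bar>p\<bar> \<le> \<epsilon> * S" "\<bar>q\<bar> \<le> L * e" "0 \<le> L" "0 \<le> S" "S + L \<le> K" "0 \<le> e"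
  shows "\<bar>p - q\<bar> \<le> K * (\<epsilon> + e)"
proof -
  have "S * \<epsilon> \<le> K * \<epsilon>" "L * e \<le> K * e" using assms eps by (auto intro!: mult_right_mono)
  then show ?thesis using assms(1,2) by (simp add: algebra_simps)
qed

lemma g_bounds:
  assumes x: "0 < x" "x < 1"
  shows "\<bar>g0 x\<bar> \<le> KG * (\<epsilon> + ex x)" "\<bar>g1 x\<bar> \<le> KG * (\<epsilon> + ex x / \<epsilon>)" "\<bar>g2 x\<bar> \<le> KG * (\<epsilon> + ex x / \<epsilon>\<^sup>2)"
proof -
  note k = k_bounds[OF x] and u = u0_derivative_bounds[OF x] and E = E_pos[of x]
  have ee: "\<bar>\<epsilon>\<bar> \<le> \<epsilon>" using eps by simp
  have M0: "0 \<le> M" using M_ge_1 by simp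
  have b0e: "\<bar>b 0 / \<epsilon>\<bar> \<le> M / \<epsilon>" using b_0 eps by (simp add: divide_right_mono)
  have UK: "0 \<le> U0 * KE" "0 \<le> U0 * KE1" "0 \<le> U0 * KE2" using U_nonneg KE_nonneg by auto
  have t: "\<bar>\<gamma> * (k0 x * E x)\<bar> \<le> U0 * KE * ex x"
    unfolding mult.assoc[of U0] by (intro abs_mult_bound \<gamma>_bound k)
  show "\<bar>g0 x\<bar> \<le> KG * (\<epsilon> + ex x)" unfolding g0_def
    by (rule weighted_diff_bound[OF abs_mult_bound[OF ee u(2)] t])
      (use E eps U_nonneg KE_nonneg UK in \<open>simp_all add: KG_def algebra_simps\<close>)
  have "\<bar>b 0 / \<epsilon> * (k0 x * E x)\<bar> \<le> M / \<epsilon> * (KE * ex x)" by (intro abs_mult_bound b0e k)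
  from abs_diff_bound[OF k(2) this] have "\<bar>(k1 x - b 0 / \<epsilon> * k0 x) * E x\<bar> \<le> KE1 * (ex x / \<epsilon>)"
    by (simp add: KE1_def algebra_simps add_divide_distrib)
  then have t: "\<bar>\<gamma> * ((k1 x - b 0 / \<epsilon> * k0 x) * E x)\<bar> \<le> U0 * KE1 * (ex x / \<epsilon>)"
    unfolding mult.assoc[of U0] by (rule abs_mult_bound[OF \<gamma>_bound])
  show "\<bar>g1 x\<bar> \<le> KG * (\<epsilon> + ex x / \<epsilon>)" unfolding g1_def
    by (rule weighted_diff_bound[OF abs_mult_bound[OF ee u(3)] t])
      (use E eps U_nonneg KE_nonneg UK in \<open>simp_all add: KG_def algebra_simps\<close>)
  have "\<bar>k2 x * E x\<bar> \<le> (M * M + M) * (ex x / \<epsilon>\<^sup>2)"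
    using k(3) mult_left_mono[OF scale_le(2)[of x], of "M * M + M"] M0 by simp
  moreover have "\<bar>2 * (b 0 / \<epsilon> * (k1 x * E x))\<bar> \<le> 2 * (M / \<epsilon> * ((M * M + M) * (ex x / \<epsilon>)))"
    by (intro abs_numeral_mult_bound abs_mult_bound b0e k)
  moreover have "\<bar>b 0 / \<epsilon> * (b 0 / \<epsilon> * (k0 x * E x))\<bar> \<le> M / \<epsilon> * (M / \<epsilon> * (KE * ex x))"
    by (intro abs_mult_bound b0e k)
  ultimately have "\<bar>k2 x * E x - 2 * (b 0 / \<epsilon> * (k1 x * E x)) + b 0 / \<epsilon> * (b 0 / \<epsilon> * (k0 x * E x))\<bar>
      \<le> (M * M + M) * (ex x / \<epsilon>\<^sup>2) + 2 * (M / \<epsilon> * ((M * M + M) * (ex x / \<epsilon>))) + M / \<epsilon> * (M / \<epsilon> * (KE * ex x))"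
    by (intro abs_add_bound abs_diff_bound)
  also have "\<dots> = KE2 * (ex x / \<epsilon>\<^sup>2)" using eps by (simp add: KE2_def field_simps power2_eq_square)
  also have "k2 x * E x - 2 * (b 0 / \<epsilon> * (k1 x * E x)) + b 0 / \<epsilon> * (b 0 / \<epsilon> * (k0 x * E x))
      = (k2 x - 2 * (b 0 / \<epsilon> * k1 x) + (b 0 / \<epsilon>)\<^sup>2 * k0 x) * E x"
    by (simp add: algebra_simps power2_eq_square)
  finally have t: "\<bar>\<gamma> * ((k2 x - 2 * (b 0 / \<epsilon> * k1 x) + (b 0 / \<epsilon>)\<^sup>2 * k0 x) * E x)\<bar> \<le> U0 * KE2 * (ex x / \<epsilon>\<^sup>2)"
    unfolding mult.assoc[of U0] by (rule abs_mult_bound[OF \<gamma>_bound])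
  show "\<bar>g2 x\<bar> \<le> KG * (\<epsilon> + ex x / \<epsilon>\<^sup>2)" unfolding g2_def
    by (rule weighted_diff_bound[OF abs_mult_bound[OF ee u(4)] t])
      (use E eps U_nonneg KE_nonneg UK in \<open>simp_all add: KG_def algebra_simps\<close>)
qed

section \<open>Bounds for the remainder and its derivatives\<close>

lemma z_ode:
  assumes "0 < x" "x < 1"
  shows "- \<epsilon> * z2 x - b x * z1 x + c x * z x = g0 x"
proof -
  have "\<epsilon> * (b 0 / \<epsilon>)\<^sup>2 = b 0 / \<epsilon> * b 0" using eps by (simp add: power2_eq_square)
  then have "\<epsilon> * (\<gamma> * ((b 0 / \<epsilon>)\<^sup>2 * E x)) = \<gamma> * (b 0 / \<epsilon> * b 0 * E x)" by (metis mult.assoc mult.left_commute)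
  then show ?thesis using ode_u[OF assms] ode_u0[OF assms]
    unfolding z_def z1_def z2_def g0_def k0_def by (simp add: algebra_simps)
qed

lemma z_deriv:
  assumes x: "0 < x" "x < 1"
  shows "(z has_real_derivative z1 x) (at x)" "(z1 has_real_derivative z2 x) (at x)"
    "(z2 has_real_derivative z3 x) (at x)" "(z3 has_real_derivative z4 x) (at x)"
proof -
  define B where "B = b 0 / \<epsilon>"
  have dE: "(E has_real_derivative - (B * E x)) (at x)" for x
    unfolding B_def by (rule deriv_E)
  have 1: "(z has_real_derivative z1 x) (at x)" if x: "0 < x" "x < 1" for x
    unfolding z_def z1_def B_def[symmetric] by (auto intro!: derivative_eq_intros deriv_u deriv_u0 dE x)
  have 2: "(z1 has_real_derivative z2 x) (at x)" if x: "0 < x" "x < 1" for x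
    unfolding z1_def z2_def B_def[symmetric] by (auto intro!: derivative_eq_intros deriv_u' deriv_u0' dE x simp: power2_eq_square)
  have k0: "(k0 has_real_derivative k1 x) (at x)" "(k1 has_real_derivative k2 x) (at x)" if x: "0 < x" "x < 1" for x
    unfolding k0_def k1_def k2_def B_def[symmetric] by (auto intro!: derivative_eq_intros deriv_b deriv_c deriv_b1 deriv_c1 x)
  have g0: "(g0 has_real_derivative g1 x) (at x)" if x: "0 < x" "x < 1" for x
    unfolding g0_def g1_def B_def[symmetric] by (auto intro!: derivative_eq_intros k0 deriv_u0'' dE x simp: algebra_simps)
  have g1: "(g1 has_real_derivative g2 x) (at x)" if x: "0 < x" "x < 1" for x
    unfolding g1_def g2_def B_def[symmetric] by (auto intro!: derivative_eq_intros k0 deriv_u03 dE x simp: algebra_simps power2_eq_square)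
  have z2: "(c t * z t - g0 t - b t * z1 t) / \<epsilon> = z2 t" if "t \<in> {0<..<1}" for t
    using z_ode[of t] that eps by (simp add: field_simps)
  have "((\<lambda>t. (c t * z t - g0 t - b t * z1 t) / \<epsilon>) has_real_derivative z3 t) (at t)" if t: "0 < t" "t < 1" for t
    unfolding z3_def by (rule DERIV_cdivide) (auto intro!: derivative_eq_intros 1 2 g0 deriv_b deriv_c t simp: algebra_simps)
  then have 3: "(z2 has_real_derivative z3 t) (at t)" if t: "0 < t" "t < 1" for t
    using t by (auto intro: has_field_derivative_transform_within_open[OF _ open_greaterThanLessThan _ z2])
  show "(z has_real_derivative z1 x) (at x)" "(z1 has_real_derivative z2 x) (at x)"
    "(z2 has_real_derivative z3 x) (at x)" using 1 2 3 x by blast+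
  have "((\<lambda>t. (c1 t * z t + c t * z1 t - g1 t - b1 t * z1 t - b t * z2 t) / \<epsilon>) has_real_derivative z4 x) (at x)"
    unfolding z4_def
    by (rule DERIV_cdivide) (auto intro!: derivative_eq_intros 1 2 3 g1 deriv_b deriv_b1 deriv_c deriv_c1 x simp: algebra_simps)
  then show "(z3 has_real_derivative z4 x) (at x)" unfolding z3_def[abs_def] .
qed

lemma cont_z: "continuous_on {0..1} z"
  unfolding z_def[abs_def] E_def using eps by (intro continuous_intros cont_u cont_u0) auto

lemma z_at_0: "z 0 = 0"
  by (simp add: z_def u_bnd E_def \<gamma>_def)

lemma z_at_1: "\<bar>z 1\<bar> \<le> U0 / \<beta> * \<epsilon>"
proof -
  have "\<beta> / \<epsilon> * exp (- (\<beta> / \<epsilon>)) \<le> 1" by (rule mult_exp_neg_le_1)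
  then have "exp (- \<beta> * 1 / \<epsilon>) \<le> \<epsilon> / \<beta>" using eps \<beta>_pos by (simp add: field_simps)
  then have "E 1 \<le> \<epsilon> / \<beta>" using E_le[of 1] by simp
  then have "\<bar>\<gamma> * E 1\<bar> \<le> U0 * (\<epsilon> / \<beta>)" using E_pos[of 1] by (intro abs_mult_bound \<gamma>_bound) auto
  then show ?thesis by (simp add: z_def u_bnd u0_bnd)
qed

text \<open>The source has a part of size \<epsilon> and a layer part of size 1. The operator sends
  \<epsilon> exp(-\<kappa> x/\<epsilon>) to at least \<kappa> (b - \<kappa>) exp(-\<kappa>
  x/\<epsilon>), so a barrier of height O(\<epsilon>) controls the layer part too.\<close>

lemma z_bound:
  assumes x: "x \<in> {0..1}"
  shows "\<bar>z x\<bar> \<le> KZ * \<epsilon>"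
proof -
  \<comment> \<open>In both constants \<open>KG\<close> matches the source and the added 1 yields
    the strict inequality of the maximum principle. \<open>U0\<close> in \<open>P\<close> dominates
    the boundary value of \<open>z\<close> at 1.\<close>
  define P Q where "P = (KG + 1 + U0) / \<beta>" and "Q = 9 * (KG + 1) / (2 * \<beta>\<^sup>2)"
  have PQ: "0 \<le> P" "0 \<le> Q" "P * \<beta> = KG + 1 + U0" "Q * (2 * \<beta>\<^sup>2 / 9) = KG + 1"
    using K_nonneg U_nonneg \<beta>_pos by (auto simp: P_def Q_def)
  define v where "v = (\<lambda>t. P * \<epsilon> * (2 - t) + Q * \<epsilon> * ex t)"
  have "0 \<le> v x + s * z x" if s: "s = 1 \<or> s = -1" for s :: real
  proof (rule maximum_principle[where \<phi> = "\<lambda>t. v t + s * z t" and c = c and b = b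
        and \<phi>' = "\<lambda>t. - P * \<epsilon> - Q * (\<kappa> * ex t) + s * z1 t"
        and \<phi>'' = "\<lambda>t. Q * \<kappa>\<^sup>2 / \<epsilon> * ex t + s * z2 t", OF eps(1) _ _ _ _ _ _ _ x])
    show "continuous_on {0..1} (\<lambda>t. v t + s * z t)"
      unfolding v_def ex_def using eps by (intro continuous_intros cont_z) auto
    show "0 \<le> v 0 + s * z 0" using PQ eps E_pos[of 0] by (simp add: v_def z_at_0)
    have "U0 / \<beta> * \<epsilon> \<le> P * \<epsilon>" unfolding P_def using eps K_nonneg U_nonneg \<beta>_pos
      by (intro mult_right_mono divide_right_mono) auto
    moreover have "0 \<le> Q * \<epsilon> * ex 1" using PQ eps E_pos[of 1] by simp
    moreover have "\<bar>s * z 1\<bar> = \<bar>z 1\<bar>" using s by auto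
    moreover have "v 1 = P * \<epsilon> + Q * \<epsilon> * ex 1" by (simp add: v_def)
    ultimately show "0 \<le> v 1 + s * z 1" using z_at_1 by linarith
    fix t :: real assume t: "0 < t" "t < 1"
    have dex: "(ex has_real_derivative - (\<kappa> / \<epsilon> * ex t)) (at t)"
      unfolding ex_def using eps by (auto intro!: derivative_eq_intros)
    show "((\<lambda>t. v t + s * z t) has_real_derivative - P * \<epsilon> - Q * (\<kappa> * ex t) + s * z1 t) (at t)"
      unfolding v_def using eps by (auto intro!: derivative_eq_intros dex z_deriv t)
    show "((\<lambda>t. - P * \<epsilon> - Q * (\<kappa> * ex t) + s * z1 t) has_real_derivative Q * \<kappa>\<^sup>2 / \<epsilon> * ex t + s * z2 t) (at t)"
      using eps by (auto intro!: derivative_eq_intros dex z_deriv t simp: power2_eq_square)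
    show "0 \<le> c t" using c_nonneg t by simp
    have bt: "\<beta> \<le> b t" using b_ge t by simp
    have "(KG + 1 + U0) * \<epsilon> \<le> b t * (P * \<epsilon>)"
      using mult_right_mono[OF bt, of "P * \<epsilon>"] PQ eps by (simp add: mult_ac flip: PQ(3))
    then have 1: "(KG + 1) * \<epsilon> \<le> b t * (P * \<epsilon>)" using U_nonneg eps by (smt (verit) mult_right_mono)
    have "2 * \<beta>\<^sup>2 / 9 \<le> \<kappa> * (b t - \<kappa>)"
    proof -
      have "\<kappa> * (\<beta> - \<kappa>) \<le> \<kappa> * (b t - \<kappa>)" using bt \<kappa> by (intro mult_left_mono) auto
      moreover have "\<kappa> * (\<beta> - \<kappa>) = 2 * \<beta>\<^sup>2 / 9" unfolding \<kappa>(3) by (simp add: \<kappa>_def power2_eq_square)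
      ultimately show ?thesis by simp
    qed
    then have "Q * (2 * \<beta>\<^sup>2 / 9) * ex t \<le> Q * (\<kappa> * (b t - \<kappa>)) * ex t"
      using PQ E_pos[of t] by (intro mult_right_mono mult_left_mono) auto
    then have 2: "(KG + 1) * ex t \<le> Q * (\<kappa> * (b t - \<kappa>)) * ex t" unfolding PQ(4) .
    have "0 \<le> v t" unfolding v_def using PQ eps t E_pos[of t] by simp
    then have 3: "0 \<le> c t * v t" using c_nonneg t by simp
    have "\<bar>s * g0 t\<bar> \<le> KG * (\<epsilon> + ex t)" using g_bounds(1)[OF t] s by auto
    then have "0 < b t * (P * \<epsilon>) + Q * (\<kappa> * (b t - \<kappa>)) * ex t + c t * v t + s * g0 t"
      using 1 2 3 eps E_pos[of t] by (simp add: algebra_simps)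
    also have "\<dots> = - \<epsilon> * (Q * \<kappa>\<^sup>2 / \<epsilon> * ex t + s * z2 t) - b t * (- P * \<epsilon> - Q * (\<kappa> * ex t) + s * z1 t)
        + c t * (v t + s * z t)"
      unfolding z_ode[OF t, symmetric] using eps by (simp add: algebra_simps power2_eq_square)
    finally show "0 < \<dots>" .
  qed
  from this[of 1] this[of "-1"] have "\<bar>z x\<bar> \<le> v x" by auto
  also have "v x \<le> P * \<epsilon> * 2 + Q * \<epsilon> * 1" unfolding v_def
    using PQ eps x ex_le_1[of x] by (intro add_mono mult_left_mono) auto
  also have "\<dots> = KZ * \<epsilon>" by (simp add: KZ_def P_def Q_def algebra_simps)
  finally show ?thesis .
qed

text \<open>The parameter \<delta> is the amplitude of the layer part: 1 in the equation for z' and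
  1/\<epsilon> in the one for z''. Since \<delta> \<ge> 1, the regular source, of size at most K,
  can be charged to the layer constant.\<close>

lemma layer_bound:
  assumes der: "\<And>x. 0 < x \<Longrightarrow> x < 1 \<Longrightarrow> (y has_real_derivative y' x) (at x)"
    and ode: "\<And>x. 0 < x \<Longrightarrow> x < 1 \<Longrightarrow> \<epsilon> * y' x + b x * y x = G x"
    and G: "\<And>x. 0 < x \<Longrightarrow> x < 1 \<Longrightarrow> \<bar>G x\<bar> \<le> K * (\<epsilon> + \<delta> * ex x)"
    and K: "0 \<le> K" "1 \<le> \<delta>" and s: "0 < s" "s < \<epsilon>" "\<bar>y s\<bar> \<le> Y * \<delta>"
    and x: "0 < x" "x < 1"
  shows "\<bar>y x\<bar> \<le> layer_K K Y * (\<epsilon> + \<delta> * ex x)"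
proof -
  have Y: "0 \<le> Y" using s(3) K by (smt (verit) zero_le_mult_iff)
  have "\<bar>y x\<bar> \<le> K * \<epsilon> / \<beta> + (K * \<delta> / (\<beta> - \<kappa>) + exp (2 * M) * (Y * \<delta> + K * \<epsilon> + K * \<delta>)) * exp (- \<kappa> * x / \<epsilon>)"
    by (rule first_order_layer_bound[OF eps cont_b _ \<kappa>(1,2) der ode _ _ _ s x])
      (use b_ge b_bound G K eps in \<open>auto simp: ex_def algebra_simps abs_le_iff\<close>)
  also have "\<dots> = K / \<beta> * \<epsilon> + (3 * K / \<beta> * \<delta> + exp (2 * M) * (Y * \<delta> + K * \<epsilon> + K * \<delta>)) * ex x"
    unfolding \<kappa>(3) ex_def by simp
  also have "\<dots> \<le> layer_K K Y * \<epsilon> + layer_K K Y * \<delta> * ex x"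
  proof (intro add_mono mult_right_mono)
    have 0: "0 \<le> exp (2 * M) * (Y + 2 * K)" "0 \<le> K / \<beta>" using Y K \<beta>_pos by auto
    then show "K / \<beta> \<le> layer_K K Y" unfolding layer_K_def by simp
    have "K * \<epsilon> \<le> K * \<delta>" using K eps by (intro mult_left_mono) auto
    then have "exp (2 * M) * (Y * \<delta> + K * \<epsilon> + K * \<delta>) \<le> exp (2 * M) * ((Y + 2 * K) * \<delta>)"
      by (intro mult_left_mono) (auto simp: algebra_simps)
    moreover have "3 * K / \<beta> * \<delta> \<le> 4 * K / \<beta> * \<delta>"
      using K \<beta>_pos by (intro mult_right_mono divide_right_mono) auto
    ultimately show "3 * K / \<beta> * \<delta> + exp (2 * M) * (Y * \<delta> + K * \<epsilon> + K * \<delta>) \<le> layer_K K Y * \<delta>"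
      unfolding layer_K_def by (simp add: algebra_simps)
  qed (use eps E_pos[of x] in auto)
  finally show ?thesis by (simp add: algebra_simps)
qed

lemma z1_bound:
  assumes x: "0 < x" "x < 1"
  shows "\<bar>z1 x\<bar> \<le> K1 * (\<epsilon> + ex x)"
proof -
  \<comment> \<open>Since z(0) = 0 and z(\<epsilon>) = O(\<epsilon>), the mean slope on
    [0, \<epsilon>] is O(1). This supplies the starting value, and it is here that the gain from
    subtracting the layer function reaches the derivative.\<close>
  obtain s where s: "0 < s" "s < \<epsilon>" "z \<epsilon> - z 0 = (\<epsilon> - 0) * z1 s"
  proof -
    have "continuous_on {0..\<epsilon>} z" using cont_z by (rule continuous_on_subset) (use eps in auto)
    moreover have "z differentiable (at t)" if "0 < t" "t < \<epsilon>" for t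
      using z_deriv(1)[of t] that eps by (auto simp: real_differentiable_def)
    ultimately obtain l t where t: "0 < t" "t < \<epsilon>" "DERIV z t :> l" "z \<epsilon> - z 0 = (\<epsilon> - 0) * l"
      using MVT[OF eps(1)] by blast
    moreover have "l = z1 t" using t eps by (intro DERIV_unique[OF t(3) z_deriv(1)]) auto
    ultimately show ?thesis using that by auto
  qed
  have "\<epsilon> * \<bar>z1 s\<bar> = \<bar>z \<epsilon>\<bar>" using s(3) eps by (simp add: z_at_0 abs_mult)
  also have "\<dots> \<le> \<epsilon> * KZ" using z_bound[of \<epsilon>] eps by (simp add: mult.commute)
  finally have Y: "\<bar>z1 s\<bar> \<le> KZ * 1" using eps by simp
  have "\<bar>z1 x\<bar> \<le> layer_K (M * KZ + KG) KZ * (\<epsilon> + 1 * ex x)"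
  proof (rule layer_bound[OF z_deriv(2) _ _ _ _ s(1,2) Y x])
    fix t :: real assume t: "0 < t" "t < 1"
    show "\<epsilon> * z2 t + b t * z1 t = c t * z t - g0 t" using z_ode[OF t] by linarith
    have "\<bar>c t * z t\<bar> \<le> M * (KZ * \<epsilon>)" using c_bound[of t] z_bound[of t] t by (intro abs_mult_bound) auto
    also have "\<dots> \<le> M * (KZ * (\<epsilon> + ex t))"
      using K_nonneg M_ge_1 E_pos[of t] by (intro mult_left_mono) auto
    finally show "\<bar>c t * z t - g0 t\<bar> \<le> (M * KZ + KG) * (\<epsilon> + 1 * ex t)"
      using abs_diff_bound[OF _ g_bounds(1)[OF t], of "c t * z t" "M * (KZ * (\<epsilon> + ex t))"] by (simp add: algebra_simps)
  qed (use K_nonneg M_ge_1 in auto)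
  then show ?thesis by (simp add: K1_def)
qed

text \<open>The right-hand side of the first-order equation \<epsilon> z''' + b z'' = H, obtained by
  differentiating the equation of \<open>z\<close>.\<close>

definition "H x = c1 x * z x + c x * z1 x - g1 x - b1 x * z1 x"

lemma H_bound:
  assumes x: "0 < x" "x < 1"
  shows "\<bar>H x\<bar> \<le> KH * (\<epsilon> + ex x / \<epsilon>)"
proof -
  define T where "T = \<epsilon> + ex x / \<epsilon>"
  have x01: "x \<in> {0..1}" using x by simp
  have bb: "\<bar>b1 x\<bar> \<le> M" using b_bound[OF x01] by simp
  have cb: "\<bar>c x\<bar> \<le> M" "\<bar>c1 x\<bar> \<le> M" using c_bound[OF x01] by simp_all
  have T: "\<epsilon> \<le> T" "\<epsilon> + ex x \<le> T" using scale_le(1)[of x] E_pos[of x] eps by (auto simp: T_def)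
  have zb: "\<bar>z x\<bar> \<le> KZ * T" using z_bound[OF x01] mult_left_mono[OF T(1) K_nonneg(2)] by linarith
  have z1b: "\<bar>z1 x\<bar> \<le> K1 * T" using z1_bound[OF x] mult_left_mono[OF T(2) K_nonneg(3)] by linarith
  have "\<bar>H x\<bar> \<le> M * (KZ * T) + M * (K1 * T) + KG * T + M * (K1 * T)"
    unfolding H_def using g_bounds(2)[OF x]
    by (intro abs_add_bound abs_diff_bound abs_mult_bound bb cb zb z1b) (simp add: T_def)
  then show ?thesis unfolding T_def[symmetric] by (simp add: KH_def algebra_simps)
qed

lemma z3_eq: "\<epsilon> * z3 x + b x * z2 x = H x"
  unfolding z3_def H_def using eps by simp

lemma z2_bound:
  assumes x: "0 < x" "x < 1"
  shows "\<bar>z2 x\<bar> \<le> K2 * (\<epsilon> + ex x / \<epsilon>)"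
proof -
  \<comment> \<open>Any fixed fraction of \<epsilon> would serve: once z and z' are bounded, the
    equation of \<open>z\<close> itself gives \<epsilon> z''(s) = O(1), hence a starting value of
    order 1/\<epsilon>.\<close>
  define s where "s = \<epsilon> / 2"
  have s: "0 < s" "s < \<epsilon>" "s < 1" using eps by (auto simp: s_def)
  have "\<bar>z2 s\<bar> \<le> (M * KZ + 2 * KG + 2 * (M * K1)) * (1 / \<epsilon>)"
  proof -
    have s01: "s \<in> {0..1}" using s by simp
    have e: "\<epsilon> + ex s \<le> 2" "\<epsilon> \<le> 1" using ex_le_1[of s] s eps by auto
    have "\<bar>g0 s\<bar> \<le> KG * 2" using g_bounds(1)[of s] s mult_left_mono[OF e(1) K_nonneg(1)] by linarith
    moreover have "\<bar>z1 s\<bar> \<le> K1 * 2" using z1_bound[of s] s mult_left_mono[OF e(1) K_nonneg(3)] by linarith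
    then have "\<bar>b s * z1 s\<bar> \<le> M * (K1 * 2)" using b_bound[OF s01] by (intro abs_mult_bound) auto
    moreover have "\<bar>z s\<bar> \<le> KZ" using z_bound[OF s01] mult_left_mono[OF e(2) K_nonneg(2)] by linarith
    then have "\<bar>c s * z s\<bar> \<le> M * KZ" using c_bound[OF s01] by (intro abs_mult_bound) auto
    ultimately have "\<bar>\<epsilon> * z2 s\<bar> \<le> M * KZ + 2 * KG + 2 * (M * K1)" using z_ode[of s] s by linarith
    then show ?thesis using eps by (simp add: abs_mult field_simps)
  qed
  have "\<bar>z2 x\<bar> \<le> layer_K KH (M * KZ + 2 * KG + 2 * (M * K1)) * (\<epsilon> + 1 / \<epsilon> * ex x)"
    by (rule layer_bound[OF z_deriv(3) z3_eq _ _ _ s(1,2) \<open>\<bar>z2 s\<bar> \<le> _\<close> x])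
      (use H_bound K_nonneg eps in auto)
  then show ?thesis by (simp add: K2_def)
qed

lemma z3_bound:
  assumes x: "0 < x" "x < 1"
  shows "\<bar>z3 x\<bar> \<le> K3 * (1 + ex x / \<epsilon>\<^sup>2)"
proof -
  have x01: "x \<in> {0..1}" using x by simp
  have "\<bar>b x * z2 x\<bar> \<le> M * (K2 * (\<epsilon> + ex x / \<epsilon>))" using b_bound[OF x01] z2_bound[OF x] by (intro abs_mult_bound) auto
  from abs_diff_bound[OF H_bound[OF x] this] have "\<bar>\<epsilon> * z3 x\<bar> \<le> K3 * (\<epsilon> + ex x / \<epsilon>)"
    using z3_eq[of x] by (simp add: K3_def algebra_simps)
  also have "\<dots> = \<epsilon> * (K3 * (1 + ex x / \<epsilon>\<^sup>2))" using eps by (simp add: field_simps power2_eq_square)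
  finally show ?thesis using eps by (simp add: abs_mult)
qed

text \<open>Decay of the layer is deliberately discarded. The fourth derivative enters only on the
  fine part, where h^2 \<epsilon> / \<epsilon>^3 is already (h/\<epsilon>)^2.\<close>

lemma z4_bound:
  assumes x: "0 < x" "x < 1"
  shows "\<bar>z4 x\<bar> \<le> K4 / \<epsilon> ^ 3"
proof -
  define T where "T = 1 / \<epsilon>\<^sup>2"
  have x01: "x \<in> {0..1}" using x by simp
  have bb: "\<bar>b x\<bar> \<le> M" "\<bar>b1 x\<bar> \<le> M" "\<bar>b2 x\<bar> \<le> M" using b_bound[OF x01] by simp_all
  have cb: "\<bar>c x\<bar> \<le> M" "\<bar>c1 x\<bar> \<le> M" "\<bar>c2 x\<bar> \<le> M" using c_bound[OF x01] by simp_all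
  have e: "ex x \<le> 1" "0 < ex x" using ex_le_1 x E_pos by auto
  have T1: "1 \<le> T" using eps by (simp add: T_def power_le_one)
  have T2: "ex x / \<epsilon>\<^sup>2 \<le> T" using e eps by (simp add: T_def divide_right_mono)
  have T: "\<epsilon> \<le> T" "\<epsilon> + ex x \<le> 2 * T" "\<epsilon> + ex x / \<epsilon> \<le> 2 * T" "1 + ex x / \<epsilon>\<^sup>2 \<le> 2 * T" "\<epsilon> + ex x / \<epsilon>\<^sup>2 \<le> 2 * T"
    using T1 T2 e eps scale_le(2)[of x] by auto
  have zb: "\<bar>z x\<bar> \<le> KZ * T" using z_bound[OF x01] mult_left_mono[OF T(1) K_nonneg(2)] by linarith
  have z1b: "\<bar>z1 x\<bar> \<le> K1 * (2 * T)" using z1_bound[OF x] mult_left_mono[OF T(2) K_nonneg(3)] by linarith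
  have z2b: "\<bar>z2 x\<bar> \<le> K2 * (2 * T)" using z2_bound[OF x] mult_left_mono[OF T(3) K_nonneg(5)] by linarith
  have z3b: "\<bar>z3 x\<bar> \<le> K3 * (2 * T)" using z3_bound[OF x] mult_left_mono[OF T(4) K_nonneg(6)] by linarith
  have g2b: "\<bar>g2 x\<bar> \<le> KG * (2 * T)" using g_bounds(3)[OF x] mult_left_mono[OF T(5) K_nonneg(1)] by linarith
  have "\<bar>c2 x * z x + 2 * (c1 x * z1 x) + c x * z2 x - g2 x - b2 x * z1 x - 2 * (b1 x * z2 x) - b x * z3 x\<bar>
    \<le> M * (KZ * T) + 2 * (M * (K1 * (2 * T))) + M * (K2 * (2 * T)) + KG * (2 * T) + M * (K1 * (2 * T))
      + 2 * (M * (K2 * (2 * T))) + M * (K3 * (2 * T))"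
    by (intro abs_add_bound abs_diff_bound abs_numeral_mult_bound abs_mult_bound bb cb zb z1b z2b z3b g2b)
  also have "\<dots> = K4 * T" by (simp add: K4_def algebra_simps)
  finally have "\<bar>\<epsilon> * z4 x\<bar> \<le> K4 * T" unfolding z4_def using eps by simp
  also have "\<dots> = \<epsilon> * (K4 / \<epsilon> ^ 3)" unfolding T_def using eps by (simp add: field_simps power2_eq_square power3_eq_cube)
  finally have "\<epsilon> * \<bar>z4 x\<bar> \<le> \<epsilon> * (K4 / \<epsilon> ^ 3)" by (simp only: abs_mult abs_of_pos[OF eps(1)])
  then show ?thesis using mult_le_cancel_left_pos[OF eps(1)] by blast
qed

section \<open>The error on the mesh\<close>

lemma layer_decay:
  assumes t: "0 \<le> t" and far: "3 * \<epsilon> * ln (1 / \<epsilon>) \<le> \<beta> * t"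
  shows "E t \<le> \<epsilon> ^ 3" "ex t \<le> \<epsilon>\<^sup>2"
proof -
  have X: "- (\<beta> * t / \<epsilon>) \<le> 3 * ln \<epsilon>"
    using far eps by (simp add: ln_div field_simps)
  have "E t \<le> exp (- (\<beta> * t / \<epsilon>))" using E_le[OF t] by simp
  also have "\<dots> \<le> exp (3 * ln \<epsilon>)" using X by simp
  also have "\<dots> = \<epsilon> ^ 3" using eps exp_of_nat_mult[of 3 "ln \<epsilon>"] by simp
  finally show "E t \<le> \<epsilon> ^ 3" .
  have "ex t = exp (2 / 3 * - (\<beta> * t / \<epsilon>))" by (simp add: ex_def \<kappa>_def)
  also have "\<dots> \<le> exp (2 * ln \<epsilon>)" using X by simp
  also have "\<dots> = \<epsilon>\<^sup>2" using eps exp_of_nat_mult[of 2 "ln \<epsilon>"] by simp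
  finally show "ex t \<le> \<epsilon>\<^sup>2" .
qed

definition "residual x i = ASI_op \<epsilon> b c x (\<lambda>j. u (x j) - u0 (x j)) i - \<epsilon> * u0'' (x i)"

text \<open>Inside the interval \<epsilon> u0'' is exactly the image of \<gamma> E + z under the
  differential operator. The residual of the scheme is therefore \<gamma> times the truncation error
  on \<open>E\<close> plus the one on \<open>z\<close>, and the two can be estimated by different
  means.\<close>

lemma residual_split:
  assumes "0 < x i" "x i < 1"
  shows "residual x i =
    \<gamma> * (ASI_op \<epsilon> b c x (\<lambda>j. E (x j)) i
      - (- \<epsilon> * ((b 0 / \<epsilon>)\<^sup>2 * E (x i)) - b (x i) * (- (b 0 / \<epsilon>) * E (x i)) + c (x i) * E (x i)))
    + (ASI_op \<epsilon> b c x (\<lambda>j. z (x j)) i - (- \<epsilon> * z2 (x i) - b (x i) * z1 (x i) + c (x i) * z (x i)))"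
proof -
  have "ASI_op \<epsilon> b c x (\<lambda>j. u (x j) - u0 (x j)) i = ASI_op \<epsilon> b c x (\<lambda>j. \<gamma> * E (x j) + 1 * z (x j)) i"
    by (simp add: z_def)
  moreover have "- \<epsilon> * ((b 0 / \<epsilon>)\<^sup>2 * E (x i)) - b (x i) * (- (b 0 / \<epsilon>) * E (x i)) + c (x i) * E (x i) = k0 (x i) * E (x i)"
    unfolding k0_def using eps by (simp add: field_simps power2_eq_square)
  ultimately show ?thesis unfolding residual_def ASI_op_linear z_ode[OF assms] g0_def by (simp add: algebra_simps)
qed

lemma fine_residual:
  assumes i: "0 < i" and h: "0 < h" and x: "x i = real i * h" "x (i - 1) = x i - h" "x (i + 1) = x i + h"
    and x1: "x (i + 1) \<le> 1" and \<Lambda>: "x i * h / \<epsilon> \<le> \<Lambda>"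
  shows "\<bar>residual x i\<bar> \<le> (U0 * layer_const \<beta> M \<Lambda> + (K4 + 2 * (M * K3) + 2 * (M\<^sup>2 * K2))) * (h / \<epsilon>)\<^sup>2"
proof -
  have "1 * h \<le> real i * h" using i h by (intro mult_right_mono) auto
  then have lo: "0 \<le> x i - h" by (simp add: x)
  have hi: "x i + h \<le> 1" using x1 x by simp
  have xi: "0 < x i" "x i < 1" "x i \<in> {0..1}" using lo hi h by auto
  have "\<bar>ASI_op \<epsilon> b c x (\<lambda>j. E (x j)) i
      - (- \<epsilon> * ((b 0 / \<epsilon>)\<^sup>2 * E (x i)) - b (x i) * (- (b 0 / \<epsilon>) * E (x i)) + c (x i) * E (x i))\<bar>
    \<le> layer_const \<beta> M \<Lambda> * (h / \<epsilon>)\<^sup>2"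
    unfolding E_def
    using b_0 b_ge[OF xi(3)] b_bound[OF xi(3)] b_lipschitz[OF xi(1,2)]
    by (intro exponential_truncation[OF eps(1) h \<beta>_pos i x] \<Lambda>) auto
  then have 1: "\<bar>\<gamma> * (ASI_op \<epsilon> b c x (\<lambda>j. E (x j)) i
      - (- \<epsilon> * ((b 0 / \<epsilon>)\<^sup>2 * E (x i)) - b (x i) * (- (b 0 / \<epsilon>) * E (x i)) + c (x i) * E (x i)))\<bar>
    \<le> U0 * (layer_const \<beta> M \<Lambda> * (h / \<epsilon>)\<^sup>2)" by (rule abs_mult_bound[OF \<gamma>_bound])
  have z2: "\<bar>z2 t\<bar> \<le> 2 * K2 / \<epsilon>" if t: "0 < t" "t < 1" for t
  proof -
    have "\<epsilon> \<le> 1 / \<epsilon>" using eps mult_le_one[of \<epsilon> \<epsilon>] by (simp add: le_divide_eq)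
    moreover have "ex t / \<epsilon> \<le> 1 / \<epsilon>" using ex_le_1[of t] t eps by (simp add: divide_right_mono)
    ultimately have "K2 * (\<epsilon> + ex t / \<epsilon>) \<le> K2 * (1 / \<epsilon> + 1 / \<epsilon>)" using K_nonneg by (intro mult_left_mono add_mono) auto
    then show ?thesis using z2_bound[OF t] by (simp add: mult.commute)
  qed
  have z3: "\<bar>z3 t\<bar> \<le> 2 * K3 / \<epsilon>\<^sup>2" if t: "0 < t" "t < 1" for t
  proof -
    have "1 \<le> 1 / \<epsilon>\<^sup>2" using eps by (simp add: power_le_one)
    moreover have "ex t / \<epsilon>\<^sup>2 \<le> 1 / \<epsilon>\<^sup>2" using ex_le_1[of t] t eps by (simp add: divide_right_mono)
    ultimately have "K3 * (1 + ex t / \<epsilon>\<^sup>2) \<le> K3 * (1 / \<epsilon>\<^sup>2 + 1 / \<epsilon>\<^sup>2)" using K_nonneg by (intro mult_left_mono add_mono) auto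
    then show ?thesis using z3_bound[OF t] by (simp add: mult.commute)
  qed
  have "\<bar>ASI_op \<epsilon> b c x (\<lambda>j. z (x j)) i - (- \<epsilon> * z2 (x i) - b (x i) * z1 (x i) + c (x i) * z (x i))\<bar>
    \<le> h\<^sup>2 * (\<epsilon> * (K4 / \<epsilon> ^ 3) + M * (2 * K3 / \<epsilon>\<^sup>2) + M\<^sup>2 * (2 * K2 / \<epsilon>) / \<epsilon>)"
  proof (rule truncation_second_order[OF eps(1) h x(2,3), of z z1 z2 z3 z4])
    show "continuous_on {x i - h..x i + h} z" by (rule continuous_on_subset[OF cont_z]) (use lo hi in auto)
  qed (use lo hi xi b_ge[OF xi(3)] b_bound[OF xi(3)] \<beta>_pos in \<open>auto intro!: z_deriv z2 z3 z4_bound\<close>)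
  also have "\<dots> = (K4 + 2 * (M * K3) + 2 * (M\<^sup>2 * K2)) * (h / \<epsilon>)\<^sup>2"
    using eps by (simp add: field_simps power2_eq_square power3_eq_cube)
  finally have 2: "\<bar>ASI_op \<epsilon> b c x (\<lambda>j. z (x j)) i - (- \<epsilon> * z2 (x i) - b (x i) * z1 (x i) + c (x i) * z (x i))\<bar>
    \<le> (K4 + 2 * (M * K3) + 2 * (M\<^sup>2 * K2)) * (h / \<epsilon>)\<^sup>2" .
  show ?thesis unfolding residual_split[of x i, OF xi(1,2)]
    by (rule order_trans[OF abs_add_bound[OF 1 2]]) (simp add: algebra_simps)
qed

text \<open>Beyond the left end of the stencil E \<le> \<epsilon>^3, so its second and third
  derivatives are O(\<epsilon>) and O(1), the same orders as those of \<open>z\<close>. The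
  first-order estimate then gives \<epsilon> times the stencil width for both parts.\<close>

lemma coarse_residual:
  assumes x: "0 < x (i - 1)" "x (i - 1) < x i" "x i < x (i + 1)" "x (i + 1) \<le> 1"
    and far: "3 * \<epsilon> * ln (1 / \<epsilon>) \<le> \<beta> * x (i - 1)"
  shows "\<bar>residual x i\<bar> \<le> (x (i + 1) - x (i - 1)) * (\<epsilon> * (U0 * (2 * M ^ 3) + 2 * K3 + 2 * (M * K2)))"
proof -
  define d where "d = x (i + 1) - x (i - 1)"
  have xi: "0 < x i" "x i < 1" "x i \<in> {0..1}" using x by auto
  have bi: "0 \<le> b (x i)" "b (x i) \<le> M" using b_ge[OF xi(3)] b_bound[OF xi(3)] \<beta>_pos by auto
  have dec: "E t \<le> \<epsilon> ^ 3" "ex t \<le> \<epsilon>\<^sup>2" if "x (i - 1) < t" for t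
  proof -
    have "\<beta> * x (i - 1) \<le> \<beta> * t" using that \<beta>_pos by simp
    then show "E t \<le> \<epsilon> ^ 3" "ex t \<le> \<epsilon>\<^sup>2" using layer_decay[of t] that x far by auto
  qed
  define B where "B = b 0 / \<epsilon>"
  have B: "0 \<le> B" "B \<le> M / \<epsilon>" unfolding B_def using b_0 eps by (auto simp: divide_right_mono)
  have E: "\<bar>B ^ k * E t\<bar> \<le> (M / \<epsilon>) ^ k * \<epsilon> ^ 3" if "x (i - 1) < t" for t k
    using B dec(1)[OF that] E_pos[of t] by (intro abs_mult_bound) (auto intro: power_mono)
  have dE: "(E has_real_derivative - (B * E t)) (at t)" for t unfolding B_def by (rule deriv_E)
  have "\<bar>ASI_op \<epsilon> b c x (\<lambda>j. E (x j)) i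
      - (- \<epsilon> * (B\<^sup>2 * E (x i)) - b (x i) * (- B * E (x i)) + c (x i) * E (x i))\<bar> \<le> d * (\<epsilon> * M ^ 3 + M * (M\<^sup>2 * \<epsilon>))"
    unfolding d_def
  proof (rule truncation_first_order[OF eps(1) x(2,3), where g = E and ?g1.0 = "\<lambda>t. - B * E t" and ?g2.0 = "\<lambda>t. B\<^sup>2 * E t"
        and ?g3.0 = "\<lambda>t. - (B ^ 3 * E t)"])
    show "continuous_on {x (i - 1)..x (i + 1)} E" unfolding E_def using eps by (intro continuous_intros) auto
    fix t assume t: "x (i - 1) < t"
    show "\<bar>B\<^sup>2 * E t\<bar> \<le> M\<^sup>2 * \<epsilon>" using E[OF t, of 2] eps by (simp add: field_simps power2_eq_square power3_eq_cube)
    show "\<bar>- (B ^ 3 * E t)\<bar> \<le> M ^ 3" using E[OF t, of 3] eps by (simp add: power_divide)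
    show "(E has_real_derivative - B * E t) (at t)" using dE by simp
    show "((\<lambda>t. - B * E t) has_real_derivative B\<^sup>2 * E t) (at t)"
      by (auto intro!: derivative_eq_intros dE simp: power2_eq_square)
    show "((\<lambda>t. B\<^sup>2 * E t) has_real_derivative - (B ^ 3 * E t)) (at t)"
      by (auto intro!: derivative_eq_intros dE simp: power2_eq_square power3_eq_cube)
  qed (rule bi)+
  then have 1: "\<bar>\<gamma> * (ASI_op \<epsilon> b c x (\<lambda>j. E (x j)) i
      - (- \<epsilon> * (B\<^sup>2 * E (x i)) - b (x i) * (- B * E (x i)) + c (x i) * E (x i)))\<bar>
    \<le> U0 * (d * (\<epsilon> * M ^ 3 + M * (M\<^sup>2 * \<epsilon>)))" by (rule abs_mult_bound[OF \<gamma>_bound])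
  have 2: "\<bar>ASI_op \<epsilon> b c x (\<lambda>j. z (x j)) i - (- \<epsilon> * z2 (x i) - b (x i) * z1 (x i) + c (x i) * z (x i))\<bar>
    \<le> d * (\<epsilon> * (K3 * 2) + M * (K2 * (2 * \<epsilon>)))"
    unfolding d_def
  proof (rule truncation_first_order[OF eps(1) x(2,3), of z z1 z2 z3])
    show "continuous_on {x (i - 1)..x (i + 1)} z" by (rule continuous_on_subset[OF cont_z]) (use x in auto)
    fix t assume t: "x (i - 1) < t" "t < x (i + 1)"
    have t01: "0 < t" "t < 1" using t x by auto
    have e: "ex t / \<epsilon> \<le> \<epsilon>" "ex t / \<epsilon>\<^sup>2 \<le> 1" using dec(2)[OF t(1)] eps by (auto simp: divide_le_eq power2_eq_square)
    have "K2 * (\<epsilon> + ex t / \<epsilon>) \<le> K2 * (2 * \<epsilon>)" using e K_nonneg by (intro mult_left_mono) auto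
    then show "\<bar>z2 t\<bar> \<le> K2 * (2 * \<epsilon>)" using z2_bound[OF t01] by linarith
    have "K3 * (1 + ex t / \<epsilon>\<^sup>2) \<le> K3 * 2" using e K_nonneg by (intro mult_left_mono) auto
    then show "\<bar>z3 t\<bar> \<le> K3 * 2" using z3_bound[OF t01] by linarith
    show "(z has_real_derivative z1 t) (at t)" "(z1 has_real_derivative z2 t) (at t)"
      "(z2 has_real_derivative z3 t) (at t)" using z_deriv[OF t01] by blast+
  qed (rule bi)+
  show ?thesis
    using abs_add_bound[OF 1 2] unfolding residual_split[of x i, OF xi(1,2)] B_def[symmetric] d_def[symmetric]
    by (simp add: algebra_simps power2_eq_square power3_eq_cube)
qed

text \<open>With s = \<epsilon>^(-1/2), ln(1/\<epsilon>) = 2 ln s \<le> 2 s. This bounds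
  \<xi>^2/\<epsilon> = (a/\<beta>)^2 \<epsilon> ln(1/\<epsilon>)^2 independently of \<epsilon>, and
  so yields the parameter \<Lambda> of the fine part.\<close>

lemma log_bound: "\<epsilon> * (ln (1 / \<epsilon>))\<^sup>2 \<le> 4"
proof -
  define s where "s = sqrt (1 / \<epsilon>)"
  have s: "0 < s" "s\<^sup>2 = 1 / \<epsilon>" "1 \<le> s" using eps by (auto simp: s_def)
  have "ln (1 / \<epsilon>) = 2 * ln s" using s by (simp add: ln_realpow flip: s(2))
  moreover have "0 \<le> ln s" "ln s \<le> s" using s ln_le_minus_one[of s] by auto
  ultimately have "(ln (1 / \<epsilon>))\<^sup>2 \<le> (2 * s)\<^sup>2" by (intro power_mono) auto
  then have "(ln (1 / \<epsilon>))\<^sup>2 \<le> 4 / \<epsilon>" using s by (simp add: power_mult_distrib)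
  then show ?thesis using eps by (simp add: field_simps)
qed

lemma error_bound:
  fixes N J :: nat and a Q \<xi> :: real and x :: "nat \<Rightarrow> real"
  defines "\<xi> \<equiv> mesh_xi a \<beta> \<epsilon> (1 / \<epsilon>)"
  defines "x \<equiv> mesh_pt N J \<xi>"
  assumes a: "a > 3" and Q: "0 < Q" "Q < 1" and N: "0 < N" and J: "real J = Q * real N"
    and Ja: "3 * real J \<le> a * (real J - 1)" and \<xi>Q: "\<xi> \<le> Q"
    and W: "W 0 = - u0 0" "W N = 0"
    and LW: "\<And>i. 0 < i \<Longrightarrow> i < N \<Longrightarrow> ASI_op \<epsilon> b c x W i = \<epsilon> * u0'' (x i)"
    and i: "i \<le> N"
  shows "\<bar>(u (x i) - u0 (x i)) - W i\<bar>
    \<le> (CF (4 * a\<^sup>2 / \<beta>\<^sup>2) * (a\<^sup>2 * (a + 8)) / (\<beta> ^ 4 * Q\<^sup>2) + 8 * CC / (\<beta> * (1 - Q)))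
      * max (\<epsilon> * \<bar>ln \<epsilon>\<bar> ^ 3 / real N ^ 2) (\<epsilon> / real N)"
proof -
  define L where "L = ln (1 / \<epsilon>)"
  have L: "0 < L" "L = \<bar>ln \<epsilon>\<bar>" using eps by (auto simp: L_def ln_div)
  have \<xi>1: "\<xi> = a * \<epsilon> / \<beta> * L" by (simp add: \<xi>_def mesh_xi_def L_def)
  have "0 < \<xi>" unfolding \<xi>1 using a \<beta>_pos eps L(1) by (intro mult_pos_pos divide_pos_pos) auto
  note \<xi> = \<xi>1 this
  have J0: "0 < real J" using Q N J by simp
  \<comment> \<open>At least two fine intervals are needed, since the stencil at \<open>J\<close>
    must start strictly to the right of 0.\<close>
  have J1: "1 < real J"
  proof (rule ccontr)
    assume "\<not> 1 < real J"
    then have "a * (real J - 1) \<le> 0" using a by (simp add: mult_nonneg_nonpos)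
    then show False using Ja J0 by linarith
  qed
  have "Q * real N < 1 * real N" using Q N by (intro mult_strict_right_mono) auto
  then have JN: "J < N" using J by simp
  have NJ: "real N - real J = (1 - Q) * real N" by (simp add: J algebra_simps)
  define h H where "h = \<xi> / real J" and "H = (1 - \<xi>) / (real N - real J)"
  have h: "0 < h" "h \<le> \<xi>" "h \<le> 1 / real N" and H: "0 < H" "H \<le> 1 / ((1 - Q) * real N)"
  proof -
    show "0 < h" unfolding h_def using \<xi>(2) J0 by (rule divide_pos_pos)
    show "h \<le> \<xi>" using \<xi>(2) J1 by (simp add: h_def divide_le_eq)
    have "h \<le> Q / real J" unfolding h_def using \<xi>Q J0 by (intro divide_right_mono) auto
    then show "h \<le> 1 / real N" using Q by (simp add: J)
    show "0 < H" using \<xi>Q Q N by (simp add: H_def NJ)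
    show "H \<le> 1 / ((1 - Q) * real N)" unfolding H_def NJ using \<xi>(2) Q N by (intro divide_right_mono) auto
  qed
  have x1: "x i = real i * h" if "i \<le> J" for i using that by (simp add: x_def mesh_pt_def h_def)
  have xJ: "x J = \<xi>" using J0 by (simp add: x1 h_def)
  have x2: "x i = x J + real (i - J) * H" if "J \<le> i" for i
    using that xJ by (cases "i = J") (auto simp: x_def mesh_pt_def H_def)
  have xN: "x N = 1" using x2[of N] JN xJ by (simp add: H_def of_nat_diff)
  have step: "x (i + 1) - x i = (if i < J then h else H)" for i
    using x1[of i] x1[of "i + 1"] x2[of i] x2[of "i + 1"] by (cases "i < J") (auto simp: Suc_diff_le algebra_simps)
  have mono: "x i < x (i + 1)" for i using step[of i] h H by (auto split: if_splits)
  have smono: "x i \<le> x j" if "i \<le> j" for i j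
    using that lift_Suc_mono_le[of x i j] mono by (auto intro: less_imp_le)
  have x01: "0 \<le> x i" "x i \<le> 1" if "i \<le> N" for i
    using smono[of 0 i] smono[of i N] x1[of 0] xN that by auto
  define e where "e = (\<lambda>i. 1 * (u (x i) - u0 (x i)) + (- 1) * W i)"
  have Le: "ASI_op \<epsilon> b c x e i = residual x i" if "0 < i" "i < N" for i
    unfolding e_def ASI_op_linear LW[OF that] residual_def by simp
  have e0: "e 0 = 0" "e N = 0" using x1[of 0] xN W u_bnd u0_bnd by (auto simp: e_def)
  define \<Lambda> where "\<Lambda> = 4 * a\<^sup>2 / \<beta>\<^sup>2"
  have fine: "\<bar>ASI_op \<epsilon> b c x e i\<bar> \<le> CF \<Lambda> * (h / \<epsilon>)\<^sup>2" if i: "0 < i" "i < J" for i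
    unfolding Le[OF i(1) less_trans[OF i(2) JN]] CF_def
  proof (rule fine_residual[OF i(1) h(1)])
    show "x i = real i * h" "x (i - 1) = x i - h" "x (i + 1) = x i + h"
      using i step[of "i - 1"] step[of i] x1[of i] less_imp_diff_less[OF i(2), of 1] by auto
    show "x (i + 1) \<le> 1" using x01[of "i + 1"] i JN by simp
    have "x i * h \<le> \<xi> * \<xi>" using smono[of i J] x01[of i] xJ h i JN by (intro mult_mono) auto
    then have "x i * h / \<epsilon> \<le> \<xi> * \<xi> / \<epsilon>" using eps by (simp add: divide_right_mono)
    also have "\<dots> = (a / \<beta>)\<^sup>2 * (\<epsilon> * L\<^sup>2)" unfolding \<xi>(1) using eps by (simp add: power2_eq_square)
    also have "\<dots> \<le> (a / \<beta>)\<^sup>2 * 4" using log_bound unfolding L_def by (intro mult_left_mono) auto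
    finally show "x i * h / \<epsilon> \<le> \<Lambda>" by (simp add: \<Lambda>_def power_divide mult.commute)
  qed
  define A2 where "A2 = 2 * CC / (1 - Q) * (\<epsilon> / real N)"
  have A2: "0 < A2" using C_nonneg Q eps N by (simp add: A2_def)
  have coarse: "\<bar>ASI_op \<epsilon> b c x e i\<bar> \<le> A2" if i: "0 < i" "J \<le> i" "i < N" for i
  proof -
    have Jm: "x (J - 1) = (real J - 1) * h" using J1 by (simp add: x1 of_nat_diff)
    \<comment> \<open>Scaling \<open>Ja\<close> by \<epsilon> L/J turns it into the decay condition
      at the point J - 1. It must hold there and not only at the transition point, because the
      stencil at \<open>J\<close> reaches one fine step back.\<close>
    have "3 * real J * (\<epsilon> * L / real J) \<le> a * (real J - 1) * (\<epsilon> * L / real J)"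
      using Ja eps L(1) J0 by (intro mult_right_mono divide_nonneg_nonneg mult_nonneg_nonneg) auto
    then have "3 * \<epsilon> * L \<le> \<beta> * x (J - 1)" unfolding Jm h_def \<xi>(1) using J0 \<beta>_pos by (simp add: mult_ac)
    also have "\<dots> \<le> \<beta> * x (i - 1)" using smono[OF diff_le_mono[OF i(2), of 1]] \<beta>_pos by simp
    finally have far: "3 * \<epsilon> * ln (1 / \<epsilon>) \<le> \<beta> * x (i - 1)" by (simp add: L_def)
    have "0 < x (J - 1)" unfolding Jm using J1 h by simp
    then have pos: "0 < x (i - 1)" using smono[OF diff_le_mono[OF i(2), of 1]] by simp
    have "\<bar>residual x i\<bar> \<le> (x (i + 1) - x (i - 1)) * (\<epsilon> * (U0 * (2 * M ^ 3) + 2 * K3 + 2 * (M * K2)))"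
      using pos mono[of "i - 1"] mono[of i] x01[of "i + 1"] i by (intro coarse_residual far) auto
    also have "\<dots> \<le> 2 / ((1 - Q) * real N) * (\<epsilon> * CC)"
    proof (intro mult_mono)
      have "1 / real N \<le> 1 / ((1 - Q) * real N)" using Q N by (intro divide_left_mono) (auto simp: mult_le_cancel_right1)
      then show "x (i + 1) - x (i - 1) \<le> 2 / ((1 - Q) * real N)"
        using step[of i] step[of "i - 1"] h H i by (auto split: if_splits)
    qed (use eps Q N K_nonneg U_nonneg M_ge_1 in \<open>auto simp: CC_def\<close>)
    also have "\<dots> = A2" by (simp add: A2_def)
    finally show ?thesis using Le i by simp
  qed
  define m where "m = max (\<epsilon> * \<bar>ln \<epsilon>\<bar> ^ 3 / real N ^ 2) (\<epsilon> / real N)"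
  have "\<bar>e i\<bar> \<le> CF \<Lambda> * (h / \<epsilon>)\<^sup>2 / \<beta> * (x J + 4 * \<epsilon> / \<beta>) + 4 * A2 / \<beta>"
  proof (rule discrete_stability[OF eps(1) \<beta>_pos h(1) H(1) less_imp_le[OF JN] x1 x2 xN _ _ e0 _ A2 fine coarse i])
    show "\<beta> \<le> b (x i)" "0 \<le> c (x i)" if "i \<le> N" for i using b_ge c_nonneg x01[OF that] by auto
  qed (use C_nonneg in auto)
  also have "CF \<Lambda> * (h / \<epsilon>)\<^sup>2 / \<beta> * (x J + 4 * \<epsilon> / \<beta>)
      = CF \<Lambda> * a\<^sup>2 / (\<beta> ^ 4 * Q\<^sup>2) * (a * (\<epsilon> * L ^ 3 / real N ^ 2) + 4 * (\<epsilon> * L\<^sup>2 / real N ^ 2))"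
  proof -
    have eq: "h / \<epsilon> = a * L / (\<beta> * Q * real N)" unfolding h_def \<xi>(1) J using eps by simp
    show ?thesis unfolding xJ \<xi>(1) eq using \<beta>_pos Q N by (simp add: field_simps power2_eq_square power3_eq_cube power4_eq_xxxx)
  qed
  also have "\<dots> \<le> CF \<Lambda> * a\<^sup>2 / (\<beta> ^ 4 * Q\<^sup>2) * (a * m + 4 * (2 * m))"
  proof (intro mult_left_mono add_mono)
    show 1: "\<epsilon> * L ^ 3 / real N ^ 2 \<le> m" by (simp add: m_def L(2))
    have "\<epsilon> * 1 / (real N * real N) \<le> \<epsilon> / (real N * 1)" using eps N by (intro frac_le mult_left_mono) auto
    also have "\<dots> \<le> m" by (simp add: m_def)
    finally have 2: "\<epsilon> * 1 / real N ^ 2 \<le> m" by (simp add: power2_eq_square)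
    \<comment> \<open>The summand 4 \<epsilon>/\<beta> of the barrier bound contributes only the
      square of the logarithm, which its cube does not dominate when \<epsilon> is close to 1. The
      surplus \<epsilon>/N^2 is covered by the other entry \<epsilon>/N of the maximum, hence the
      factor 2.\<close>
    have "L\<^sup>2 \<le> L ^ 3 + 1"
    proof (cases "L \<le> 1")
      case True
      then have "L\<^sup>2 \<le> 1" "0 \<le> L ^ 3" using L(1) by (simp_all add: power_le_one)
      then show ?thesis by linarith
    next
      case False
      then have "L\<^sup>2 \<le> L ^ 3" by (intro power_increasing) auto
      then show ?thesis by linarith
    qed
    then have "\<epsilon> * L\<^sup>2 / real N ^ 2 \<le> \<epsilon> * (L ^ 3 + 1) / real N ^ 2" using eps by (intro divide_right_mono mult_left_mono) auto
    also have "\<dots> = \<epsilon> * L ^ 3 / real N ^ 2 + \<epsilon> * 1 / real N ^ 2" by (simp add: distrib_left add_divide_distrib)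
    finally show "\<epsilon> * L\<^sup>2 / real N ^ 2 \<le> 2 * m" using 1 2 by linarith
  qed (use a C_nonneg \<beta>_pos in auto)
  also have "4 * A2 / \<beta> \<le> 8 * CC / (\<beta> * (1 - Q)) * m"
  proof -
    have "8 * CC / (\<beta> * (1 - Q)) * (\<epsilon> / real N) \<le> 8 * CC / (\<beta> * (1 - Q)) * m"
      using C_nonneg \<beta>_pos Q by (intro mult_left_mono) (auto simp: m_def less_imp_le)
    then show ?thesis by (simp add: A2_def mult_ac)
  qed
  finally have "\<bar>e i\<bar> \<le> CF \<Lambda> * a\<^sup>2 / (\<beta> ^ 4 * Q\<^sup>2) * (a * m + 4 * (2 * m)) + 8 * CC / (\<beta> * (1 - Q)) * m" by simp
  also have "\<dots> = (CF \<Lambda> * (a\<^sup>2 * (a + 8)) / (\<beta> ^ 4 * Q\<^sup>2) + 8 * CC / (\<beta> * (1 - Q))) * m"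
    by (simp add: algebra_simps add_divide_distrib)
  finally show ?thesis by (simp add: e_def m_def \<Lambda>_def)
qed

end

section \<open>Bounds on the data and choice of the uniform constants\<close>

lemma C_k_01_derivatives:
  assumes "C_k_01 4 g"
  shows "\<exists>g1 g2 g3 B. continuous_on {0..1} g \<and>
    (\<forall>x. 0 < x \<and> x < 1 \<longrightarrow> (g has_real_derivative g1 x) (at x) \<and> (g1 has_real_derivative g2 x) (at x)
      \<and> (g2 has_real_derivative g3 x) (at x)) \<and>
    (\<forall>x\<in>{0..1}. \<bar>g x\<bar> \<le> B \<and> \<bar>g1 x\<bar> \<le> B \<and> \<bar>g2 x\<bar> \<le> B \<and> \<bar>g3 x\<bar> \<le> B)"
proof -
  obtain d where d0: "d 0 = g"
    and d: "\<And>j x. j < 4 \<Longrightarrow> x \<in> {0..1} \<Longrightarrow> (d j has_real_derivative d (Suc j) x) (at x within {0..1})"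
    using assms unfolding C_k_01_def by blast
  have der: "(d j has_real_derivative d (Suc j) x) (at x)" if "j < 4" "0 < x" "x < 1" for j x
    using d[of j x] that at_within_Icc_at[of 0 x 1] by auto
  have cont: "continuous_on {0..1} (d j)" if "j < 4" for j
    using d[OF that] by (rule DERIV_continuous_on)
  have "\<exists>B. \<forall>x\<in>{0..1}. \<bar>d j x\<bar> \<le> B" if "j < 4" for j
    using compact_imp_bounded[OF compact_continuous_image[OF cont[OF that] compact_Icc]]
    by (auto simp: bounded_iff)
  then obtain B where B: "\<And>j x. j < 4 \<Longrightarrow> x \<in> {0..1} \<Longrightarrow> \<bar>d j x\<bar> \<le> B j" by metis
  have bd: "\<bar>d j x\<bar> \<le> (\<Sum>j<4. \<bar>B j\<bar>)" if "j < 4" "x \<in> {0..1}" for j x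
  proof -
    have "\<bar>B j\<bar> \<le> (\<Sum>j<4. \<bar>B j\<bar>)" using that by (intro member_le_sum) auto
    then show ?thesis using B[OF that] by linarith
  qed
  show ?thesis
    using cont[of 0] der[of 0] der[of 1] der[of 2] bd[of 0] bd[of 1] bd[of 2] bd[of 3]
    by (intro exI[of _ "d 1"] exI[of _ "d 2"] exI[of _ "d 3"] exI[of _ "\<Sum>j<4. \<bar>B j\<bar>"])
      (simp add: d0 numeral_2_eq_2 numeral_3_eq_3)
qed

theorem theorem5:
  fixes b c f :: "real \<Rightarrow> real" and \<beta> Q a :: real
  assumes "C_k_01 4 b" and "C_k_01 4 c" and "C_k_01 4 f"
    and "\<beta> > 0" and "\<forall>x\<in>{0..1}. b x > \<beta>" and "\<forall>x\<in>{0..1}. c x \<ge> 0"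
    and "Q \<in> \<rat>" and "0 < Q" and "Q < 1"
    and "a > 3"
  shows "\<exists>N0 :: nat. \<exists>C :: real.
    \<forall>\<epsilon> :: real. \<forall>N :: nat. \<forall>u u' u'' u0 u0' u0'' :: real \<Rightarrow> real. \<forall>W :: nat \<Rightarrow> real.
      0 < \<epsilon> \<and> \<epsilon> < 1 \<and> N \<ge> N0 \<and> Q * real N \<in> \<int>
      \<and> mesh_xi a \<beta> \<epsilon> (1 / \<epsilon>) \<le> Q
      \<and> continuous_on {0..1} u \<and> u 0 = 0 \<and> u 1 = 0
      \<and> (\<forall>x\<in>{0<..<1}. (u has_real_derivative u' x) (at x)
            \<and> (u' has_real_derivative u'' x) (at x)
            \<and> - \<epsilon> * u'' x - b x * u' x + c x * u x = f x)
      \<and> continuous_on {0..1} u0 \<and> u0 1 = 0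
      \<and> (\<forall>x\<in>{0<..<1}. (u0 has_real_derivative u0' x) (at x)
            \<and> (u0' has_real_derivative u0'' x) (at x)
            \<and> - b x * u0' x + c x * u0 x = f x)
      \<and> W 0 = - u0 0 \<and> W N = 0
      \<and> (\<forall>i\<in>{1..N-1}.
            ASI_op \<epsilon> b c (mesh_pt N (nat \<lfloor>Q * real N\<rfloor>) (mesh_xi a \<beta> \<epsilon> (1 / \<epsilon>))) W i
            = \<epsilon> * u0'' (mesh_pt N (nat \<lfloor>Q * real N\<rfloor>) (mesh_xi a \<beta> \<epsilon> (1 / \<epsilon>)) i))
      \<longrightarrow> Max ((\<lambda>i. \<bar>(u - u0) (mesh_pt N (nat \<lfloor>Q * real N\<rfloor>) (mesh_xi a \<beta> \<epsilon> (1 / \<epsilon>)) i) - W i\<bar>) ` {0..N})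
          \<le> C * max (\<epsilon> * \<bar>ln \<epsilon>\<bar> ^ 3 / real N ^ 2) (\<epsilon> / real N)"
proof -
  obtain b1 b2 b3 Bb where b: "continuous_on {0..1} b"
    "\<forall>x. 0 < x \<and> x < 1 \<longrightarrow> (b has_real_derivative b1 x) (at x) \<and> (b1 has_real_derivative b2 x) (at x)
      \<and> (b2 has_real_derivative b3 x) (at x)"
    and Bb: "\<forall>x\<in>{0..1}. \<bar>b x\<bar> \<le> Bb \<and> \<bar>b1 x\<bar> \<le> Bb \<and> \<bar>b2 x\<bar> \<le> Bb \<and> \<bar>b3 x\<bar> \<le> Bb"
    using C_k_01_derivatives[OF assms(1)] by blast
  obtain c1 c2 c3 Bc where c: "continuous_on {0..1} c"
    "\<forall>x. 0 < x \<and> x < 1 \<longrightarrow> (c has_real_derivative c1 x) (at x) \<and> (c1 has_real_derivative c2 x) (at x)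
      \<and> (c2 has_real_derivative c3 x) (at x)"
    and Bc: "\<forall>x\<in>{0..1}. \<bar>c x\<bar> \<le> Bc \<and> \<bar>c1 x\<bar> \<le> Bc \<and> \<bar>c2 x\<bar> \<le> Bc \<and> \<bar>c3 x\<bar> \<le> Bc"
    using C_k_01_derivatives[OF assms(2)] by blast
  obtain f1 f2 f3 Bf where f: "continuous_on {0..1} f"
    "\<forall>x. 0 < x \<and> x < 1 \<longrightarrow> (f has_real_derivative f1 x) (at x) \<and> (f1 has_real_derivative f2 x) (at x)
      \<and> (f2 has_real_derivative f3 x) (at x)"
    and Bf: "\<forall>x\<in>{0..1}. \<bar>f x\<bar> \<le> Bf \<and> \<bar>f1 x\<bar> \<le> Bf \<and> \<bar>f2 x\<bar> \<le> Bf \<and> \<bar>f3 x\<bar> \<le> Bf"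
    using C_k_01_derivatives[OF assms(3)] by blast
  define M where "M = max 1 (max Bb (max Bc Bf))"
  have M: "1 \<le> M" "Bb \<le> M" "Bc \<le> M" "Bf \<le> M" by (auto simp: M_def)
  interpret problem_data b b1 b2 b3 c c1 c2 c3 f f1 f2 f3 \<beta> M
  proof
    fix x :: real assume x: "x \<in> {0..1}"
    show "\<beta> \<le> b x" "0 \<le> c x" using assms(5,6) x by (auto simp: less_imp_le)
    show "\<bar>b x\<bar> \<le> M \<and> \<bar>b1 x\<bar> \<le> M \<and> \<bar>b2 x\<bar> \<le> M \<and> \<bar>b3 x\<bar> \<le> M" using bspec[OF Bb x] M by auto
    show "\<bar>c x\<bar> \<le> M \<and> \<bar>c1 x\<bar> \<le> M \<and> \<bar>c2 x\<bar> \<le> M \<and> \<bar>c3 x\<bar> \<le> M" using bspec[OF Bc x] M by auto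
    show "\<bar>f x\<bar> \<le> M \<and> \<bar>f1 x\<bar> \<le> M \<and> \<bar>f2 x\<bar> \<le> M \<and> \<bar>f3 x\<bar> \<le> M" using bspec[OF Bf x] M by auto
  qed (use assms(4) M b c f in auto)
  \<comment> \<open>The condition N \<ge> a/(Q (a - 3)) is equivalent to 3 J \<le> a (J - 1) for J =
    Q N: the excess of a over 3 pays for the loss of one fine step. The added 1 makes N
    positive.\<close>
  define N0 where "N0 = nat \<lceil>a / (Q * (a - 3))\<rceil> + 1"
  define C where "C = CF (4 * a\<^sup>2 / \<beta>\<^sup>2) * (a\<^sup>2 * (a + 8)) / (\<beta> ^ 4 * Q\<^sup>2) + 8 * CC / (\<beta> * (1 - Q))"
  show ?thesis
  proof (rule exI[of _ N0], rule exI[of _ C], intro allI impI, elim conjE)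
    fix \<epsilon> :: real and N :: nat and u u' u'' u0 u0' u0'' :: "real \<Rightarrow> real" and W :: "nat \<Rightarrow> real"
    define J x where "J = nat \<lfloor>Q * real N\<rfloor>" and "x = mesh_pt N J (mesh_xi a \<beta> \<epsilon> (1 / \<epsilon>))"
    assume eps: "0 < \<epsilon>" "\<epsilon> < 1" and N: "N0 \<le> N" "Q * real N \<in> \<int>"
      and \<xi>: "mesh_xi a \<beta> \<epsilon> (1 / \<epsilon>) \<le> Q"
      and u: "continuous_on {0..1} u" "u 0 = 0" "u 1 = 0"
        "\<forall>x\<in>{0<..<1}. (u has_real_derivative u' x) (at x) \<and> (u' has_real_derivative u'' x) (at x)
          \<and> - \<epsilon> * u'' x - b x * u' x + c x * u x = f x"
      and u0: "continuous_on {0..1} u0" "u0 1 = 0"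
        "\<forall>x\<in>{0<..<1}. (u0 has_real_derivative u0' x) (at x) \<and> (u0' has_real_derivative u0'' x) (at x)
          \<and> - b x * u0' x + c x * u0 x = f x"
      and W: "W 0 = - u0 0" "W N = 0"
      and LW: "\<forall>i\<in>{1..N-1}.
        ASI_op \<epsilon> b c (mesh_pt N (nat \<lfloor>Q * real N\<rfloor>) (mesh_xi a \<beta> \<epsilon> (1 / \<epsilon>))) W i
        = \<epsilon> * u0'' (mesh_pt N (nat \<lfloor>Q * real N\<rfloor>) (mesh_xi a \<beta> \<epsilon> (1 / \<epsilon>)) i)"
    interpret layer_problem b b1 b2 b3 c c1 c2 c3 f f1 f2 f3 \<beta> M \<epsilon> u u' u'' u0 u0' u0''
      by unfold_locales (use eps u u0 in auto)
    have N1: "0 < N" using N(1) by (simp add: N0_def)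
    have J: "real J = Q * real N"
      using N(2) assms(8) by (auto simp: J_def Ints_def)
    have "a / (Q * (a - 3)) \<le> real N" using N(1) unfolding N0_def by linarith
    then have "a \<le> real J * (a - 3)" unfolding J using assms(8,10) by (simp add: field_simps)
    then have Ja: "3 * real J \<le> a * (real J - 1)" by (simp add: algebra_simps)
    have "\<bar>(u - u0) (x i) - W i\<bar> \<le> C * max (\<epsilon> * \<bar>ln \<epsilon>\<bar> ^ 3 / real N ^ 2) (\<epsilon> / real N)" if "i \<le> N" for i
      using error_bound[OF assms(10,8,9) N1 J Ja \<xi> W _ that] LW unfolding C_def x_def J_def by simp
    then show "Max ((\<lambda>i. \<bar>(u - u0) (mesh_pt N (nat \<lfloor>Q * real N\<rfloor>) (mesh_xi a \<beta> \<epsilon> (1 / \<epsilon>)) i) - W i\<bar>) ` {0..N})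
        \<le> C * max (\<epsilon> * \<bar>ln \<epsilon>\<bar> ^ 3 / real N ^ 2) (\<epsilon> / real N)"
      unfolding x_def J_def by (intro Max.boundedI) auto
  qed
qed

end
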